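(* Assume (A1)–(A6). Then $\sup_{h\in[0,h_0]}|\widehat C(h)-C(h)-\Delta(h)|=o_p(n^{-1/2})$, where $\Delta(h)=\widetilde C(h)-C(h)$.
   Context: Standing setup. Let $h_0\in(0,1)$ be fixed. Observed data follow $Y_{ij}=m(j/N)+Z_i(j/N)+\sigma(j/N)\varepsilon_{ij}$, $1\le i\le n$, $1\le j\le N$, where $Z_i(x)=\sum_{k\ge1}\xi_{ik}\phi_k(x)$, $x\in[0,1]$, $\phi_k=\sqrt{\lambda_k}\psi_k$ with $\lambda_k,\psi_k$ the eigenvalues/orthonormal eigenfunctions of $G(x,x')=\mathrm{Cov}\{Z_1(x),Z_1(x')\}$; for each $i$ the scores $\{\xi_{ik}\}_k$ are uncorrelated with mean $0$, variance $1$, i.i.d. across $i$; $\varepsilon_{ij}$ i.i.d. mean $0$ variance $1$, independent of the $Z_i$. Covariance stationarity: $G(x,x')=C(|x-x'|)$. Spline order $p$, interior knots $t_\ell=\ell/(J_s+1)$, $\ell=1,\dots,J_s$; $\mathcal S^{(p-2)}$ is the space of splines of order $p$ on these knots with B-spline basis $\{B_{\ell,p}\}_{\ell=1}^{J_s+p}$. Estimators: $\widehat\eta_i=\arg\min_{g\in\mathcal S^{(p-2)}}\sum_{j=1}^N\{Y_{ij}-g(j/N)\}^2$; $\widehat m=n^{-1}\sum_i\widehat\eta_i$; $\widehat Z_i=\widehat\eta_i-\widehat m$; $\widehat C(h)=\frac{1}{1-h}\int_0^{1-h}\frac1n\sum_{i}\widehat Z_i(x)\widehat Z_i(x+h)dx$,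 $\widetilde C(h)=\frac{1}{1-h}\int_0^{1-h}\frac1n\sum_{i}Z_i(x)Z_i(x+h)dx$, $h\in[0,h_0]$. Hölder space $\mathcal H^{(q,\mu)}[0,1]$: functions with $\|\varphi\|_{q,\mu}=\sup_{x\ne y}|\varphi^{(q)}(x)-\varphi^{(q)}(y)|/|x-y|^\mu<\infty$; $\|\varphi\|_\infty=\sup|\varphi|$. Assumptions: (A1) $m\in\mathcal H^{(q,\mu)}[0,1]$, integer $q>0$, $\mu\in(0,1]$; $p^*=q+\mu$. (A2) $\sigma\in\mathcal H^{(0,\nu)}[0,1]$, $\nu\in(0,1]$; $\sup\sigma\le M_\sigma$, $\sup_{[0,h_0]}|C|\le M_0$. (A3) $n\to\infty$ as $N\to\infty$, $n=O(N^\theta)$, $\theta>0$. (A4) $\phi_k\in\mathcal H^{(q,\mu)}$, $\sum_k\|\phi_k\|_{q,\mu}<\infty$, $\sum_k\|\phi_k\|_\infty<\infty$; increasing integers $k_n$ with $\sum_{k>k_n}\|\phi_k\|_\infty=o(n^{-1/2})$, $k_n=O(n^\omega)$, $\omega>0$. (A5) Constants $c_1,c_2>0$, $\gamma_1,\gamma_2>1$, $\beta_1,\beta_2\in(0,1/2)$ and i.i.d. $N(0,1)$ variables $\{U_{ij,\varepsilon}\},\{U_{ik,\xi}\}$ with $\min\{\frac{2(1-\beta_2)p^*}{3+(1+\beta_1)p^*},\frac{2(\nu-\beta_2)}{1+\beta_1}\}>\theta$, $\Pr\{\max_{k\le k_n}\max_{t\le n}|\sum_{i\le t}(\xi_{ik}-U_{ik,\xi})|>n^{\beta_1}\}<c_1n^{-\gamma_1}$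 and $\Pr\{\max_{i\le n}\max_{t\le N}|\sum_{j\le t}(\varepsilon_{ij}-U_{ij,\varepsilon})|>N^{\beta_2}\}<c_2N^{-\gamma_2}$. (A6) $p\ge p^*$; $J_s\asymp N^\gamma d_N$, $d_N+d_N^{-1}=O(\log^\tau N)$, $\tau>0$, with $\max\{\frac{5\theta}{4p^*},\frac{\theta+8\theta\beta_1/(\gamma_1+1+\omega)}{2p^*},1-\nu\}<\gamma<1-\frac\theta2-\beta_2-\frac\theta2\beta_1$. *)

theory Defs
  imports "HOL-Probability.Probability" "HOL-Computational_Algebra.Polynomial"
    "HOL-Library.Landau_Symbols"
begin

definition holder_derivs :: "nat \<Rightarrow> (real \<Rightarrow> real) \<Rightarrow> (nat \<Rightarrow> real \<Rightarrow> real) \<Rightarrow> bool" where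
  "holder_derivs q f D \<longleftrightarrow>
     (\<forall>x\<in>{0..1}. D 0 x = f x) \<and>
     (\<forall>r<q. \<forall>x\<in>{0..1}. (D r has_real_derivative D (Suc r) x) (at x within {0..1}))"

definition holder_quotients :: "nat \<Rightarrow> real \<Rightarrow> (real \<Rightarrow> real) \<Rightarrow> real set" where
  "holder_quotients q mu f =
     (let D = (SOME D. holder_derivs q f D) in
      {\<bar>D q x - D q y\<bar> / \<bar>x - y\<bar> powr mu | x y. x \<in> {0..1} \<and> y \<in> {0..1} \<and> x \<noteq> y})"

definition holder_norm :: "nat \<Rightarrow> real \<Rightarrow> (real \<Rightarrow> real) \<Rightarrow> real" where
  "holder_norm q mu f = Sup (holder_quotients q mu f)"

definition in_holder :: "nat \<Rightarrow> real \<Rightarrow> (real \<Rightarrow> real) \<Rightarrow> bool" where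
  "in_holder q mu f \<longleftrightarrow> (\<exists>D. holder_derivs q f D) \<and> bdd_above (holder_quotients q mu f)"

definition sup_norm01 :: "(real \<Rightarrow> real) \<Rightarrow> real" where
  "sup_norm01 f = (SUP x\<in>{0..1}. \<bar>f x\<bar>)"

definition knot :: "nat \<Rightarrow> nat \<Rightarrow> real" where
  "knot J l = real l / real (J + 1)"

definition spline_space :: "nat \<Rightarrow> nat \<Rightarrow> (real \<Rightarrow> real) set" where
  "spline_space p J =
     {g. \<exists>P :: nat \<Rightarrow> real poly.
          (\<forall>l\<le>J. degree (P l) < p) \<and>
          (\<forall>l\<le>J. \<forall>x. knot J l \<le> x \<and> (x < knot J (Suc l) \<or> (l = J \<and> x = 1))
                     \<longrightarrow> g x = poly (P l) x) \<and>
          (\<forall>l\<in>{1..J}. \<forall>r. r + 2 \<le> p \<longrightarrow>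
              poly ((pderiv ^^ r) (P (l - 1))) (knot J l) = poly ((pderiv ^^ r) (P l)) (knot J l))}"

definition spline_fit :: "nat \<Rightarrow> nat \<Rightarrow> nat \<Rightarrow> (nat \<Rightarrow> real) \<Rightarrow> real \<Rightarrow> real" where
  "spline_fit p J N y =
     (SOME g. g \<in> spline_space p J \<and>
        (\<forall>g'\<in>spline_space p J.
           (\<Sum>j=1..N. (y j - g (real j / real N))^2) \<le> (\<Sum>j=1..N. (y j - g' (real j / real N))^2)))"

definition Zproc :: "(nat \<Rightarrow> nat \<Rightarrow> 'a \<Rightarrow> real) \<Rightarrow> (nat \<Rightarrow> real \<Rightarrow> real) \<Rightarrow> nat \<Rightarrow> real \<Rightarrow> 'a \<Rightarrow> real" where
  "Zproc xi phi i x \<omega> = (\<Sum>k. xi i (Suc k) \<omega> * phi (Suc k) x)"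

definition Gcov :: "'a measure \<Rightarrow> (nat \<Rightarrow> nat \<Rightarrow> 'a \<Rightarrow> real) \<Rightarrow> (nat \<Rightarrow> real \<Rightarrow> real) \<Rightarrow> real \<Rightarrow> real \<Rightarrow> real" where
  "Gcov M xi phi x x' =
     (let Z = (\<lambda>y \<omega>. Zproc xi phi 1 y \<omega>); mu = (\<lambda>y. integral\<^sup>L M (Z y))
      in integral\<^sup>L M (\<lambda>\<omega>. (Z x \<omega> - mu x) * (Z x' \<omega> - mu x')))"

definition Yobs :: "(real \<Rightarrow> real) \<Rightarrow> (real \<Rightarrow> real) \<Rightarrow> (nat \<Rightarrow> nat \<Rightarrow> 'a \<Rightarrow> real) \<Rightarrow> (nat \<Rightarrow> real \<Rightarrow> real)
     \<Rightarrow> (nat \<Rightarrow> nat \<Rightarrow> 'a \<Rightarrow> real) \<Rightarrow> nat \<Rightarrow> nat \<Rightarrow> nat \<Rightarrow> 'a \<Rightarrow> real" where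
  "Yobs m sig xi phi eps N i j \<omega> =
     m (real j / real N) + Zproc xi phi i (real j / real N) \<omega> + sig (real j / real N) * eps i j \<omega>"

definition Zhat :: "nat \<Rightarrow> nat \<Rightarrow> nat \<Rightarrow> nat \<Rightarrow> (nat \<Rightarrow> nat \<Rightarrow> real) \<Rightarrow> nat \<Rightarrow> real \<Rightarrow> real" where
  "Zhat p J N n Y i x =
     spline_fit p J N (Y i) x - (1 / real n) * (\<Sum>i'=1..n. spline_fit p J N (Y i') x)"

definition cov_est :: "nat \<Rightarrow> (nat \<Rightarrow> real \<Rightarrow> real) \<Rightarrow> real \<Rightarrow> real" where
  "cov_est n W h = 1 / (1 - h) * integral {0..1-h} (\<lambda>x. (1 / real n) * (\<Sum>i=1..n. W i x * W i (x + h)))"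

text \<open>X_N = o_p(r_N): for all e, delta > 0, eventually the event |X_N| > e r_N is contained
  in a measurable set of probability < delta (outer probability, so that no measurability
  of the supremum is presupposed).\<close>
definition o_prob :: "'a measure \<Rightarrow> (nat \<Rightarrow> 'a \<Rightarrow> real) \<Rightarrow> (nat \<Rightarrow> real) \<Rightarrow> bool" where
  "o_prob M X r \<longleftrightarrow>
     (\<forall>e>0. \<forall>\<delta>>0. eventually (\<lambda>N. \<exists>A\<in>sets M.
         {\<omega>\<in>space M. \<bar>X N \<omega>\<bar> > e * r N} \<subseteq> A \<and> measure M A < \<delta>) sequentially)"

end

(*
  Fitting by least squares is linear, so the mean function m cancels from Zhat_i, and
  Zhat_i = U_i - mean(U) with U_i = Z_i + R_i + E_i, where R_i is the spline bias of Z_i and E_i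
  the fitted noise. All lag products are bounded through L2 norms on [0,1], which makes the bounds
  uniform in the lag. As soon as every cell between two knots contains p design points, the L2 norm
  of a spline is dominated by its empirical norm on the design. Hence, with rho = J^(-(q+mu)),
    - R_i has squared norm O(rho^2), by spline approximation of the eigenfunctions,
    - E_i has expected squared norm O(J/N), by counting dimensions,
    - mean(U) has expected squared norm O(1/n).
  The delicate term is the mean over i of the products Z_i E_i. Expanding Z_i = sum_k xi_ik phi_k,
  the coefficient of phi_k is the mean over i of xi_ik E_i, whose expected squared norm is
  O(J/(nN)) by orthogonality, so that the term is O(sqrt(J/(nN))) = o(n^(-1/2)). Markov's inequality
  then gives the claim, since rho and J/N are o(n^(-1/2)).
*)
theory Submission
  imports Defs
begin

section \<open>Norm equivalence for splines on the design\<close>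

text \<open>Bounding each product of a curve with its fitted noise separately gives sqrt(J/N), which
  in general is o(n^(-1/2)) only if gam + theta < 1, while the assumptions yield gam + theta/2 < 1.
  The average over the curves must therefore come before the norm; but doing this lag by lag would
  leave a supremum over the lags to control. The way out is that in the expansion of the product the
  averaged noise does not depend on the lag, so that one measurable function of the sample bounds
  the error at all lags. A second obstacle is that the curves are infinite series, with scores
  controlled through second moments. A single summable weight \<open>w k\<close>, the sup norm plus
  the Hoelder norm of an eigenfunction, dominates both its size and its spline approximation error,
  and the sum of \<open>w k\<close> times the squared scores has finite expectation. This one random
  quantity governs convergence, size and smoothness of a curve. The spline space enters through an
  abstract basis that is orthonormal on the design: the fit becomes a projection, and its dimension
  determines the size of the noise.\<close>

lemma poly_lagrange:
  fixes P :: "real poly" and y :: "nat \<Rightarrow> real"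
  assumes inj: "inj_on y {..<p}" and deg: "degree P < p"
  shows "poly P x = (\<Sum>a<p. poly P (y a) * (\<Prod>b\<in>{..<p}-{a}. (x - y b) / (y a - y b)))"
proof -
  define L where "L a = (\<Prod>b\<in>{..<p}-{a}. smult (1 / (y a - y b)) [:- y b, 1:])" for a
  define Q where "Q = (\<Sum>a<p. smult (poly P (y a)) (L a))"
  have pL: "poly (L a) x = (\<Prod>b\<in>{..<p}-{a}. (x - y b) / (y a - y b))" for a x
    by (simp add: L_def poly_prod diff_divide_distrib)
  have degL: "degree (L a) \<le> p - 1" if "a < p" for a
  proof -
    have "degree (L a) \<le> (\<Sum>b\<in>{..<p}-{a}. degree (smult (1 / (y a - y b)) [:- y b, 1:]))"
      unfolding L_def using degree_prod_sum_le[of "{..<p}-{a}" "\<lambda>b. smult (1 / (y a - y b)) [:- y b, 1:]"]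
      by (simp add: o_def)
    also have "\<dots> \<le> (\<Sum>b\<in>{..<p}-{a}. 1)"
      by (rule sum_mono) auto
    finally show ?thesis using that by simp
  qed
  have degQ: "degree Q < p"
  proof -
    have "degree Q \<le> p - 1"
      unfolding Q_def by (rule degree_sum_le) (auto intro!: order.trans[OF degree_smult_le] degL[simplified])
    with deg show ?thesis by simp
  qed
  have Ly: "poly (L a) (y b) = (if a = b then 1 else 0)" if "a < p" "b < p" for a b
  proof (cases "a = b")
    case True
    have "(y a - y c) \<noteq> 0" if "c \<in> {..<p} - {a}" for c
      using inj \<open>a < p\<close> that by (auto simp: inj_on_def)
    then show ?thesis using True by (simp add: pL)
  next
    case False
    then have "b \<in> {..<p} - {a}" using that by auto
    then have "(\<Prod>c\<in>{..<p}-{a}. (y b - y c) / (y a - y c)) = 0"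
      by (intro prod_zero) auto
    then show ?thesis using False by (simp add: pL)
  qed
  have "P = Q"
  proof (rule poly_eqI_degree)
    fix x assume "x \<in> y ` {..<p}"
    then obtain b where b: "b < p" "x = y b" by auto
    have "poly Q x = (\<Sum>a<p. poly P (y a) * (if a = b then 1 else 0))"
      unfolding Q_def b(2) poly_sum poly_smult
      by (rule sum.cong) (use Ly b in auto)
    also have "\<dots> = poly P x" using b by (simp add: if_distrib cong: if_cong)
    finally show "poly P x = poly Q x" by simp
  next
    show "card (y ` {..<p}) > degree P" "card (y ` {..<p}) > degree Q"
      using deg degQ by (auto simp: card_image[OF inj])
  qed
  then have "poly P x = poly Q x" by simp
  also have "\<dots> = (\<Sum>a<p. poly P (y a) * (\<Prod>b\<in>{..<p}-{a}. (x - y b) / (y a - y b)))"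
    by (simp add: Q_def poly_sum pL)
  finally show ?thesis .
qed

text \<open>The $pm$ consecutive design points split into $m$ arithmetic progressions of length $p$ and step
  $m/N$. Lagrange interpolation on each of them bounds $P(x)$, and averaging over the $m$ progressions
  turns this into a bound by the mean square over all the points.\<close>

lemma poly_square_le_design:
  fixes P :: "real poly" and h :: real
  assumes deg: "degree P < p" and m: "m > 0" and N: "N > 0"
    and x: "\<And>i. i \<in> {1..p*m} \<Longrightarrow> \<bar>x - real (j0 + i) / real N\<bar> \<le> h"
  shows "(poly P x)\<^sup>2 \<le> real p * (h * real N / real m) ^ (2*(p-1)) / real m *
           (\<Sum>i=1..p*m. (poly P (real (j0 + i) / real N))\<^sup>2)"
proof -
  define B where "B = (h * real N / real m) ^ (2*(p-1))"
  have p: "p > 0" using deg by simp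
  have h0: "h \<ge> 0" using x[of 1] p m by (auto intro: order.trans[OF abs_ge_zero])
  define f where "f i = (poly P (real (j0 + i) / real N))\<^sup>2" for i
  have one: "(poly P x)\<^sup>2 \<le> real p * B * (\<Sum>a<p. f (s + a*m))" if s: "s \<in> {1..m}" for s
  proof -
    define y where "y a = real (j0 + (s + a*m)) / real N" for a
    have ydiff: "\<bar>y a - y b\<bar> \<ge> real m / real N" if "a \<noteq> b" for a b
    proof -
      have "y a - y b = (real a - real b) * real m / real N"
        using N by (simp add: y_def field_simps)
      then have "\<bar>y a - y b\<bar> = \<bar>real a - real b\<bar> * (real m / real N)"
        by (simp add: abs_mult)
      moreover have "1 * (real m / real N) \<le> \<bar>real a - real b\<bar> * (real m / real N)"
        using that by (intro mult_right_mono) auto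
      ultimately show ?thesis by simp
    qed
    have mN: "real m / real N > 0" using m N by simp
    have inj: "inj_on y {..<p}"
      using ydiff mN by (intro inj_onI) (metis abs_zero diff_self not_less)
    have xy: "\<bar>x - y a\<bar> \<le> h" if "a < p" for a
    proof -
      have "Suc a * m \<le> p * m" using that by (intro mult_le_mono1) simp
      then have "s + a*m \<in> {1..p*m}" using s by auto
      from x[OF this] show ?thesis by (simp add: y_def)
    qed
    define c where "c a = (\<Prod>b\<in>{..<p}-{a}. (x - y b) / (y a - y b))" for a
    have c: "(c a)\<^sup>2 \<le> B" if a: "a < p" for a
    proof -
      have "\<bar>c a\<bar> = (\<Prod>b\<in>{..<p}-{a}. \<bar>(x - y b) / (y a - y b)\<bar>)"
        by (simp add: c_def abs_prod)
      also have "\<dots> \<le> (\<Prod>b\<in>{..<p}-{a}. h / (real m / real N))"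
      proof (rule prod_mono, safe)
        fix b assume b: "b < p" "b \<noteq> a"
        show "\<bar>(x - y b) / (y a - y b)\<bar> \<le> h / (real m / real N)"
          unfolding abs_divide
          by (rule frac_le) (use ydiff[of a b] b xy[of b] h0 mN in auto)
      qed auto
      also have "\<dots> = (h * real N / real m) ^ (p-1)"
        using a by simp
      finally have "\<bar>c a\<bar>^2 \<le> ((h * real N / real m) ^ (p-1))^2"
        by (rule power_mono) simp
      also have "\<dots> = B" by (simp add: B_def power_mult [symmetric] mult.commute)
      finally show ?thesis by simp
    qed
    have "(poly P x)\<^sup>2 = (\<Sum>a<p. c a * poly P (y a))\<^sup>2"
      by (subst poly_lagrange[OF inj deg, of x]) (simp add: c_def mult.commute)
    also have "\<dots> \<le> (\<Sum>a<p. (c a)\<^sup>2) * (\<Sum>a<p. (poly P (y a))\<^sup>2)"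
      by (rule Cauchy_Schwarz_ineq_sum)
    also have "\<dots> \<le> (\<Sum>a<p. B) * (\<Sum>a<p. (poly P (y a))\<^sup>2)"
      by (intro mult_right_mono sum_mono c sum_nonneg) auto
    also have "\<dots> = real p * B * (\<Sum>a<p. f (s + a*m))"
      by (simp add: f_def y_def)
    finally show ?thesis .
  qed
  have "real m * (poly P x)\<^sup>2 = (\<Sum>s=1..m. (poly P x)\<^sup>2)" by simp
  also have "\<dots> \<le> (\<Sum>s=1..m. real p * B * (\<Sum>a<p. f (s + a*m)))"
    by (rule sum_mono) (rule one)
  also have "\<dots> = real p * B * (\<Sum>a<p. \<Sum>s=1..m. f (s + a*m))"
    by (subst sum.swap) (simp add: sum_distrib_left)
  also have "(\<Sum>a<p. \<Sum>s=1..m. f (s + a*m)) = (\<Sum>i=1..p*m. f i)"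
  proof -
    have "(\<Sum>s=1..m. f (s + a*m)) = sum (\<lambda>i. f (Suc i)) {a*m..<a*m+m}" for a
    proof -
      have "(\<Sum>s=1..m. f (s + a*m)) = (\<Sum>s<m. f (Suc s + a*m))"
        by (simp add: sum.atLeast1_atMost_eq)
      also have "\<dots> = sum (\<lambda>i. f (Suc i)) {a*m..<a*m+m}"
        using sum.shift_bounds_nat_ivl[of "\<lambda>i. f (Suc i)" 0 "a*m" m]
        by (simp add: lessThan_atLeast0 add.commute)
      finally show ?thesis .
    qed
    then have "(\<Sum>a<p. \<Sum>s=1..m. f (s + a*m)) = (\<Sum>i<p*m. f (Suc i))"
      by (simp add: sum.nat_group)
    also have "\<dots> = (\<Sum>i=1..p*m. f i)"
      by (simp add: sum.atLeast1_atMost_eq)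
    finally show ?thesis .
  qed
  finally have "(poly P x)\<^sup>2 \<le> real p * B / real m * (\<Sum>i=1..p*m. f i)"
    using m by (simp add: field_simps)
  then show ?thesis by (simp add: B_def f_def)
qed

section \<open>Knots, cells and polynomial pieces\<close>

lemma knot_mono: "l \<le> l' \<Longrightarrow> knot J l \<le> knot J l'"
  by (simp add: knot_def divide_right_mono)

lemma knot_0 [simp]: "knot J 0 = 0" and knot_Suc_J [simp]: "knot J (Suc J) = 1"
  by (auto simp: knot_def)

text \<open>Membership fixes the values on half-open cells only. Agreement of adjacent pieces at the
  interior knots, which is the case \<open>r = 0\<close> of the matching condition and requires
  \<open>p \<ge> 2\<close>, extends each piece to its closed cell.\<close>

lemma spline_space_pieces:
  assumes g: "g \<in> spline_space p J" and p: "p \<ge> 2"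
  obtains P where "\<And>l. l \<le> J \<Longrightarrow> degree (P l) < p"
    "\<And>l x. l \<le> J \<Longrightarrow> x \<in> {knot J l..knot J (Suc l)} \<Longrightarrow> g x = poly (P l) x"
proof -
  from g obtain P where deg: "\<forall>l\<le>J. degree (P l) < p"
    and eq: "\<forall>l\<le>J. \<forall>x. knot J l \<le> x \<and> (x < knot J (Suc l) \<or> (l = J \<and> x = 1)) \<longrightarrow> g x = poly (P l) x"
    and match: "\<forall>l\<in>{1..J}. \<forall>r. r + 2 \<le> p \<longrightarrow>
        poly ((pderiv ^^ r) (P (l - 1))) (knot J l) = poly ((pderiv ^^ r) (P l)) (knot J l)"
    unfolding spline_space_def by blast
  have "g x = poly (P l) x" if l: "l \<le> J" and x: "x \<in> {knot J l..knot J (Suc l)}" for l x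
  proof (cases "x < knot J (Suc l) \<or> l = J \<and> x = 1")
    case True
    then show ?thesis using eq l x by auto
  next
    case False
    then have x': "x = knot J (Suc l)" and lJ: "l < J"
      using x l by (auto, metis knot_Suc_J le_neq_implies_less)
    have "x < knot J (Suc (Suc l))" unfolding x' by (simp add: knot_def divide_strict_right_mono)
    then have "g x = poly (P (Suc l)) x" using eq lJ x' by auto
    also have "\<dots> = poly (P l) x"
      using match[rule_format, of "Suc l" 0] lJ p x' by simp
    finally show ?thesis .
  qed
  then show ?thesis using that deg by blast
qed

lemma knot_cells: "{0..1} = (\<Union>l\<le>J. {knot J l..knot J (Suc l)})"
proof
  show "{0..1} \<subseteq> (\<Union>l\<le>J. {knot J l..knot J (Suc l)})"
  proof
    fix x :: real assume x: "x \<in> {0..1}"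
    show "x \<in> (\<Union>l\<le>J. {knot J l..knot J (Suc l)})"
    proof (cases "x = 1")
      case True
      then show ?thesis by (auto intro!: bexI[of _ J] simp: knot_def)
    next
      case False
      define l where "l = nat \<lfloor>x * real (J+1)\<rfloor>"
      have l: "real l \<le> x * real (J+1)" "x * real (J+1) < real l + 1"
        using x by (auto simp: l_def)
      have "x * real (J+1) < 1 * real (J+1)" using x False by (intro mult_strict_right_mono) auto
      with l(1) have "real l < real (J+1)" by (simp only: mult_1)
      then have "l < J + 1" by (simp only: of_nat_less_iff)
      moreover have "knot J l \<le> x" "x \<le> knot J (Suc l)"
        using l by (simp_all add: knot_def divide_simps algebra_simps)
      ultimately show ?thesis by (auto intro!: bexI[of _ l])
    qed
  qed
  have "knot J l \<ge> 0" "l \<le> J \<Longrightarrow> knot J (Suc l) \<le> 1" for l by (auto simp: knot_def)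
  then show "(\<Union>l\<le>J. {knot J l..knot J (Suc l)}) \<subseteq> {0..1}" by (auto; meson order_trans)
qed

lemma spline_continuous:
  assumes g: "g \<in> spline_space p J" and p: "p \<ge> 2"
  shows "continuous_on {0..1} g"
proof -
  obtain P where "\<And>l. l \<le> J \<Longrightarrow> degree (P l) < p"
    and eq: "\<And>l x. l \<le> J \<Longrightarrow> x \<in> {knot J l..knot J (Suc l)} \<Longrightarrow> g x = poly (P l) x"
    using spline_space_pieces[OF g p] by blast
  have "continuous_on {knot J l..knot J (Suc l)} g" if "l \<le> J" for l
    by (rule continuous_on_eq[of _ "poly (P l)"]) (use eq that in \<open>auto intro!: continuous_intros\<close>)
  then show ?thesis
    unfolding knot_cells[of J] by (intro continuous_on_closed_Union) auto
qed

text \<open>The leading \<open>p\<close> counts the interpolation nodes. The squared Lagrange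
  coefficients have 2(p-1) factors, each at most 4p; one more 4p turns the reciprocal of the block
  size into (J+1)/N, and the exponent is rounded up to 2p.\<close>

definition spline_const :: "nat \<Rightarrow> real" where
  "spline_const p = real p * (4 * real p) ^ (2 * p)"

section \<open>Comparison of a spline with its values on the design\<close>

context
  fixes p J N :: nat and g :: "real \<Rightarrow> real"
  assumes g: "g \<in> spline_space p J" and p: "p \<ge> 2" and N: "N \<ge> p * (J + 1)"
begin

text \<open>The number of interleaved progressions of \<open>p\<close> design points that fit into
  every cell.\<close>

private definition "cellsize = (N div (J + 1)) div p"
text \<open>The index of the last design point that does not exceed knot \<open>l\<close>; the
  points of the cell thus begin with offset 1.\<close>

private definition "start l = (l * N) div (J + 1)" for l

private lemma cellsize: "cellsize > 0" "4 * p * (J+1) * cellsize \<ge> N" "p * cellsize \<le> N div (J+1)"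
proof -
  have c: "N div (J+1) \<ge> p" using N by (simp add: less_eq_div_iff_mult_less_eq)
  \<comment> \<open>An integer division with nonzero quotient loses less than a factor 2. It is
    applied to both divisions in \<open>cellsize\<close>, which produces the 4 in
    \<open>spline_const\<close>.\<close>
  have half: "2 * b * (a div b) \<ge> a" if "a \<ge> b" "b > 0" for a b :: nat
  proof -
    have "a div b \<ge> 1" using that by (simp add: Suc_leI div_greater_zero_iff)
    then have "b \<le> b * (a div b)" by simp
    moreover have "a mod b < b" using that by simp
    moreover have "a = b * (a div b) + a mod b" by simp
    ultimately show ?thesis by linarith
  qed
  show "cellsize > 0" using c p by (simp add: cellsize_def div_greater_zero_iff)
  show "p * cellsize \<le> N div (J+1)" by (simp add: cellsize_def)
  have "J + 1 \<le> N" using N p by (metis le_trans mult_le_mono1 nat_mult_1 one_le_numeral)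
  then have "N \<le> 2 * (J+1) * (N div (J+1))" by (intro half) auto
  also have "\<dots> \<le> 2 * (J+1) * (2 * p * cellsize)"
    unfolding cellsize_def by (intro mult_le_mono2 half) (use c p in auto)
  finally show "4 * p * (J+1) * cellsize \<ge> N" by (simp add: algebra_simps)
qed

private lemma start_Suc: "start l + p * cellsize \<le> start (Suc l)"
proof -
  have "start l + N div (J+1) \<le> (l * N + N) div (J+1)"
    unfolding start_def by (simp add: div_add1_eq[of "l * N" N])
  also have "\<dots> = start (Suc l)" by (simp add: start_def add.commute)
  finally show ?thesis using cellsize(3) by linarith
qed

private lemma in_cell:
  assumes "i \<in> {1..p * cellsize}"
  shows "real (start l + i) / real N \<in> {knot J l..knot J (Suc l)}"
proof -
  have N0: "N > 0" using N p by (metis add_gr_0 less_le_trans less_numeral_extra(1) mult_pos_pos pos2)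
  have "l * N < (start l + 1) * (J+1)"
    unfolding start_def by (metis Suc_eq_plus1 dividend_less_div_times mult.commute add_Suc_right zero_less_Suc mult_Suc add.commute)
  also have "\<dots> \<le> (start l + i) * (J+1)" using assms by (intro mult_le_mono1) auto
  finally have 1: "real l * real N < real (start l + i) * real (J+1)"
    by (metis of_nat_less_iff of_nat_mult)
  have "(start l + i) * (J+1) \<le> start (Suc l) * (J+1)"
    using assms start_Suc[of l] by (intro mult_le_mono1) auto
  also have "\<dots> \<le> Suc l * N" unfolding start_def by (rule div_times_less_eq_dividend)
  finally have 2: "real (start l + i) * real (J+1) \<le> real (Suc l) * real N"
    by (metis of_nat_le_iff of_nat_mult)
  show ?thesis using 1 2 N0 by (auto simp: knot_def divide_simps simp del: of_nat_Suc of_nat_add)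
qed

text \<open>On one cell the spline is a polynomial, and all points involved lie within the cell
  width 1/(J+1) of \<open>x\<close>. Restricting the sum to points of the same cell is what later
  allows the cells to be added up.\<close>

lemma spline_cell_bound:
  assumes l: "l \<le> J" and x: "x \<in> {knot J l..knot J (Suc l)}"
  shows "(g x)\<^sup>2 \<le> spline_const p * real (J+1) / real N *
           (\<Sum>i=1..p*cellsize. (g (real (start l + i) / real N))\<^sup>2)"
proof -
  obtain P where deg: "\<And>l. l \<le> J \<Longrightarrow> degree (P l) < p"
    and eq: "\<And>l x. l \<le> J \<Longrightarrow> x \<in> {knot J l..knot J (Suc l)} \<Longrightarrow> g x = poly (P l) x"
    using spline_space_pieces[OF g p] by blast
  have N0: "N > 0" using N p by (metis add_gr_0 less_le_trans less_numeral_extra(1) mult_pos_pos pos2)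
  have kn: "knot J (Suc l) - knot J l = 1 / real (J+1)"
    by (simp add: knot_def diff_divide_distrib [symmetric])
  have "(g x)\<^sup>2 = (poly (P l) x)\<^sup>2" using eq l x by simp
  also have "\<dots> \<le> real p * (1 / real (J+1) * real N / real cellsize) ^ (2*(p-1)) / real cellsize *
           (\<Sum>i=1..p*cellsize. (poly (P l) (real (start l + i) / real N))\<^sup>2)"
  proof (rule poly_square_le_design)
    fix i assume "i \<in> {1..p*cellsize}"
    from in_cell[OF this, of l] x kn show "\<bar>x - real (start l + i) / real N\<bar> \<le> 1 / real (J+1)"
      by (auto simp: abs_le_iff simp del: of_nat_add)
  qed (use deg l cellsize N0 in auto)
  also have "(\<Sum>i=1..p*cellsize. (poly (P l) (real (start l + i) / real N))\<^sup>2) =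
      (\<Sum>i=1..p*cellsize. (g (real (start l + i) / real N))\<^sup>2)"
    by (rule sum.cong) (use eq[OF l in_cell] in auto)
  also have "real p * (1 / real (J+1) * real N / real cellsize) ^ (2*(p-1)) / real cellsize
      \<le> spline_const p * real (J+1) / real N"
  proof -
    define c where "c = real cellsize"
    have c: "c > 0" "real N \<le> 4 * real p * real (J+1) * c"
      using cellsize(1,2) unfolding c_def by (simp, metis of_nat_le_iff of_nat_mult of_nat_numeral)
    have a: "1 / real (J+1) * real N / c \<le> 4 * real p"
      using c by (simp add: divide_simps mult_ac)
    have b: "1 / c \<le> 4 * real p * real (J+1) / real N"
      using c N0 by (simp add: divide_simps mult_ac)
    have "real p * (1 / real (J+1) * real N / c) ^ (2*(p-1)) / c
        = real p * ((1 / real (J+1) * real N / c) ^ (2*(p-1)) * (1 / c))" by simp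
    also have "\<dots> \<le> real p * ((4 * real p) ^ (2*(p-1)) * (4 * real p * real (J+1) / real N))"
      by (intro mult_left_mono mult_mono power_mono a b) (use c in auto)
    also have "\<dots> = real p * (4 * real p) ^ (Suc (2*(p-1))) * real (J+1) / real N"
      by simp
    also have "\<dots> \<le> real p * (4 * real p) ^ (2*p) * real (J+1) / real N"
      by (intro divide_right_mono mult_right_mono mult_left_mono power_increasing) (use p in auto)
    finally show ?thesis by (simp add: spline_const_def c_def)
  qed
  finally show ?thesis by (simp add: mult_right_mono sum_nonneg)
qed

text \<open>The blocks of different cells are disjoint by \<open>start_Suc\<close>, and the design
  points skipped between two blocks only add nonnegative terms.\<close>

private lemma sum_cells:
  fixes f :: "nat \<Rightarrow> real"
  assumes f: "\<And>j. f j \<ge> 0"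
  shows "(\<Sum>l<L. \<Sum>i=1..p*cellsize. f (start l + i)) \<le> (\<Sum>j=1..start L. f j)"
proof (induction L)
  case 0
  then show ?case by (simp add: start_def)
next
  case (Suc L)
  have "(\<Sum>i=1..p*cellsize. f (start L + i)) = (\<Sum>j\<in>{start L + 1..start L + p*cellsize}. f j)"
    using sum.shift_bounds_cl_nat_ivl[of f 1 "start L" "p*cellsize"] by (simp add: add.commute)
  also have "\<dots> \<le> (\<Sum>j\<in>{start L + 1..start (Suc L)}. f j)"
    by (rule sum_mono2) (use start_Suc[of L] f in auto)
  finally have "(\<Sum>l<Suc L. \<Sum>i=1..p*cellsize. f (start l + i))
      \<le> (\<Sum>j=1..start L. f j) + (\<Sum>j\<in>{start L + 1..start (Suc L)}. f j)"
    using Suc by simp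
  also have "\<dots> = (\<Sum>j=1..start (Suc L). f j)"
    using start_Suc[of L] sum.ub_add_nat[of 1 "start L" f "start (Suc L) - start L"] by simp
  finally show ?case .
qed

text \<open>Serves two purposes: a spline that vanishes on the design vanishes on the whole
  interval, which makes the least-squares fit unique there, and the factor \<open>J + 1\<close>
  bounds the dimension of the space.\<close>

lemma spline_pointwise_bound:
  assumes x: "x \<in> {0..1}"
  shows "(g x)\<^sup>2 \<le> spline_const p * real (J+1) / real N * (\<Sum>j=1..N. (g (real j / real N))\<^sup>2)"
proof -
  define f where "f j = (g (real j / real N))\<^sup>2" for j
  have f: "f j \<ge> 0" for j by (simp add: f_def)
  obtain l where l: "l \<le> J" "x \<in> {knot J l..knot J (Suc l)}" using x unfolding knot_cells[of J] by auto
  have cell: "(g x)\<^sup>2 \<le> spline_const p * real (J+1) / real N * (\<Sum>i=1..p*cellsize. f (start l + i))"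
    using spline_cell_bound[OF l] by (simp add: f_def)
  have "(\<Sum>i=1..p*cellsize. f (start l + i)) \<le> (\<Sum>l<Suc J. \<Sum>i=1..p*cellsize. f (start l + i))"
    by (rule member_le_sum[of l "{..<Suc J}" "\<lambda>l. \<Sum>i=1..p*cellsize. f (start l + i)"])
       (use l f in \<open>auto intro: sum_nonneg\<close>)
  also have "\<dots> \<le> (\<Sum>j=1..start (Suc J). f j)" by (rule sum_cells) (rule f)
  also have "start (Suc J) = N" unfolding start_def by (metis Suc_eq_plus1 nonzero_mult_div_cancel_left nat.distinct(1))
  finally have "spline_const p * real (J+1) / real N * (\<Sum>i=1..p*cellsize. f (start l + i))
      \<le> spline_const p * real (J+1) / real N * (\<Sum>j=1..N. f j)"
    by (rule mult_left_mono) (use p in \<open>simp add: spline_const_def\<close>)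
  with cell show ?thesis by (simp add: f_def)
qed

text \<open>Integrating the bound of each cell gains the cell length 1/(J+1), which cancels the
  factor \<open>J + 1\<close> of the pointwise bound. The mean squares are thus compared with a
  constant that depends on \<open>p\<close> alone.\<close>

lemma spline_integral_bound:
  "integral {0..1} (\<lambda>x. (g x)\<^sup>2) \<le> spline_const p / real N * (\<Sum>j=1..N. (g (real j / real N))\<^sup>2)"
proof -
  define f where "f j = (g (real j / real N))\<^sup>2" for j
  have f: "f j \<ge> 0" for j by (simp add: f_def)
  have cont: "continuous_on {0..1} (\<lambda>x. (g x)\<^sup>2)"
    by (intro continuous_intros spline_continuous[OF g p])
  have split: "integral {0..knot J L} (\<lambda>x. (g x)\<^sup>2) =
      (\<Sum>l<L. integral {knot J l..knot J (Suc l)} (\<lambda>x. (g x)\<^sup>2))" if "L \<le> Suc J" for L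
    using that
  proof (induction L)
    case (Suc L)
    have "(\<lambda>x. (g x)\<^sup>2) integrable_on {0..knot J (Suc L)}"
      by (rule integrable_continuous_real, rule continuous_on_subset[OF cont])
         (use knot_mono[of "Suc L" "Suc J" J] Suc.prems in auto)
    then have "integral {0..knot J (Suc L)} (\<lambda>x. (g x)\<^sup>2) =
       integral {0..knot J L} (\<lambda>x. (g x)\<^sup>2) + integral {knot J L..knot J (Suc L)} (\<lambda>x. (g x)\<^sup>2)"
      by (intro Henstock_Kurzweil_Integration.integral_combine[symmetric])
         (use knot_mono[of 0 L J] knot_mono[of L "Suc L" J] in auto)
    then show ?case using Suc by simp
  qed auto
  have kn: "knot J (Suc l) - knot J l = 1 / real (J+1)" for l
    by (simp add: knot_def diff_divide_distrib [symmetric])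
  have cell: "integral {knot J l..knot J (Suc l)} (\<lambda>x. (g x)\<^sup>2)
      \<le> spline_const p / real N * (\<Sum>i=1..p*cellsize. f (start l + i))" if l: "l \<le> J" for l
  proof -
    define B where "B = spline_const p * real (J+1) / real N * (\<Sum>i=1..p*cellsize. f (start l + i))"
    have "(\<lambda>x. (g x)\<^sup>2) integrable_on {knot J l..knot J (Suc l)}"
      by (rule integrable_continuous_real, rule continuous_on_subset[OF cont])
         (use knot_mono[of "Suc l" "Suc J" J] knot_mono[of 0 l J] l in auto)
    then have "integral {knot J l..knot J (Suc l)} (\<lambda>x. (g x)\<^sup>2)
        \<le> integral {knot J l..knot J (Suc l)} (\<lambda>x. B)"
      by (rule integral_le) (use spline_cell_bound[OF l] in \<open>auto simp: B_def f_def\<close>)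
    also have "\<dots> = B / real (J+1)" using kn[of l] knot_mono[of l "Suc l" J] by simp
    finally show ?thesis by (simp add: B_def)
  qed
  have "integral {0..1} (\<lambda>x. (g x)\<^sup>2) = (\<Sum>l<Suc J. integral {knot J l..knot J (Suc l)} (\<lambda>x. (g x)\<^sup>2))"
    using split[of "Suc J"] by simp
  also have "\<dots> \<le> (\<Sum>l<Suc J. spline_const p / real N * (\<Sum>i=1..p*cellsize. f (start l + i)))"
    by (rule sum_mono) (use cell in auto)
  also have "\<dots> = spline_const p / real N * (\<Sum>l<Suc J. \<Sum>i=1..p*cellsize. f (start l + i))"
    by (rule sum_distrib_left [symmetric])
  also have "\<dots> \<le> spline_const p / real N * (\<Sum>j=1..start (Suc J). f j)"
    by (intro mult_left_mono sum_cells f) (use p in \<open>simp add: spline_const_def\<close>)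
  also have "start (Suc J) = N" unfolding start_def by (metis Suc_eq_plus1 nonzero_mult_div_cancel_left nat.distinct(1))
  finally show ?thesis by (simp add: f_def)
qed

end

section \<open>Least-squares spline fits\<close>

lemma spline_space_zero: "p > 0 \<Longrightarrow> (\<lambda>x. 0) \<in> spline_space p J"
  unfolding spline_space_def by (rule CollectI, rule exI[of _ "\<lambda>_. 0"]) auto

lemma spline_space_add:
  assumes "f \<in> spline_space p J" "g \<in> spline_space p J"
  shows "(\<lambda>x. f x + g x) \<in> spline_space p J"
proof -
  from assms obtain P Q where
    "(\<forall>l\<le>J. degree (P l) < p)" "(\<forall>l\<le>J. degree (Q l) < p)"
    "(\<forall>l\<le>J. \<forall>x. knot J l \<le> x \<and> (x < knot J (Suc l) \<or> (l = J \<and> x = 1)) \<longrightarrow> f x = poly (P l) x)"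
    "(\<forall>l\<le>J. \<forall>x. knot J l \<le> x \<and> (x < knot J (Suc l) \<or> (l = J \<and> x = 1)) \<longrightarrow> g x = poly (Q l) x)"
    "(\<forall>l\<in>{1..J}. \<forall>r. r + 2 \<le> p \<longrightarrow>
        poly ((pderiv ^^ r) (P (l - 1))) (knot J l) = poly ((pderiv ^^ r) (P l)) (knot J l))"
    "(\<forall>l\<in>{1..J}. \<forall>r. r + 2 \<le> p \<longrightarrow>
        poly ((pderiv ^^ r) (Q (l - 1))) (knot J l) = poly ((pderiv ^^ r) (Q l)) (knot J l))"
    unfolding spline_space_def mem_Collect_eq by (elim exE conjE) blast
  then show ?thesis
    unfolding spline_space_def mem_Collect_eq
    by (intro exI[of _ "\<lambda>l. P l + Q l"] conjI) (simp_all add: degree_add_less higher_pderiv_add)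
qed

lemma spline_space_scale:
  assumes "f \<in> spline_space p J"
  shows "(\<lambda>x. c * f x) \<in> spline_space p J"
proof -
  from assms obtain P where
    "(\<forall>l\<le>J. degree (P l) < p)"
    "(\<forall>l\<le>J. \<forall>x. knot J l \<le> x \<and> (x < knot J (Suc l) \<or> (l = J \<and> x = 1)) \<longrightarrow> f x = poly (P l) x)"
    "(\<forall>l\<in>{1..J}. \<forall>r. r + 2 \<le> p \<longrightarrow>
        poly ((pderiv ^^ r) (P (l - 1))) (knot J l) = poly ((pderiv ^^ r) (P l)) (knot J l))"
    unfolding spline_space_def by blast
  then show ?thesis
    unfolding spline_space_def mem_Collect_eq
    by (intro exI[of _ "\<lambda>l. smult c (P l)"] conjI)
       (auto simp: higher_pderiv_smult intro: le_less_trans[OF degree_smult_le])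
qed

lemma spline_space_sum:
  assumes "p > 0" "\<And>l. l \<in> A \<Longrightarrow> f l \<in> spline_space p J"
  shows "(\<lambda>x. \<Sum>l\<in>A. c l * f l x) \<in> spline_space p J"
  using assms(2)
proof (induction A rule: infinite_finite_induct)
  case (insert l A)
  have "(\<lambda>x. c l * f l x + (\<Sum>l\<in>A. c l * f l x)) \<in> spline_space p J"
    using insert by (intro spline_space_add spline_space_scale) auto
  then show ?case using insert by simp
qed (use spline_space_zero[OF assms(1)] in auto)

section \<open>The empirical inner product and orthonormal families\<close>

definition dinner :: "nat \<Rightarrow> (nat \<Rightarrow> real) \<Rightarrow> (nat \<Rightarrow> real) \<Rightarrow> real" where
  "dinner N u v = (\<Sum>j=1..N. u j * v j) / real N"

definition grid :: "nat \<Rightarrow> (real \<Rightarrow> real) \<Rightarrow> nat \<Rightarrow> real" where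
  "grid N f j = f (real j / real N)"

lemma dinner_sum_left: "dinner N (\<lambda>j. \<Sum>a\<in>A. f a j) v = (\<Sum>a\<in>A. dinner N (f a) v)"
  unfolding dinner_def sum_distrib_right sum_divide_distrib by (subst sum.swap) simp

lemma dinner_scale_left: "dinner N (\<lambda>j. c * u j) v = c * dinner N u v"
  by (simp add: dinner_def sum_distrib_left mult.assoc)

lemma dinner_commute: "dinner N u v = dinner N v u"
  by (simp add: dinner_def mult.commute)

lemma dinner_add_left: "dinner N (\<lambda>j. u j + u' j) v = dinner N u v + dinner N u' v"
  by (simp add: dinner_def sum.distrib distrib_right add_divide_distrib)

lemma dinner_diff_left: "dinner N (\<lambda>j. u j - u' j) v = dinner N u v - dinner N u' v"
  by (simp add: dinner_def sum_subtractf left_diff_distrib diff_divide_distrib)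

lemma dinner_scale_right: "dinner N u (\<lambda>j. c * v j) = c * dinner N u v"
  by (simp add: dinner_def sum_distrib_left mult_ac)

lemma dinner_diff_right: "dinner N u (\<lambda>j. v j - v' j) = dinner N u v - dinner N u v'"
  by (simp add: dinner_def sum_subtractf right_diff_distrib diff_divide_distrib)

lemma dinner_self_nonneg: "dinner N u u \<ge> 0"
  by (simp add: dinner_def sum_nonneg)

lemma dinner_self_eq_0: "N > 0 \<Longrightarrow> dinner N u u = 0 \<Longrightarrow> j \<in> {1..N} \<Longrightarrow> u j = 0"
  by (auto simp: dinner_def sum_nonneg_eq_0_iff)

definition orthonormal :: "nat \<Rightarrow> nat \<Rightarrow> (nat \<Rightarrow> nat \<Rightarrow> real) \<Rightarrow> bool" where
  "orthonormal N K E \<longleftrightarrow> (\<forall>l<K. \<forall>l'<K. dinner N (E l) (E l') = (if l = l' then 1 else 0))"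

lemma dinner_expansion:
  assumes "orthonormal N K E" "l < K"
  shows "dinner N (\<lambda>j. \<Sum>l<K. c l * E l j) (E l) = c l"
proof -
  have "dinner N (\<lambda>j. \<Sum>l<K. c l * E l j) (E l) = (\<Sum>l'<K. c l' * (if l' = l then 1 else 0))"
    unfolding dinner_sum_left dinner_scale_left
    by (rule sum.cong) (use assms in \<open>auto simp: orthonormal_def\<close>)
  also have "\<dots> = c l" using assms by (simp add: if_distrib cong: if_cong)
  finally show ?thesis .
qed

lemma dinner_expansion_self:
  assumes "orthonormal N K E"
  shows "dinner N (\<lambda>j. \<Sum>l<K. c l * E l j) (\<lambda>j. \<Sum>l<K. c l * E l j) = (\<Sum>l<K. (c l)\<^sup>2)"
proof -
  have "dinner N (\<lambda>j. \<Sum>l<K. c l * E l j) (\<lambda>j. \<Sum>l<K. c l * E l j)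
      = (\<Sum>l<K. c l * dinner N (E l) (\<lambda>j. \<Sum>l<K. c l * E l j))"
    by (subst dinner_sum_left) (simp add: dinner_scale_left)
  also have "\<dots> = (\<Sum>l<K. c l * c l)"
    by (rule sum.cong) (use dinner_expansion[OF assms, of _ c] in \<open>auto simp: dinner_commute[of N "E _" "\<lambda>j. \<Sum>l<K. c l * E l j"]\<close>)
  finally show ?thesis by (simp add: power2_eq_square)
qed

lemma dinner_bessel:
  assumes "orthonormal N K E"
  shows "(\<Sum>l<K. (dinner N u (E l))\<^sup>2) \<le> dinner N u u"
proof -
  define w where "w j = (\<Sum>l<K. dinner N u (E l) * E l j)" for j
  have ww: "dinner N w w = (\<Sum>l<K. (dinner N u (E l))\<^sup>2)"
    unfolding w_def by (rule dinner_expansion_self[OF assms])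
  have wu: "dinner N w u = (\<Sum>l<K. (dinner N u (E l))\<^sup>2)"
    unfolding w_def dinner_sum_left dinner_scale_left
    by (simp add: power2_eq_square dinner_commute[of N "E _" u])
  have "0 \<le> dinner N (\<lambda>j. u j - w j) (\<lambda>j. u j - w j)" by (rule dinner_self_nonneg)
  also have "\<dots> = dinner N u u - dinner N w u - (dinner N w u - dinner N w w)"
    by (simp add: dinner_diff_left dinner_diff_right dinner_commute[of N u w])
  finally show ?thesis using ww wu by simp
qed

text \<open>Bessel's inequality for the indicator of a design point bounds the sum over
  \<open>l\<close> of \<open>(E l j)^2\<close> by \<open>N\<close>; averaging over the design turns
  the left-hand side into \<open>K\<close>. This guarantees that a maximal orthonormal family
  exists.\<close>

lemma orthonormal_card_le:
  assumes E: "orthonormal N K E" and N: "N > 0"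
  shows "K \<le> N"
proof -
  have *: "(\<Sum>l<K. (E l j)\<^sup>2) \<le> real N" if j: "j \<in> {1..N}" for j
  proof -
    have d: "dinner N (\<lambda>i. if i = j then 1 else 0) v = v j / real N" for v
      using j by (simp add: dinner_def if_distrib[of "\<lambda>x. x * _"] cong: if_cong)
    have "(\<Sum>l<K. (E l j / real N)\<^sup>2) \<le> 1 / real N"
      using dinner_bessel[OF E, of "\<lambda>i. if i = j then 1 else 0"] unfolding d by simp
    then show ?thesis using N
      by (simp add: power_divide sum_divide_distrib[symmetric] divide_simps power2_eq_square)
  qed
  have "real K = (\<Sum>l<K. dinner N (E l) (E l))"
    using E by (simp add: orthonormal_def)
  also have "\<dots> = (\<Sum>j=1..N. \<Sum>l<K. (E l j)\<^sup>2) / real N"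
    unfolding dinner_def sum_divide_distrib[symmetric]
    by (subst sum.swap) (simp add: power2_eq_square)
  also have "\<dots> \<le> (\<Sum>j=1..N. real N) / real N"
    by (intro divide_right_mono sum_mono) (use * in auto)
  also have "\<dots> = real N" using N by simp
  finally show ?thesis by simp
qed

text \<open>Takes the place of the B-spline basis, without a Gram matrix to invert. Completeness is
  required on the design only; together with orthonormality it makes \<open>K\<close> the dimension
  of the splines restricted to the design. The condition on \<open>N\<close> puts at least
  \<open>p\<close> design points into every cell.\<close>

locale spline_basis =
  fixes p J N K :: nat and e :: "nat \<Rightarrow> real \<Rightarrow> real"
  assumes p: "p \<ge> 2" and N: "N \<ge> p * (J + 1)"
    and e_spline: "\<And>l. l < K \<Longrightarrow> e l \<in> spline_space p J"
    and e_orthonormal: "orthonormal N K (\<lambda>l. grid N (e l))"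
    and e_complete: "\<And>g j. g \<in> spline_space p J \<Longrightarrow> j \<in> {1..N} \<Longrightarrow>
        grid N g j = (\<Sum>l<K. dinner N (grid N g) (grid N (e l)) * grid N (e l) j)"

lemma spline_basis_exists:
  assumes p: "p \<ge> 2" and N: "N \<ge> p * (J + 1)"
  shows "\<exists>K e. spline_basis p J N K e"
proof -
  have N0: "N > 0" using N p by (metis add_gr_0 less_le_trans less_numeral_extra(1) mult_pos_pos pos2)
  \<comment> \<open>A maximal orthonormal family: its size is at most \<open>N\<close> by Bessel, and Gram-Schmidt would extend it
    by any spline that it does not represent on the design.\<close>
  define good where "good K e \<longleftrightarrow> (\<forall>l<K. e l \<in> spline_space p J) \<and> orthonormal N K (\<lambda>l. grid N (e l))"
    for K and e :: "nat \<Rightarrow> real \<Rightarrow> real"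
  have "good 0 (\<lambda>_ _. 0)" by (simp add: good_def orthonormal_def)
  then have ex: "\<exists>e. good 0 e" by blast
  have bnd: "\<forall>K. (\<exists>e. good K e) \<longrightarrow> K \<le> N"
    unfolding good_def using orthonormal_card_le N0 by blast
  obtain K where "\<exists>e. good K e" and max: "\<And>K'. \<exists>e. good K' e \<Longrightarrow> K' \<le> K"
    using GreatestI_nat[of "\<lambda>K. \<exists>e. good K e" 0 N] Greatest_le_nat[of "\<lambda>K. \<exists>e. good K e" _ N] ex bnd by blast
  then obtain e where e: "good K e" by blast
  note on = e[unfolded good_def, THEN conjunct2]
  have "grid N g j = (\<Sum>l<K. dinner N (grid N g) (grid N (e l)) * grid N (e l) j)"
    if g: "g \<in> spline_space p J" and j: "j \<in> {1..N}" for g j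
  proof (rule ccontr)
    assume ne: "grid N g j \<noteq> (\<Sum>l<K. dinner N (grid N g) (grid N (e l)) * grid N (e l) j)"
    define r where "r x = g x + (\<Sum>l<K. (- dinner N (grid N g) (grid N (e l))) * e l x)" for x
    have r: "r \<in> spline_space p J"
      unfolding r_def by (intro spline_space_add spline_space_sum g) (use p e in \<open>auto simp: good_def\<close>)
    have gr: "grid N r = (\<lambda>j. grid N g j - (\<Sum>l<K. dinner N (grid N g) (grid N (e l)) * grid N (e l) j))"
      by (auto simp: r_def grid_def sum_negf)
    have r0: "dinner N (grid N r) (grid N (e l)) = 0" if "l < K" for l
      using dinner_expansion[OF on that, of "\<lambda>l. dinner N (grid N g) (grid N (e l))"]
      unfolding gr dinner_diff_left by simp
    have pos: "dinner N (grid N r) (grid N r) > 0"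
      using dinner_self_nonneg[of N "grid N r"] dinner_self_eq_0[OF N0 _ j, of "grid N r"] ne
      by (auto simp: gr less_le)
    define s where "s = sqrt (dinner N (grid N r) (grid N r))"
    have s: "s > 0" "s * s = dinner N (grid N r) (grid N r)" using pos by (auto simp: s_def)
    define e' where "e' = e(K := (\<lambda>x. (1/s) * r x))"
    have ge': "grid N (e' K) = (\<lambda>j. (1/s) * grid N r j)" "\<And>l. l < K \<Longrightarrow> e' l = e l"
      by (auto simp: e'_def grid_def)
    have 1: "dinner N (grid N (e' K)) (grid N (e l)) = 0" if "l < K" for l
      unfolding ge' dinner_scale_left r0[OF that] by simp
    have 2: "dinner N (grid N (e' K)) (grid N (e' K)) = 1"
      unfolding ge' dinner_scale_left dinner_scale_right using s by (simp flip: s(2))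
    have "good (Suc K) e'"
      unfolding good_def orthonormal_def
    proof (intro conjI allI impI)
      fix l assume "l < Suc K"
      then show "e' l \<in> spline_space p J"
        using e spline_space_scale[OF r, of "1/s"] by (auto simp: e'_def good_def)
    next
      fix l l' assume "l < Suc K" "l' < Suc K"
      then show "dinner N (grid N (e' l)) (grid N (e' l')) = (if l = l' then 1 else 0)"
        using 1 2 on ge'(2) by (auto simp: less_Suc_eq orthonormal_def dinner_commute[of N "grid N (e _)" "grid N (e' K)"])
    qed
    then have "Suc K \<le> K" using max by blast
    then show False by simp
  qed
  then have "spline_basis p J N K e"
    using p N e by unfold_locales (auto simp: good_def)
  then show ?thesis by blast
qed

section \<open>The least-squares fit as an orthogonal projection\<close>

context spline_basis
begin

abbreviation (input) "E l \<equiv> grid N (e l)"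
definition "coef y l = dinner N y (grid N (e l))"
abbreviation "fit \<equiv> spline_fit p J N"
definition "proj y x = (\<Sum>l<K. coef y l * e l x)"

lemma N0: "N > 0" using N p by (metis add_gr_0 less_le_trans less_numeral_extra(1) mult_pos_pos pos2)

lemma proj_spline: "proj y \<in> spline_space p J"
  unfolding proj_def by (rule spline_space_sum) (use p e_spline in auto)

lemma spline_eqI:
  assumes f: "f \<in> spline_space p J" and g: "g \<in> spline_space p J"
    and eq: "\<And>j. j \<in> {1..N} \<Longrightarrow> grid N f j = grid N g j" and x: "x \<in> {0..1}"
  shows "f x = g x"
proof -
  have "(\<lambda>x. f x + (-1) * g x) \<in> spline_space p J" by (intro spline_space_add spline_space_scale f g)
  from spline_pointwise_bound[OF this p N x] have "(f x + (-1) * g x)\<^sup>2 \<le> 0"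
    using eq by (simp add: grid_def)
  then show ?thesis by simp
qed

text \<open>Pythagoras: the residual is orthogonal to every \<open>E l\<close>, hence by
  completeness to every spline on the design, in particular to the difference of
  \<open>proj y\<close> and \<open>g\<close>.\<close>

lemma proj_best:
  assumes g: "g \<in> spline_space p J"
  shows "(\<Sum>j=1..N. (y j - grid N g j)\<^sup>2)
       = (\<Sum>j=1..N. (y j - grid N (proj y) j)\<^sup>2) + (\<Sum>j=1..N. (grid N (proj y) j - grid N g j)\<^sup>2)"
proof -
  define f where "f x = proj y x + (-1) * g x" for x
  have f: "f \<in> spline_space p J" unfolding f_def by (intro spline_space_add spline_space_scale proj_spline g)
  define r where "r j = y j - grid N (proj y) j" for j
  have gp: "grid N (proj y) = (\<lambda>j. \<Sum>l<K. coef y l * E l j)"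
    by (auto simp: grid_def proj_def)
  have re: "dinner N r (E l) = 0" if "l < K" for l
    unfolding r_def dinner_diff_left gp dinner_expansion[OF e_orthonormal that] coef_def by simp
  have "dinner N r (grid N f) = dinner N r (\<lambda>j. \<Sum>l<K. dinner N (grid N f) (E l) * E l j)"
    unfolding dinner_def[of N r]
    by (intro arg_cong2[of _ _ _ _ "(/)"] sum.cong refl arg_cong2[of _ _ _ _ "(*)"] e_complete[OF f])
  also have "\<dots> = (\<Sum>l<K. dinner N (grid N f) (E l) * dinner N (E l) r)"
    by (subst dinner_commute) (simp add: dinner_sum_left dinner_scale_left)
  also have "\<dots> = 0" using re by (simp add: dinner_commute[of N "E _" r])
  finally have 0: "(\<Sum>j=1..N. r j * grid N f j) = 0" using N0 by (simp add: dinner_def)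
  have "(\<Sum>j=1..N. (y j - grid N g j)\<^sup>2) = (\<Sum>j=1..N. (r j + grid N f j)\<^sup>2)"
    by (simp add: r_def f_def grid_def)
  also have "\<dots> = (\<Sum>j=1..N. (r j)\<^sup>2) + (\<Sum>j=1..N. (grid N f j)\<^sup>2) + 2 * (\<Sum>j=1..N. r j * grid N f j)"
    by (simp add: power2_sum sum.distrib sum_distrib_left mult.assoc)
  finally show ?thesis using 0 by (simp add: r_def f_def grid_def)
qed

text \<open>The fit is a choice among all minimisers. Pythagoras forces each of them to agree with
  \<open>proj y\<close> on the design, and then \<open>spline_eqI\<close> forces agreement on the
  interval. From here on the fit is linear in the data.\<close>

lemma fit_eq_proj:
  assumes x: "x \<in> {0..1}"
  shows "fit y x = proj y x"
proof -
  have ex: "\<exists>g. g \<in> spline_space p J \<and>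
        (\<forall>g'\<in>spline_space p J.
           (\<Sum>j=1..N. (y j - g (real j / real N))^2) \<le> (\<Sum>j=1..N. (y j - g' (real j / real N))^2))"
  proof (intro exI[of _ "proj y"] conjI ballI proj_spline)
    fix g assume "g \<in> spline_space p J"
    from proj_best[OF this, of y]
    have "(\<Sum>j=1..N. (y j - grid N (proj y) j)^2) \<le> (\<Sum>j=1..N. (y j - grid N g j)^2)"
      using sum_nonneg[of "{1..N}" "\<lambda>j. (grid N (proj y) j - grid N g j)\<^sup>2"] by simp
    then show "(\<Sum>j=1..N. (y j - proj y (real j / real N))^2) \<le> (\<Sum>j=1..N. (y j - g (real j / real N))^2)"
      by (simp only: grid_def)
  qed
  from someI_ex[OF ex] have g: "fit y \<in> spline_space p J"
    and min: "(\<Sum>j=1..N. (y j - grid N (fit y) j)^2) \<le> (\<Sum>j=1..N. (y j - grid N (proj y) j)^2)"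
    using proj_spline[of y] by (simp_all only: grid_def spline_fit_def)
  have "(\<Sum>j=1..N. (grid N (proj y) j - grid N (fit y) j)\<^sup>2) \<le> 0"
    using min proj_best[OF g, of y] by simp
  then have "(\<Sum>j=1..N. (grid N (proj y) j - grid N (fit y) j)\<^sup>2) = 0"
    by (intro antisym sum_nonneg) auto
  then have "grid N (proj y) j = grid N (fit y) j" if "j \<in> {1..N}" for j
    using that by (auto simp: sum_nonneg_eq_0_iff)
  then show ?thesis using spline_eqI[OF g proj_spline _ x] by auto
qed

lemma proj_of_spline:
  assumes g: "g \<in> spline_space p J" and x: "x \<in> {0..1}"
  shows "proj (grid N g) x = g x"
proof (rule spline_eqI[OF proj_spline g _ x])
  fix j assume "j \<in> {1..N}"
  then show "grid N (proj (grid N g)) j = grid N g j"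
    using e_complete[OF g] by (simp add: grid_def proj_def coef_def)
qed

lemma proj_continuous: "continuous_on {0..1} (proj y)"
  by (rule spline_continuous[OF proj_spline p])

lemma proj_integral: "integral {0..1} (\<lambda>x. (proj y x)\<^sup>2) \<le> spline_const p * (\<Sum>l<K. (coef y l)\<^sup>2)"
proof -
  have "grid N (proj y) = (\<lambda>j. \<Sum>l<K. coef y l * E l j)"
    by (auto simp: grid_def proj_def)
  then have "dinner N (grid N (proj y)) (grid N (proj y)) = (\<Sum>l<K. (coef y l)\<^sup>2)"
    using dinner_expansion_self[OF e_orthonormal] by simp
  moreover have "dinner N (grid N (proj y)) (grid N (proj y)) = (\<Sum>j=1..N. (proj y (real j / real N))\<^sup>2) / real N"
    by (simp add: dinner_def grid_def power2_eq_square)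
  ultimately have "(\<Sum>j=1..N. (proj y (real j / real N))\<^sup>2) / real N = (\<Sum>l<K. (coef y l)\<^sup>2)"
    by simp
  then show ?thesis using spline_integral_bound[OF proj_spline p N, of y]
    by (simp only: times_divide_eq_left) (simp only: times_divide_eq_right [symmetric])
qed

lemma coef_bessel: "(\<Sum>l<K. (coef y l)\<^sup>2) \<le> dinner N y y"
  unfolding coef_def by (rule dinner_bessel[OF e_orthonormal])

lemma coef_square_sum: "(\<Sum>l<K. \<Sum>j=1..N. (E l j)\<^sup>2) = real N * real K"
proof -
  have "(\<Sum>j=1..N. (E l j)\<^sup>2) = real N" if "l < K" for l
  proof -
    have "dinner N (E l) (E l) = 1" using e_orthonormal that by (simp add: orthonormal_def)
    then show ?thesis using N0 by (simp add: dinner_def power2_eq_square divide_simps)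
  qed
  then show ?thesis by simp
qed

text \<open>The spline \<open>g\<close> in the proof is the reproducing kernel at \<open>x\<close>,
  so its empirical squared norm equals its own value \<open>g x\<close>. The pointwise bound becomes
  \<open>g x ^ 2\<close> at most a constant times \<open>(J + 1) * g x\<close>, which bounds the
  kernel on the diagonal; the average of the diagonal over the design is \<open>K\<close>.\<close>

lemma K_le: "real K \<le> spline_const p * real (J + 1)"
proof -
  have *: "(\<Sum>l<K. (e l x)\<^sup>2) \<le> spline_const p * real (J+1)" if x: "x \<in> {0..1}" for x
  proof -
    define g where "g y = (\<Sum>l<K. e l x * e l y)" for y
    have g: "g \<in> spline_space p J" unfolding g_def by (rule spline_space_sum) (use p e_spline in auto)
    have gg: "grid N g = (\<lambda>j. \<Sum>l<K. e l x * E l j)" by (auto simp: grid_def g_def)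
    have gx: "g x = (\<Sum>l<K. (e l x)\<^sup>2)" by (simp add: g_def power2_eq_square)
    have "(g x)\<^sup>2 \<le> spline_const p * real (J+1) * dinner N (grid N g) (grid N g)"
      using spline_pointwise_bound[OF g p N x] by (simp add: dinner_def grid_def power2_eq_square)
    also have "dinner N (grid N g) (grid N g) = g x"
      unfolding gg gx by (rule dinner_expansion_self[OF e_orthonormal])
    finally have "(g x) * g x \<le> spline_const p * real (J+1) * g x" by (simp add: power2_eq_square)
    moreover have "g x \<ge> 0" unfolding gx by (rule sum_nonneg) auto
    moreover have "spline_const p * real (J+1) \<ge> 0" by (simp add: spline_const_def)
    ultimately have "g x \<le> spline_const p * real (J+1)"
      by (metis linorder_not_le mult_strict_right_mono order_le_less)
    then show ?thesis by (simp add: gx)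
  qed
  have "real N * real K = (\<Sum>j=1..N. \<Sum>l<K. (E l j)\<^sup>2)"
    unfolding coef_square_sum[symmetric] by (rule sum.swap)
  also have "\<dots> \<le> (\<Sum>j=1..N. spline_const p * real (J+1))"
    unfolding grid_def by (intro sum_mono *) (use N0 in auto)
  also have "\<dots> = real N * (spline_const p * real (J+1))" by simp
  finally show ?thesis using N0 by (simp del: of_nat_add)
qed

end

section \<open>Spline approximation of smooth functions\<close>

text \<open>A mean value inequality that tolerates finitely many points without a derivative:
  antiderivatives of step functions have corners at the knots.\<close>

lemma increment_bound_off_finite:
  fixes F F' :: "real \<Rightarrow> real"
  assumes ab: "a \<le> b" and S: "finite S" and cont: "continuous_on {a..b} F"
    and der: "\<And>x. x \<in> {a<..<b} - S \<Longrightarrow> (F has_real_derivative F' x) (at x)"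
    and bnd: "\<And>x. x \<in> {a<..<b} - S \<Longrightarrow> \<bar>F' x\<bar> \<le> B" and B: "B \<ge> 0"
  shows "\<bar>F b - F a\<bar> \<le> B * (b - a)"
proof -
  define G where "G x = (if x \<in> {a<..<b} - S then F' x else 0)" for x
  have "(G has_integral (F b - F a)) {a..b}"
  proof (rule fundamental_theorem_of_calculus_interior_strong[OF S ab _ cont])
    fix x assume "x \<in> {a<..<b} - S"
    then show "(F has_vector_derivative G x) (at x)"
      using der by (auto simp: G_def has_real_derivative_iff_has_vector_derivative[symmetric])
  qed
  from has_integral_bound_real[OF B finite.emptyI this] have "norm (F b - F a) \<le> B * Henstock_Kurzweil_Integration.content {a..b}"
    using bnd B by (auto simp: G_def)
  then show ?thesis using ab by simp
qed

text \<open>Splines of order \<open>k\<close> on the half line, with knots at the positive multiples of \<open>h\<close>, given by their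
  sequence of polynomial pieces. Working on the half line makes the class invariant under the shift by
  \<open>h\<close>.\<close>

definition ppoly :: "nat \<Rightarrow> real \<Rightarrow> (nat \<Rightarrow> real poly) \<Rightarrow> bool" where
  "ppoly k h P \<longleftrightarrow> (\<forall>l. degree (P l) < k) \<and>
     (\<forall>l r. r + 2 \<le> k \<longrightarrow> poly ((pderiv ^^ r) (P l)) (real (Suc l) * h)
                        = poly ((pderiv ^^ r) (P (Suc l))) (real (Suc l) * h))"

definition pw :: "real \<Rightarrow> (nat \<Rightarrow> real poly) \<Rightarrow> real \<Rightarrow> real" where
  "pw h P x = poly (P (nat \<lfloor>x / h\<rfloor>)) x"

lemma ppoly_add: "ppoly k h P \<Longrightarrow> ppoly k h Q \<Longrightarrow> ppoly k h (\<lambda>l. P l + Q l)"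
  by (simp add: ppoly_def degree_add_less higher_pderiv_add)

lemma pw_add: "pw h (\<lambda>l. P l + Q l) x = pw h P x + pw h Q x"
  by (simp add: pw_def)

lemma ppoly_smult: "ppoly k h P \<Longrightarrow> ppoly k h (\<lambda>l. smult c (P l))"
  by (auto simp: ppoly_def higher_pderiv_smult intro: le_less_trans[OF degree_smult_le])

lemma pw_smult: "pw h (\<lambda>l. smult c (P l)) x = c * pw h P x"
  by (simp add: pw_def)

lemma higher_pderiv_shift:
  fixes P :: "real poly"
  shows "(pderiv ^^ r) (pcompose P [:h, 1:]) = pcompose ((pderiv ^^ r) P) [:h, 1:]"
  by (induction r) (auto simp: pderiv_pcompose pderiv_pCons)

lemma ppoly_shift:
  assumes "ppoly k h P"
  shows "ppoly k h (\<lambda>l. pcompose (P (Suc l)) [:h, 1:])"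
  unfolding ppoly_def
proof (intro conjI allI impI)
  fix l show "degree (pcompose (P (Suc l)) [:h, 1:]) < k"
    using assms by (simp add: ppoly_def degree_pcompose)
next
  fix l r assume "r + 2 \<le> k"
  have eq: "h + real (Suc l) * h = real (Suc (Suc l)) * h" by (simp add: algebra_simps)
  show "poly ((pderiv ^^ r) (pcompose (P (Suc l)) [:h, 1:])) (real (Suc l) * h) =
        poly ((pderiv ^^ r) (pcompose (P (Suc (Suc l))) [:h, 1:])) (real (Suc l) * h)"
    using assms \<open>r + 2 \<le> k\<close> eq unfolding higher_pderiv_shift poly_pcompose ppoly_def
    by (simp del: of_nat_Suc)
qed

lemma pw_shift:
  assumes "h > 0" "x \<ge> 0"
  shows "pw h (\<lambda>l. pcompose (P (Suc l)) [:h, 1:]) x = pw h P (x + h)"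
proof -
  have "(x + h) / h = x / h + 1" using assms by (simp add: field_simps)
  then have "nat \<lfloor>(x + h) / h\<rfloor> = Suc (nat \<lfloor>x / h\<rfloor>)" using assms by (simp add: nat_add_distrib)
  then show ?thesis by (simp add: pw_def poly_pcompose add.commute)
qed

lemma pw_open_cell:
  assumes "h > 0" "real l * h \<le> x" "x < real (Suc l) * h"
  shows "pw h P x = poly (P l) x"
proof -
  have "real l \<le> x / h" "x / h < real l + 1"
    using assms by (simp_all add: field_simps)
  then have "\<lfloor>x / h\<rfloor> = int l" by (simp add: floor_eq_iff)
  then show ?thesis by (simp add: pw_def)
qed

lemma pw_cell:
  assumes P: "ppoly k h P" and k: "k \<ge> 2" and h: "h > 0"
    and x: "real l * h \<le> x" "x \<le> real (Suc l) * h"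
  shows "pw h P x = poly (P l) x"
proof (cases "x < real (Suc l) * h")
  case True
  then show ?thesis using pw_open_cell h x by blast
next
  case False
  then have x': "x = real (Suc l) * h" using x by simp
  then have "pw h P x = poly (P (Suc l)) x" using h by (intro pw_open_cell) auto
  also have "\<dots> = poly (P l) x"
  proof -
    have "poly ((pderiv ^^ 0) (P l)) (real (Suc l) * h)
                        = poly ((pderiv ^^ 0) (P (Suc l))) (real (Suc l) * h)"
      using P k unfolding ppoly_def by (metis add_0)
    then show ?thesis by (simp add: x')
  qed
  finally show ?thesis .
qed

lemma cell_exists:
  assumes "h > 0" "x \<ge> 0"
  obtains l where "real l * h \<le> x" "x < real (Suc l) * h"
proof -
  define l where "l = nat \<lfloor>x / h\<rfloor>"
  have "real l = real_of_int \<lfloor>x / h\<rfloor>" using assms by (simp add: l_def)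
  then have "real l \<le> x / h" "x / h < real (Suc l)" by (simp_all, linarith)
  then show ?thesis using that[of l] assms
    by (simp add: pos_le_divide_eq pos_divide_less_eq)
qed

lemma pw_continuous:
  assumes P: "ppoly k h P" and k: "k \<ge> 2" and h: "h > 0" and a: "0 \<le> a"
  shows "continuous_on {a..b} (pw h P)"
proof -
  define n where "n = nat \<lceil>b / h\<rceil>"
  have "continuous_on (\<Union>l\<le>n. {real l * h..real (Suc l) * h}) (pw h P)"
  proof (rule continuous_on_closed_Union)
    fix l
    show "continuous_on {real l * h..real (Suc l) * h} (pw h P)"
      by (rule continuous_on_eq[of _ "poly (P l)"])
         (use pw_cell[OF P k h] in \<open>auto intro!: continuous_intros\<close>)
  qed auto
  moreover have "{a..b} \<subseteq> (\<Union>l\<le>n. {real l * h..real (Suc l) * h})"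
  proof
    fix x assume x: "x \<in> {a..b}"
    obtain l where l: "real l * h \<le> x" "x < real (Suc l) * h" using cell_exists[OF h, of x] x a by auto
    then have "real l * h \<le> b" using x by auto
    then have "real l \<le> b / h" using h by (simp add: pos_le_divide_eq)
    then have "l \<le> n" unfolding n_def by linarith
    then show "x \<in> (\<Union>l\<le>n. {real l * h..real (Suc l) * h})" using l by (intro UN_I[of l]) auto
  qed
  ultimately show ?thesis by (rule continuous_on_subset)
qed

lemma pw_derivative:
  assumes h: "h > 0" and x: "x > 0" "x \<notin> range (\<lambda>l. real l * h)"
    and der: "\<And>l. pderiv (Q l) = P l"
  shows "(pw h Q has_real_derivative pw h P x) (at x)"
proof -
  obtain l where l: "real l * h \<le> x" "x < real (Suc l) * h" using cell_exists[OF h, of x] x by auto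
  then have l': "real l * h < x" using x(2) by (metis less_eq_real_def rangeI)
  have "(poly (Q l) has_real_derivative poly (P l) x) (at x)"
    using poly_DERIV[of "Q l" x] der by simp
  then have "(pw h Q has_real_derivative poly (P l) x) (at x)"
    by (rule has_field_derivative_transform_within_open[of _ _ _ "{real l * h<..<real (Suc l) * h}"])
       (use l l' pw_open_cell[OF h, of l _ Q] in auto)
  then show ?thesis using pw_open_cell[OF h l] by simp
qed

lemma poly_antiderivative:
  fixes P :: "real poly"
  shows "\<exists>Q. pderiv Q = P \<and> degree Q \<le> Suc (degree P)"
proof -
  define Q where "Q = (\<Sum>i\<le>degree P. monom (coeff P i / real (Suc i)) (Suc i))"
  have "pderiv Q = (\<Sum>i\<le>degree P. monom (coeff P i) i)"
    unfolding Q_def by (simp add: higher_pderiv_sum[of 1, simplified] pderiv_monom del: of_nat_Suc)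
  also have "\<dots> = P" by (rule poly_as_sum_of_monoms)
  finally have "pderiv Q = P" .
  moreover have "degree Q \<le> Suc (degree P)"
    unfolding Q_def by (rule degree_sum_le) (auto intro: order.trans[OF degree_monom_le])
  ultimately show ?thesis by blast
qed

lemma ppoly_antiderivative:
  assumes P: "ppoly k h P" and k: "k > 0"
  obtains Q where "ppoly (Suc k) h Q" "\<And>l. pderiv (Q l) = P l"
proof -
  obtain A :: "real poly \<Rightarrow> real poly" where A: "\<And>P. pderiv (A P) = P" "\<And>P. degree (A P) \<le> Suc (degree P)"
    using poly_antiderivative by metis
  \<comment> \<open>The constants of integration are fixed from cell to cell so that adjacent pieces
    agree at their common knot. The matching of the derivatives is inherited from
    \<open>P\<close>.\<close>
  define Q where "Q = rec_nat (A (P 0)) (\<lambda>l R. A (P (Suc l)) +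
      [:poly R (real (Suc l) * h) - poly (A (P (Suc l))) (real (Suc l) * h):])"
  have Q0: "Q 0 = A (P 0)" and QS: "Q (Suc l) = A (P (Suc l)) +
      [:poly (Q l) (real (Suc l) * h) - poly (A (P (Suc l))) (real (Suc l) * h):]" for l
    by (auto simp: Q_def)
  have der: "pderiv (Q l) = P l" for l
    by (cases l) (auto simp: Q0 QS A pderiv_add pderiv_pCons simp del: of_nat_Suc)
  have "degree (A (P l)) < Suc k" for l
    using A(2)[of "P l"] P by (auto simp: ppoly_def less_Suc_eq_le Suc_le_eq intro: order.trans)
  then have deg: "degree (Q l) < Suc k" for l
    by (cases l) (auto simp: Q0 QS intro!: degree_add_less)
  have "ppoly (Suc k) h Q"
    unfolding ppoly_def
  proof (intro conjI allI impI deg)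
    fix l r assume r: "r + 2 \<le> Suc k"
    show "poly ((pderiv ^^ r) (Q l)) (real (Suc l) * h) = poly ((pderiv ^^ r) (Q (Suc l))) (real (Suc l) * h)"
    proof (cases r)
      case 0
      then show ?thesis by (simp add: QS del: of_nat_Suc)
    next
      case (Suc r')
      then have "(pderiv ^^ r) (Q l) = (pderiv ^^ r') (P l)" for l
        by (simp add: funpow_Suc_right der del: funpow.simps)
      then show ?thesis using P r Suc by (simp add: ppoly_def del: of_nat_Suc)
    qed
  qed
  then show ?thesis using that der by blast
qed

text \<open>Turns a bound between derivatives into a bound between increments. It is applied with a
  linear \<open>f\<close> to analyse moving averages, and with a smooth \<open>f\<close> to
  integrate an approximation of its derivative.\<close>

lemma pw_antiderivative_increment:
  assumes P: "ppoly k h P" and k: "k > 0" and h: "h > 0"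
    and Q: "ppoly (Suc k) h Q" "\<And>l. pderiv (Q l) = P l"
    and ab: "0 \<le> a" "a \<le> b" and f: "continuous_on {a..b} f"
    and der: "\<And>x. x \<in> {a<..<b} \<Longrightarrow> (f has_real_derivative f' x) (at x)"
    and bnd: "\<And>x. x \<in> {a<..<b} \<Longrightarrow> \<bar>f' x - pw h P x\<bar> \<le> B" and B: "B \<ge> 0"
  shows "\<bar>(f b - pw h Q b) - (f a - pw h Q a)\<bar> \<le> B * (b - a)"
proof (rule increment_bound_off_finite[where F' = "\<lambda>x. f' x - pw h P x"])
  define n where "n = nat \<lceil>b / h\<rceil>"
  let ?S = "(\<lambda>l. real l * h) ` {..n}"
  show "finite ?S" by simp
  show "continuous_on {a..b} (\<lambda>x. f x - pw h Q x)"
    using Q(1) k h ab by (intro continuous_intros f pw_continuous[of "Suc k"]) auto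
  fix x assume x: "x \<in> {a<..<b} - ?S"
  have "x \<notin> range (\<lambda>l. real l * h)"
  proof
    assume "x \<in> range (\<lambda>l. real l * h)"
    then obtain l where l: "x = real l * h" by auto
    then have "real l \<le> b / h" using x h by (simp add: pos_le_divide_eq)
    then have "l \<le> n" unfolding n_def by linarith
    then show False using x l by auto
  qed
  then show "((\<lambda>x. f x - pw h Q x) has_real_derivative f' x - pw h P x) (at x)"
    using x ab h Q(2) by (intro DERIV_diff der pw_derivative) auto
  show "\<bar>f' x - pw h P x\<bar> \<le> B" using bnd x by auto
qed (use ab B in auto)

text \<open>Averaging over a window of one knot distance raises the order by one, and it adds to the
  error no more than the variation of \<open>f\<close> over the window. The factor
  \<open>Suc k\<close> counts these contributions, starting from a step function.\<close>

lemma spline_approx_holder: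
  fixes f :: "real \<Rightarrow> real"
  assumes f: "\<And>x y. x \<ge> 0 \<Longrightarrow> y \<ge> 0 \<Longrightarrow> \<bar>f x - f y\<bar> \<le> H * \<bar>x - y\<bar> powr mu"
    and H: "H \<ge> 0" and mu: "mu > 0" and h: "h > 0"
  shows "\<exists>P. ppoly (Suc k) h P \<and> (\<forall>x\<ge>0. \<bar>f x - pw h P x\<bar> \<le> real (Suc k) * H * h powr mu)"
proof (induction k)
  case 0
  define P where "P l = [:f (real l * h):]" for l
  have "\<bar>f x - pw h P x\<bar> \<le> real (Suc 0) * H * h powr mu" if x: "x \<ge> 0" for x
  proof -
    obtain l where l: "real l * h \<le> x" "x < real (Suc l) * h" using cell_exists[OF h x] .
    have "pw h P x = f (real l * h)" using pw_open_cell[OF h l] by (simp add: P_def)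
    moreover have "\<bar>f x - f (real l * h)\<bar> \<le> H * \<bar>x - real l * h\<bar> powr mu" using h x by (intro f) auto
    moreover have "\<bar>x - real l * h\<bar> \<le> h" using l by (simp add: algebra_simps)
    then have "H * \<bar>x - real l * h\<bar> powr mu \<le> H * h powr mu"
      using H mu by (intro mult_left_mono powr_mono2) auto
    ultimately show ?thesis by simp
  qed
  moreover have "ppoly (Suc 0) h P" by (simp add: ppoly_def P_def)
  ultimately show ?case by blast
next
  case (Suc k)
  then obtain P where P: "ppoly (Suc k) h P"
    and err: "\<And>x. x \<ge> 0 \<Longrightarrow> \<bar>f x - pw h P x\<bar> \<le> real (Suc k) * H * h powr mu" by blast
  obtain Q where Q: "ppoly (Suc (Suc k)) h Q" "\<And>l. pderiv (Q l) = P l"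
    using ppoly_antiderivative[OF P] by blast
  \<comment> \<open>The moving average of the order \<open>Suc k\<close> spline over \<open>[x, x + h]\<close>, a spline of one order more.\<close>
  define R where "R l = smult (1 / h) (pcompose (Q (Suc l)) [:h, 1:] + smult (-1) (Q l))" for l
  have R: "ppoly (Suc (Suc k)) h R"
    unfolding R_def by (intro ppoly_smult ppoly_add ppoly_shift Q)
  define B where "B = real (Suc (Suc k)) * H * h powr mu"
  have "\<bar>f x - pw h R x\<bar> \<le> B" if x: "x \<ge> 0" for x
  proof -
    have Rx: "pw h R x = (pw h Q (x + h) - pw h Q x) / h"
      unfolding R_def pw_smult pw_add using pw_shift[OF h x, of Q] by simp
    \<comment> \<open>The spline on the window is compared with the constant \<open>f x\<close>,
      whose antiderivative is linear; the increment over the window is \<open>h\<close> times the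
      error at \<open>x\<close>.\<close>
    have "\<bar>(f x * (x + h) - pw h Q (x + h)) - (f x * x - pw h Q x)\<bar> \<le> B * (x + h - x)"
    proof (rule pw_antiderivative_increment[OF P _ h Q, where f' = "\<lambda>_. f x"])
      fix y assume y: "y \<in> {x<..<x + h}"
      show "((*) (f x) has_real_derivative f x) (at y)"
        by (auto intro!: derivative_eq_intros)
      have "\<bar>f x - f y\<bar> \<le> H * \<bar>x - y\<bar> powr mu" using x y by (intro f) auto
      also have "\<dots> \<le> H * h powr mu" using y H mu by (intro mult_left_mono powr_mono2) auto
      finally have "\<bar>f x - pw h P y\<bar> \<le> H * h powr mu + real (Suc k) * H * h powr mu"
        using err[of y] x y by auto
      then show "\<bar>f x - pw h P y\<bar> \<le> B" by (simp add: B_def algebra_simps)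
    qed (use x h H in \<open>auto intro!: continuous_intros simp: B_def\<close>)
    moreover have "h * (f x - pw h R x) = (f x * (x + h) - pw h Q (x + h)) - (f x * x - pw h Q x)"
    proof -
      have "h * pw h R x = pw h Q (x + h) - pw h Q x" using h unfolding Rx by simp
      then show ?thesis by (simp add: algebra_simps)
    qed
    ultimately have "\<bar>h * (f x - pw h R x)\<bar> \<le> B * h" by simp
    then show ?thesis using h by (simp add: abs_mult mult.commute)
  qed
  then show ?case using R unfolding B_def by blast
qed

text \<open>Each derivative gains one factor \<open>h\<close> and costs one factor equal to the
  order of the spline. This explains the exponent of \<open>h\<close>, and the power in the constant
  after the orders of all stages are bounded by the final one.\<close>

lemma spline_approx_smooth:
  assumes "\<And>r x. r < q \<Longrightarrow> x \<in> {0..1} \<Longrightarrow> (D r has_real_derivative D (Suc r) x) (at x within {0..1})"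
    and "\<And>x y. x \<in> {0..1} \<Longrightarrow> y \<in> {0..1} \<Longrightarrow> \<bar>D q x - D q y\<bar> \<le> H * \<bar>x - y\<bar> powr mu"
    and H: "H \<ge> 0" and mu: "mu > 0" and h: "h > 0"
  shows "\<exists>P. ppoly (q + Suc k) h P \<and>
    (\<forall>x\<in>{0..1}. \<bar>D 0 x - pw h P x\<bar> \<le> real (q + Suc k) ^ Suc q * H * h powr (real q + mu))"
  using assms(1,2)
proof (induction q arbitrary: D)
  case 0
  \<comment> \<open>Composition with \<open>min 1\<close> continues the function as a constant
    beyond 1 and keeps its Hoelder constant; the approximation on the half line needs this.\<close>
  have "\<bar>D 0 (min 1 x) - D 0 (min 1 y)\<bar> \<le> H * \<bar>x - y\<bar> powr mu" if "x \<ge> 0" "y \<ge> 0" for x y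
  proof -
    have "\<bar>D 0 (min 1 x) - D 0 (min 1 y)\<bar> \<le> H * \<bar>min 1 x - min 1 y\<bar> powr mu"
      using that by (intro 0) auto
    also have "\<dots> \<le> H * \<bar>x - y\<bar> powr mu" using H mu by (intro mult_left_mono powr_mono2) auto
    finally show ?thesis .
  qed
  from spline_approx_holder[of "\<lambda>x. D 0 (min 1 x)", OF this H mu h]
  obtain P where "ppoly (Suc k) h P" "\<forall>x\<ge>0. \<bar>D 0 (min 1 x) - pw h P x\<bar> \<le> real (Suc k) * H * h powr mu"
    by blast
  then show ?case by (intro exI[of _ P]) (auto simp: min_absorb2)
next
  case (Suc q)
  define B where "B = real (q + Suc k) ^ Suc q * H * h powr (real q + mu)"
  have B: "B \<ge> 0" using H by (simp add: B_def)
  have "\<exists>P. ppoly (q + Suc k) h P \<and> (\<forall>x\<in>{0..1}. \<bar>D (Suc 0) x - pw h P x\<bar> \<le> B)"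
    unfolding B_def by (rule Suc.IH[of "\<lambda>r. D (Suc r)"]) (use Suc.prems in auto)
  then obtain P where P: "ppoly (q + Suc k) h P"
    and err: "\<And>x. x \<in> {0..1} \<Longrightarrow> \<bar>D (Suc 0) x - pw h P x\<bar> \<le> B" by blast
  obtain Q where Q: "ppoly (Suc (q + Suc k)) h Q" "\<And>l. pderiv (Q l) = P l"
    using ppoly_antiderivative[OF P] by auto
  \<comment> \<open>Integrating the approximation of \<open>D 1\<close> leaves a Lipschitz remainder with the small constant \<open>B\<close>,
    which is approximated once more.\<close>
  define f where "f x = D 0 (min 1 x) - pw h Q (min 1 x)" for x
  have D0: "(D 0 has_real_derivative D (Suc 0) x) (at x within {0..1})" if "x \<in> {0..1}" for x
    using Suc.prems(1)[of 0] that by auto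
  have lip: "\<bar>f b - f a\<bar> \<le> B * (b - a)" if ab: "0 \<le> a" "a \<le> b" "b \<le> 1" for a b
  proof -
    have "\<bar>(D 0 b - pw h Q b) - (D 0 a - pw h Q a)\<bar> \<le> B * (b - a)"
    proof (rule pw_antiderivative_increment[OF P _ h Q, where f' = "D (Suc 0)"])
      have "continuous_on {0..1} (D 0)"
        using D0 by (rule DERIV_continuous_on)
      then show "continuous_on {a..b} (D 0)" by (rule continuous_on_subset) (use ab in auto)
      fix x assume x: "x \<in> {a<..<b}"
      then have "x \<in> {0<..<1}" using ab by auto
      then show "(D 0 has_real_derivative D (Suc 0) x) (at x)"
        using D0[of x] by (auto simp: at_within_Icc_at)
      show "\<bar>D (Suc 0) x - pw h P x\<bar> \<le> B" using x ab by (intro err) auto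
    qed (use ab B in auto)
    then show ?thesis using ab by (simp add: f_def min_absorb2)
  qed
  have lip': "\<bar>f x - f y\<bar> \<le> B * \<bar>x - y\<bar> powr 1" if "x \<ge> 0" "y \<ge> 0" for x y
  proof -
    have ord: "\<bar>f y - f x\<bar> \<le> B * (y - x)" if "0 \<le> x" "x \<le> y" for x y
    proof -
      have "\<bar>f (min 1 y) - f (min 1 x)\<bar> \<le> B * (min 1 y - min 1 x)" using that by (intro lip) auto
      also have "\<dots> \<le> B * (y - x)" using that B by (intro mult_left_mono) auto
      finally show ?thesis by (simp add: f_def)
    qed
    show ?thesis using ord[of x y] ord[of y x] that by (cases "x \<le> y") (auto simp: abs_minus_commute)
  qed
  from spline_approx_holder[of f, OF lip' B _ h, of "q + Suc k"]
  obtain R where R: "ppoly (Suc (q + Suc k)) h R"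
    and err2: "\<And>x. x \<ge> 0 \<Longrightarrow> \<bar>f x - pw h R x\<bar> \<le> real (Suc (q + Suc k)) * B * h powr 1" by auto
  have "\<bar>D 0 x - pw h (\<lambda>l. Q l + R l) x\<bar> \<le> real (Suc q + Suc k) ^ Suc (Suc q) * H * h powr (real (Suc q) + mu)"
    if x: "x \<in> {0..1}" for x
  proof -
    have "\<bar>D 0 x - pw h (\<lambda>l. Q l + R l) x\<bar> = \<bar>f x - pw h R x\<bar>"
      using x by (simp add: f_def pw_add min_absorb2)
    also have "\<dots> \<le> real (Suc (q + Suc k)) * B * h powr 1" using err2 x by auto
    also have "\<dots> = real (Suc (q + Suc k)) * (real (q + Suc k) ^ Suc q * (H * h powr (real (Suc q) + mu)))"
      using h by (simp add: B_def powr_add mult_ac)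
    also have "\<dots> \<le> real (Suc (q + Suc k)) * (real (Suc (q + Suc k)) ^ Suc q * (H * h powr (real (Suc q) + mu)))"
      by (intro mult_left_mono mult_right_mono power_mono) (use H in auto)
    finally show ?thesis by (simp add: mult_ac)
  qed
  then show ?case using ppoly_add[OF Q(1) R] by auto
qed

lemma spline_space_approx:
  assumes D: "\<And>r x. r < q \<Longrightarrow> x \<in> {0..1} \<Longrightarrow> (D r has_real_derivative D (Suc r) x) (at x within {0..1})"
    and hol: "\<And>x y. x \<in> {0..1} \<Longrightarrow> y \<in> {0..1} \<Longrightarrow> \<bar>D q x - D q y\<bar> \<le> H * \<bar>x - y\<bar> powr mu"
    and H: "H \<ge> 0" and mu: "mu > 0" and q: "q > 0" and p: "p > q"
  shows "\<exists>g\<in>spline_space p J. \<forall>x\<in>{0..1}. \<bar>D 0 x - g x\<bar> \<le> real p ^ Suc q * H * (1 / real (J+1)) powr (real q + mu)"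
proof -
  define h where "h = 1 / real (J+1)"
  have h: "h > 0" by (simp add: h_def)
  \<comment> \<open>Of the order \<open>p\<close>, one unit is spent on each of the \<open>q\<close>
    derivatives; the remaining \<open>Suc k\<close> is the order at which the top derivative is
    approximated.\<close>
  obtain k where k: "p = q + Suc k" using p by (metis less_iff_Suc_add add_Suc_right)
  obtain P where P: "ppoly p h P"
    and err: "\<forall>x\<in>{0..1}. \<bar>D 0 x - pw h P x\<bar> \<le> real p ^ Suc q * H * h powr (real q + mu)"
    using spline_approx_smooth[OF D hol H mu h, of k] unfolding k by blast
  have knot: "knot J l = real l * h" for l by (simp add: knot_def h_def)
  have J1: "real (Suc J) * h = 1" by (simp add: h_def)
  have "pw h P \<in> spline_space p J"
    unfolding spline_space_def mem_Collect_eq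
  proof (intro exI[of _ P] conjI allI impI ballI)
    fix l x assume "l \<le> J" "knot J l \<le> x \<and> (x < knot J (Suc l) \<or> l = J \<and> x = 1)"
    then show "pw h P x = poly (P l) x"
      using J1 q p by (intro pw_cell[OF P _ h]) (auto simp: knot simp del: of_nat_Suc)
  next
    fix l r assume "l \<in> {1..J}" "r + 2 \<le> p"
    then show "poly ((pderiv ^^ r) (P (l - 1))) (knot J l) = poly ((pderiv ^^ r) (P l)) (knot J l)"
      using P unfolding ppoly_def knot by (cases l) (auto simp del: of_nat_Suc)
  qed (use P in \<open>auto simp: ppoly_def\<close>)
  then show ?thesis using err by (auto simp: h_def)
qed

text \<open>The norm is computed from a chosen sequence of derivatives. That same choice is returned
  here, so that the norm is a valid Hoelder constant for its last member.\<close>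

lemma holder_norm_bound:
  assumes f: "in_holder q mu f"
  shows "holder_norm q mu f \<ge> 0 \<and> (\<exists>D. holder_derivs q f D \<and>
    (\<forall>x\<in>{0..1}. \<forall>y\<in>{0..1}. \<bar>D q x - D q y\<bar> \<le> holder_norm q mu f * \<bar>x - y\<bar> powr mu))"
proof -
  define D where "D = (SOME D. holder_derivs q f D)"
  have D: "holder_derivs q f D" using someI_ex[of "holder_derivs q f"] f by (simp add: in_holder_def D_def)
  have bdd: "bdd_above (holder_quotients q mu f)" using f by (simp add: in_holder_def)
  have quot: "holder_quotients q mu f = {\<bar>D q x - D q y\<bar> / \<bar>x - y\<bar> powr mu | x y. x \<in> {0..1} \<and> y \<in> {0..1} \<and> x \<noteq> y}"
    by (simp add: holder_quotients_def D_def Let_def)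
  have le: "\<bar>D q x - D q y\<bar> / \<bar>x - y\<bar> powr mu \<le> holder_norm q mu f"
    if "x \<in> {0..1}" "y \<in> {0..1}" "x \<noteq> y" for x y
    unfolding holder_norm_def by (rule cSup_upper[OF _ bdd]) (use that quot in auto)
  have nonneg: "holder_norm q mu f \<ge> 0" 
    using order.trans[OF abs_ge_zero le[of 0 1, simplified]] by simp
  have "\<bar>D q x - D q y\<bar> \<le> holder_norm q mu f * \<bar>x - y\<bar> powr mu"
    if "x \<in> {0..1}" "y \<in> {0..1}" for x y
    using le[OF that] by (cases "x = y") (auto simp: pos_divide_le_eq)
  then show ?thesis using D nonneg by blast
qed

lemma in_holder_spline_approx:
  assumes f: "in_holder q mu f" and mu: "mu > 0" and q: "q > 0" and p: "p > q"
  shows "\<exists>g\<in>spline_space p J. \<forall>x\<in>{0..1}.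
    \<bar>f x - g x\<bar> \<le> real p ^ Suc q * holder_norm q mu f * (1 / real (J+1)) powr (real q + mu)"
proof -
  obtain D where D: "holder_derivs q f D"
    and hol: "\<forall>x\<in>{0..1}. \<forall>y\<in>{0..1}. \<bar>D q x - D q y\<bar> \<le> holder_norm q mu f * \<bar>x - y\<bar> powr mu"
    and nn: "holder_norm q mu f \<ge> 0" using holder_norm_bound[OF f] by blast
  have "\<exists>g\<in>spline_space p J. \<forall>x\<in>{0..1}.
    \<bar>D 0 x - g x\<bar> \<le> real p ^ Suc q * holder_norm q mu f * (1 / real (J+1)) powr (real q + mu)"
    by (rule spline_space_approx[where D = D and q = q]) (use D hol nn mu q p in \<open>auto simp: holder_derivs_def\<close>)
  then show ?thesis using D by (simp add: holder_derivs_def)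
qed

lemma in_holder_continuous:
  assumes f: "in_holder q mu f" and q: "q > 0"
  shows "continuous_on {0..1} f"
proof -
  obtain D where D: "holder_derivs q f D" using f by (auto simp: in_holder_def)
  have "continuous_on {0..1} (D 0)"
    using D q by (intro DERIV_continuous_on[where D = "D (Suc 0)"]) (auto simp: holder_derivs_def)
  then show ?thesis by (rule continuous_on_eq) (use D in \<open>simp add: holder_derivs_def\<close>)
qed

lemma sup_norm01_bound:
  assumes f: "continuous_on {0..1} f" and x: "x \<in> {0..1}"
  shows "\<bar>f x\<bar> \<le> sup_norm01 f"
proof -
  have "compact ((\<lambda>x. \<bar>f x\<bar>) ` {0..1})"
    by (intro compact_continuous_image continuous_intros f) auto
  then have "bdd_above ((\<lambda>x. \<bar>f x\<bar>) ` {0..1})" by (intro bounded_imp_bdd_above compact_imp_bounded)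
  then show ?thesis unfolding sup_norm01_def using x by (intro cSUP_upper) auto
qed

section \<open>Lag products\<close>

definition sqnorm :: "(real \<Rightarrow> real) \<Rightarrow> real" where
  "sqnorm f = integral {0..1} (\<lambda>t. (f t)\<^sup>2)"

text \<open>Symmetrised, so that squares of sums expand with a single cross term; on the diagonal it
  is twice the plain lag product.\<close>

definition lagform :: "real \<Rightarrow> (real \<Rightarrow> real) \<Rightarrow> (real \<Rightarrow> real) \<Rightarrow> real" where
  "lagform h f g = integral {0..1-h} (\<lambda>t. f t * g (t + h) + g t * f (t + h))"

lemma continuous_on_lag:
  fixes f :: "real \<Rightarrow> real"
  assumes "continuous_on {0..1} f" "0 \<le> h"
  shows "continuous_on {0..1-h} f" "continuous_on {0..1-h} (\<lambda>t. f (t + h))"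
proof -
  show "continuous_on {0..1-h} f" by (rule continuous_on_subset[OF assms(1)]) (use assms(2) in auto)
  show "continuous_on {0..1-h} (\<lambda>t. f (t + h))"
    by (rule continuous_on_compose2[OF assms(1)]) (use assms(2) in \<open>auto intro!: continuous_intros\<close>)
qed

lemma integral_lag_le:
  fixes a :: "real \<Rightarrow> real"
  assumes a: "continuous_on {0..1} a" and nn: "\<And>t. t \<in> {0..1} \<Longrightarrow> a t \<ge> 0" and h: "0 \<le> h"
  shows "integral {0..1-h} a \<le> integral {0..1} a"
    and "integral {0..1-h} (\<lambda>t. a (t + h)) \<le> integral {0..1} a"
proof -
  have int: "a integrable_on {0..1}" by (rule integrable_continuous_real[OF a])
  show "integral {0..1-h} a \<le> integral {0..1} a"
    by (rule integral_subset_le)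
       (use h nn int in \<open>auto intro!: integrable_continuous_real continuous_on_lag[OF a h]\<close>)
  have "integral {0..1-h} (\<lambda>t. a (t + h)) = integral {h..1} a"
    using integral_shift_real_ivl[of h h 1 a] by simp
  also have "\<dots> \<le> integral {0..1} a"
    by (rule integral_subset_le)
       (use h nn int in \<open>auto intro!: integrable_continuous_real continuous_on_subset[OF a]\<close>)
  finally show "integral {0..1-h} (\<lambda>t. a (t + h)) \<le> integral {0..1} a" .
qed

text \<open>The source of uniformity in the lag: the product is dominated by a sum in which each
  term depends on one point only, and integrating a nonnegative function over either the interval
  cut at the right or its shift by \<open>h\<close> never exceeds the integral over the unit
  interval.\<close>

lemma lagform_bound:
  assumes f: "continuous_on {0..1} f" and g: "continuous_on {0..1} g"
    and a: "continuous_on {0..1} a" and b: "continuous_on {0..1} b" and h: "0 \<le> h"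
    and an: "\<And>t. t \<in> {0..1} \<Longrightarrow> a t \<ge> 0" and bn: "\<And>t. t \<in> {0..1} \<Longrightarrow> b t \<ge> 0"
    and le: "\<And>s u. s \<in> {0..1} \<Longrightarrow> u \<in> {0..1} \<Longrightarrow> \<bar>f s * g u\<bar> \<le> a s + b u"
  shows "\<bar>lagform h f g\<bar> \<le> 2 * (integral {0..1} a + integral {0..1} b)"
proof -
  note c = continuous_on_lag[OF f h] continuous_on_lag[OF g h] continuous_on_lag[OF a h] continuous_on_lag[OF b h]
  have i: "a integrable_on {0..1-h}" "(\<lambda>t. a (t+h)) integrable_on {0..1-h}"
     "b integrable_on {0..1-h}" "(\<lambda>t. b (t+h)) integrable_on {0..1-h}"
    by (intro integrable_continuous_real c)+
  have "norm (lagform h f g) \<le> integral {0..1-h} (\<lambda>t. (a t + b (t + h)) + (a (t + h) + b t))"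
    unfolding lagform_def
  proof (rule Henstock_Kurzweil_Integration.integral_norm_bound_integral)
    fix t assume t: "t \<in> {0..1-h}"
    then have "t \<in> {0..1}" "t + h \<in> {0..1}" using h by auto
    from le[OF this] le[OF this(2) this(1)]
    show "norm (f t * g (t + h) + g t * f (t + h)) \<le> (a t + b (t + h)) + (a (t + h) + b t)"
      by (simp add: mult.commute)
  qed (intro integrable_continuous_real continuous_intros c)+
  also have "\<dots> = integral {0..1-h} a + integral {0..1-h} (\<lambda>t. b (t + h)) +
      (integral {0..1-h} (\<lambda>t. a (t + h)) + integral {0..1-h} b)"
    by (simp add: Henstock_Kurzweil_Integration.integral_add Henstock_Kurzweil_Integration.integrable_add i)
  also have "\<dots> \<le> 2 * (integral {0..1} a + integral {0..1} b)"
    using integral_lag_le[OF a an h] integral_lag_le[OF b bn h] by simp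
  finally show ?thesis by simp
qed

lemma abs_mult_le_scaled_squares:
  fixes x y c :: real
  assumes "c > 0"
  shows "\<bar>x * y\<bar> \<le> c / 2 * x\<^sup>2 + y\<^sup>2 / (2 * c)"
proof -
  have "0 \<le> (c * \<bar>x\<bar> - \<bar>y\<bar>)\<^sup>2 / (2 * c)" using assms by simp
  also have "\<dots> = c / 2 * x\<^sup>2 + y\<^sup>2 / (2 * c) - \<bar>x * y\<bar>"
    using assms by (simp add: power2_eq_square field_simps abs_mult)
  finally show ?thesis by simp
qed

lemma sqnorm_le:
  assumes f: "continuous_on {0..1} f" and le: "\<And>t. t \<in> {0..1} \<Longrightarrow> \<bar>f t\<bar> \<le> c"
  shows "sqnorm f \<le> c\<^sup>2"
proof -
  have "integral {0..1} (\<lambda>t. (f t)\<^sup>2) \<le> integral {0..1::real} (\<lambda>t. c\<^sup>2)"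
  proof (rule integral_le)
    show "(\<lambda>t. (f t)\<^sup>2) integrable_on {0..1}" by (intro integrable_continuous_real continuous_intros f)
    fix t :: real assume "t \<in> {0..1}"
    from power_mono[OF le[OF this] abs_ge_zero, of 2] show "(f t)\<^sup>2 \<le> c\<^sup>2" by simp
  qed auto
  then show ?thesis by (simp add: sqnorm_def)
qed

lemma sqnorm_add_le:
  assumes f: "continuous_on {0..1} f" and g: "continuous_on {0..1} g"
  shows "sqnorm (\<lambda>t. f t + g t) \<le> 2 * sqnorm f + 2 * sqnorm g"
proof -
  have i: "(\<lambda>t. 2 * (f t)\<^sup>2) integrable_on {0..1}" "(\<lambda>t. 2 * (g t)\<^sup>2) integrable_on {0..1}"
    by (intro integrable_continuous_real continuous_intros f g)+
  have "sqnorm (\<lambda>t. f t + g t) \<le> integral {0..1} (\<lambda>t. 2 * (f t)\<^sup>2 + 2 * (g t)\<^sup>2)"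
    unfolding sqnorm_def
  proof (rule integral_le)
    show "(\<lambda>t. (f t + g t)\<^sup>2) integrable_on {0..1}" "(\<lambda>t. 2 * (f t)\<^sup>2 + 2 * (g t)\<^sup>2) integrable_on {0..1}"
      by (intro integrable_continuous_real continuous_intros f g)+
    fix t :: real
    have "0 \<le> (f t - g t)\<^sup>2" by simp
    then show "(f t + g t)\<^sup>2 \<le> 2 * (f t)\<^sup>2 + 2 * (g t)\<^sup>2" by (simp add: power2_eq_square algebra_simps)
  qed
  then show ?thesis by (simp add: Henstock_Kurzweil_Integration.integral_add i sqnorm_def)
qed

lemma lagform_le_sqnorm:
  assumes f: "continuous_on {0..1} f" and g: "continuous_on {0..1} g" and h: "0 \<le> h" and c: "c > 0"
  shows "\<bar>lagform h f g\<bar> \<le> c * sqnorm f + sqnorm g / c"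
proof -
  have "\<bar>lagform h f g\<bar> \<le> 2 * (integral {0..1} (\<lambda>t. c / 2 * (f t)\<^sup>2) + integral {0..1} (\<lambda>t. (1 / (2 * c)) * (g t)\<^sup>2))"
    by (rule lagform_bound[OF f g _ _ h])
       (use c abs_mult_le_scaled_squares[OF c] in \<open>auto intro!: continuous_intros f g\<close>)
  also have "\<dots> = c * sqnorm f + sqnorm g / c"
    unfolding sqnorm_def Henstock_Kurzweil_Integration.integral_mult_right
    using c by (simp add: field_simps)
  finally show ?thesis .
qed

text \<open>In contrast to \<open>lagform_le_sqnorm\<close>, the sup bound \<open>c\<close> enters
  linearly in both terms. With \<open>c = w k\<close> the bounds can be summed over the
  eigenfunctions, while \<open>s\<close> stays the same for all of them.\<close>

lemma lagform_le_sup: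
  assumes f: "continuous_on {0..1} f" and g: "continuous_on {0..1} g" and h: "0 \<le> h" and s: "s > 0"
    and le: "\<And>t. t \<in> {0..1} \<Longrightarrow> \<bar>f t\<bar> \<le> c"
  shows "\<bar>lagform h f g\<bar> \<le> c * (s + sqnorm g / s)"
proof -
  have c: "c \<ge> 0" using le[of 0] by auto
  have "\<bar>lagform h f g\<bar> \<le> 2 * (integral {0..1::real} (\<lambda>t. c * s / 2) + integral {0..1} (\<lambda>t. (c / (2 * s)) * (g t)\<^sup>2))"
  proof (rule lagform_bound[OF f g _ _ h])
    fix t u :: real assume "t \<in> {0..1}" "u \<in> {0..1}"
    have "\<bar>f t * g u\<bar> \<le> c * \<bar>1 * g u\<bar>" using le[OF \<open>t \<in> {0..1}\<close>] by (simp add: abs_mult mult_right_mono)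
    also have "\<dots> \<le> c * (s / 2 * 1\<^sup>2 + (g u)\<^sup>2 / (2 * s))"
      by (intro mult_left_mono abs_mult_le_scaled_squares s c)
    finally show "\<bar>f t * g u\<bar> \<le> c * s / 2 + (c / (2 * s)) * (g u)\<^sup>2" by (simp add: algebra_simps)
  qed (use c s in \<open>auto intro!: continuous_intros g\<close>)
  also have "\<dots> = c * (s + sqnorm g / s)"
    unfolding sqnorm_def Henstock_Kurzweil_Integration.integral_mult_right
    using s by (simp add: field_simps)
  finally show ?thesis .
qed

lemma lagform_commute: "lagform h f g = lagform h g f"
  by (simp add: lagform_def add.commute)

lemma lagform_add_left:
  assumes f: "continuous_on {0..1} f" and f': "continuous_on {0..1} f'" and g: "continuous_on {0..1} g" and h: "0 \<le> h"
  shows "lagform h (\<lambda>t. f t + f' t) g = lagform h f g + lagform h f' g"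
proof -
  note c = continuous_on_lag[OF f h] continuous_on_lag[OF g h] continuous_on_lag[OF f' h]
  have "lagform h (\<lambda>t. f t + f' t) g = integral {0..1-h} (\<lambda>t. (f t * g (t + h) + g t * f (t + h)) + (f' t * g (t + h) + g t * f' (t + h)))"
    unfolding lagform_def by (rule arg_cong[of _ _ "integral _"]) (auto simp: algebra_simps)
  also have "\<dots> = lagform h f g + lagform h f' g"
    unfolding lagform_def
    by (rule Henstock_Kurzweil_Integration.integral_add) (intro integrable_continuous_real continuous_intros c)+
  finally show ?thesis .
qed

lemma lagform_scale_left: "lagform h (\<lambda>t. c * f t) g = c * lagform h f g"
proof -
  have "lagform h (\<lambda>t. c * f t) g = integral {0..1-h} (\<lambda>t. c * (f t * g (t + h) + g t * f (t + h)))"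
    unfolding lagform_def by (rule arg_cong[of _ _ "integral _"]) (auto simp: algebra_simps)
  then show ?thesis unfolding lagform_def by simp
qed

lemma lagform_sum_left:
  assumes "finite I" and f: "\<And>i. i \<in> I \<Longrightarrow> continuous_on {0..1} (f i)" and g: "continuous_on {0..1} g" and h: "0 \<le> h"
  shows "lagform h (\<lambda>t. \<Sum>i\<in>I. c i * f i t) g = (\<Sum>i\<in>I. c i * lagform h (f i) g)"
  using assms(1) f
proof (induction I)
  case empty
  then show ?case by (simp add: lagform_def)
next
  case (insert i I)
  have "lagform h (\<lambda>t. c i * f i t + (\<Sum>i\<in>I. c i * f i t)) g =
     lagform h (\<lambda>t. c i * f i t) g + lagform h (\<lambda>t. (\<Sum>i\<in>I. c i * f i t)) g"
    using insert.prems by (intro lagform_add_left g h continuous_intros) auto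
  then show ?case using insert by (simp add: lagform_scale_left)
qed

lemma lagform_square: "lagform h f f = 2 * integral {0..1-h} (\<lambda>t. f t * f (t + h))"
proof -
  have "lagform h f f = integral {0..1-h} (\<lambda>t. 2 * (f t * f (t + h)))"
    unfolding lagform_def by (rule arg_cong[of _ _ "integral _"]) auto
  then show ?thesis by simp
qed

lemma lagform_square_add:
  assumes f: "continuous_on {0..1} f" and g: "continuous_on {0..1} g" and h: "0 \<le> h"
  shows "lagform h (\<lambda>t. f t + g t) (\<lambda>t. f t + g t) = lagform h f f + lagform h g g + 2 * lagform h f g"
proof -
  have fg: "continuous_on {0..1} (\<lambda>t. f t + g t)" by (intro continuous_intros f g)
  have "lagform h (\<lambda>t. f t + g t) (\<lambda>t. f t + g t) = lagform h (\<lambda>t. f t + g t) f + lagform h (\<lambda>t. f t + g t) g"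
    unfolding lagform_add_left[OF f g fg h]
    by (simp only: lagform_commute[of h f "\<lambda>t. f t + g t"] lagform_commute[of h g "\<lambda>t. f t + g t"])
  also have "\<dots> = lagform h f f + lagform h g g + 2 * lagform h f g"
    unfolding lagform_add_left[OF f g f h] lagform_add_left[OF f g g h] lagform_commute[of h g f] by simp
  finally show ?thesis .
qed

lemma cov_est_lagform:
  assumes "\<And>i. i \<in> {1..n} \<Longrightarrow> continuous_on {0..1} (X i)" and h: "0 \<le> h"
  shows "cov_est n X h = 1 / (1 - h) * ((1 / real n) * (\<Sum>i=1..n. lagform h (X i) (X i) / 2))"
proof -
  have "integral {0..1-h} (\<lambda>t. (1 / real n) * (\<Sum>i=1..n. X i t * X i (t + h)))
     = (1 / real n) * (\<Sum>i=1..n. integral {0..1-h} (\<lambda>t. X i t * X i (t + h)))"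
  proof -
    have "(\<lambda>t. X i t * X i (t + h)) integrable_on {0..1-h}" if "i \<in> {1..n}" for i
      by (intro integrable_continuous_real continuous_on_mult continuous_on_lag assms that)
    then show ?thesis
      by (subst Henstock_Kurzweil_Integration.integral_mult_right, subst integral_sum) auto
  qed
  then show ?thesis by (simp add: cov_est_def lagform_square)
qed

text \<open>The identity between the variance and the mean square minus the squared mean, for a
  symmetric bilinear form. It isolates the effect of centring in the single term
  \<open>lagform h B B\<close>.\<close>

lemma lagform_centered:
  assumes X: "\<And>i. i \<in> {1..n} \<Longrightarrow> continuous_on {0..1} (X i)" and h: "0 \<le> h" and n: "n > 0"
  defines "B \<equiv> \<lambda>t. (1 / real n) * (\<Sum>i=1..n. X i t)"
  shows "(\<Sum>i=1..n. lagform h (\<lambda>t. X i t - B t) (\<lambda>t. X i t - B t)) = (\<Sum>i=1..n. lagform h (X i) (X i)) - real n * lagform h B B"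
proof -
  have B: "continuous_on {0..1} B" unfolding B_def using X by (intro continuous_intros) auto
  have nB: "(\<lambda>t. \<Sum>i=1..n. 1 * X i t) = (\<lambda>t. real n * B t)" using n by (simp add: B_def)
  have "(\<Sum>i=1..n. lagform h (X i) B) = lagform h (\<lambda>t. \<Sum>i=1..n. 1 * X i t) B"
    by (subst lagform_sum_left) (use X B h in auto)
  also have "\<dots> = real n * lagform h B B" unfolding nB by (rule lagform_scale_left)
  finally have cross: "(\<Sum>i=1..n. lagform h (X i) B) = real n * lagform h B B" .
  have "lagform h (\<lambda>t. X i t - B t) (\<lambda>t. X i t - B t) = lagform h (X i) (X i) + lagform h B B - 2 * lagform h (X i) B"
    if "i \<in> {1..n}" for i
  proof -
    have "lagform h (\<lambda>t. X i t + (-1) * B t) (\<lambda>t. X i t + (-1) * B t) =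
       lagform h (X i) (X i) + lagform h (\<lambda>t. (-1) * B t) (\<lambda>t. (-1) * B t) + 2 * lagform h (X i) (\<lambda>t. (-1) * B t)"
      by (intro lagform_square_add X that h continuous_intros B)
    moreover have "lagform h (\<lambda>t. (-1) * B t) (\<lambda>t. (-1) * B t) = lagform h B B"
      by (subst lagform_scale_left, subst lagform_commute, subst lagform_scale_left) simp
    moreover have "lagform h (X i) (\<lambda>t. (-1) * B t) = - lagform h (X i) B"
      by (subst lagform_commute, subst lagform_scale_left) (simp add: lagform_commute)
    ultimately show ?thesis by simp
  qed
  then have "(\<Sum>i=1..n. lagform h (\<lambda>t. X i t - B t) (\<lambda>t. X i t - B t))
    = (\<Sum>i=1..n. lagform h (X i) (X i) + lagform h B B - 2 * lagform h (X i) B)" by simp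
  also have "\<dots> = (\<Sum>i=1..n. lagform h (X i) (X i)) + real n * lagform h B B - 2 * (\<Sum>i=1..n. lagform h (X i) B)"
    by (simp add: sum.distrib sum_subtractf sum_distrib_left)
  finally show ?thesis using cross by simp
qed

section \<open>The estimation error for a fixed outcome\<close>

text \<open>Sequences are indexed from 0 here: \<open>phi k\<close> is the eigenfunction number \<open>k + 1\<close> of the statement.\<close>

locale weighted_series =
  fixes phi :: "nat \<Rightarrow> real \<Rightarrow> real" and w :: "nat \<Rightarrow> real"
  assumes w_nonneg: "\<And>k. w k \<ge> 0" and w_summable: "summable w"
    and phi_continuous: "\<And>k. continuous_on {0..1} (phi k)"
    and phi_le: "\<And>k t. t \<in> {0..1} \<Longrightarrow> \<bar>phi k t\<bar> \<le> w k"
begin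

definition "series c t = (\<Sum>k. c k * phi k t)"
definition "wtotal = (\<Sum>k. w k)"
text \<open>The weights enter to the first power, so coefficients of unit second moment give
  expectation \<open>wtotal\<close>. By Cauchy-Schwarz, with \<open>w k\<close> split into two
  square roots, this norm also controls the absolutely weighted sum of the coefficients.\<close>

definition "wnorm c = (\<Sum>k. w k * (c k)\<^sup>2)"

lemma wtotal_nonneg: "wtotal \<ge> 0"
  unfolding wtotal_def using w_nonneg w_summable by (rule suminf_nonneg[rotated])

context
  fixes c :: "nat \<Rightarrow> real"
  assumes sq: "summable (\<lambda>k. w k * (c k)\<^sup>2)"
begin

lemma wnorm_nonneg: "wnorm c \<ge> 0"
  unfolding wnorm_def using w_nonneg sq by (intro suminf_nonneg) auto

lemma weighted_abs_summable: "summable (\<lambda>k. w k * \<bar>c k\<bar>)"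
proof (rule summable_comparison_test'[where N = 0])
  show "summable (\<lambda>k. w k + w k * (c k)\<^sup>2)" by (intro summable_add w_summable sq)
  fix k
  have "2 * \<bar>c k\<bar> \<le> 1 + \<bar>c k\<bar>\<^sup>2" using zero_le_power2[of "1 - \<bar>c k\<bar>"] by (simp add: power2_eq_square algebra_simps)
  moreover have "0 \<le> \<bar>c k\<bar>" by simp
  ultimately have "w k * \<bar>c k\<bar> \<le> w k * (1 + (c k)\<^sup>2)" by (intro mult_left_mono w_nonneg) simp
  then show "norm (w k * \<bar>c k\<bar>) \<le> w k + w k * (c k)\<^sup>2" by (simp add: w_nonneg abs_mult algebra_simps)
qed

lemma weighted_abs_square_le: "(\<Sum>k. w k * \<bar>c k\<bar>)\<^sup>2 \<le> wtotal * wnorm c"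
proof (rule LIMSEQ_le_const2)
  show "(\<lambda>m. (\<Sum>k<m. w k * \<bar>c k\<bar>)\<^sup>2) \<longlonglongrightarrow> (\<Sum>k. w k * \<bar>c k\<bar>)\<^sup>2"
    by (intro tendsto_intros summable_LIMSEQ weighted_abs_summable)
  have "(\<Sum>k<m. w k * \<bar>c k\<bar>)\<^sup>2 \<le> wtotal * wnorm c" for m
  proof -
    have "(\<Sum>k<m. w k * \<bar>c k\<bar>) = (\<Sum>k<m. sqrt (w k) * (sqrt (w k) * \<bar>c k\<bar>))"
      by (rule sum.cong) (use w_nonneg in \<open>auto simp: mult.assoc[symmetric]\<close>)
    also have "\<dots>\<^sup>2 \<le> (\<Sum>k<m. (sqrt (w k))\<^sup>2) * (\<Sum>k<m. (sqrt (w k) * \<bar>c k\<bar>)\<^sup>2)"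
      by (rule Cauchy_Schwarz_ineq_sum)
    also have "\<dots> = (\<Sum>k<m. w k) * (\<Sum>k<m. w k * (c k)\<^sup>2)"
      using w_nonneg by (simp add: power_mult_distrib)
    also have "\<dots> \<le> wtotal * wnorm c"
      unfolding wtotal_def wnorm_def
      by (intro mult_mono sum_le_suminf w_summable sq suminf_nonneg sum_nonneg) (use w_nonneg in auto)
    finally show ?thesis .
  qed
  then show "\<exists>m0. \<forall>m\<ge>m0. (\<Sum>k<m. w k * \<bar>c k\<bar>)\<^sup>2 \<le> wtotal * wnorm c" by blast
qed

lemma series_term_le: "t \<in> {0..1} \<Longrightarrow> \<bar>c k * phi k t\<bar> \<le> w k * \<bar>c k\<bar>"
  using mult_right_mono[OF phi_le abs_ge_zero, of t k "c k"] by (simp add: abs_mult mult.commute)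

lemma series_summable: "t \<in> {0..1} \<Longrightarrow> summable (\<lambda>k. c k * phi k t)"
  by (rule summable_comparison_test'[where N = 0, OF weighted_abs_summable]) (use series_term_le in auto)

lemma series_tail:
  assumes t: "t \<in> {0..1}"
  shows "\<bar>series c t - (\<Sum>k<m. c k * phi k t)\<bar> \<le> (\<Sum>k. w (k + m) * \<bar>c (k + m)\<bar>)"
proof -
  have "series c t - (\<Sum>k<m. c k * phi k t) = (\<Sum>k. c (k + m) * phi (k + m) t)"
    unfolding series_def using suminf_split_initial_segment[OF series_summable[OF t], of m] by simp
  also have "norm \<dots> \<le> (\<Sum>k. w (k + m) * \<bar>c (k + m)\<bar>)"
  proof (rule norm_suminf_le)
    show "summable (\<lambda>k. w (k + m) * \<bar>c (k + m)\<bar>)"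
      using summable_ignore_initial_segment[OF weighted_abs_summable] .
  qed (use series_term_le[OF t] in simp)
  finally show ?thesis by simp
qed

lemma tail_LIMSEQ: "(\<lambda>m. \<Sum>k. w (k + m) * \<bar>c (k + m)\<bar>) \<longlonglongrightarrow> 0"
  by (rule suminf_exist_split2[OF weighted_abs_summable])

lemma series_le: "t \<in> {0..1} \<Longrightarrow> \<bar>series c t\<bar> \<le> (\<Sum>k. w k * \<bar>c k\<bar>)"
  using series_tail[of t 0] by simp

lemma series_square_le: "t \<in> {0..1} \<Longrightarrow> (series c t)\<^sup>2 \<le> wtotal * wnorm c"
  using power_mono[OF series_le abs_ge_zero, of t 2] weighted_abs_square_le by simp

lemma series_continuous: "continuous_on {0..1} (series c)"
proof (rule uniform_limit_theorem)
  show "\<forall>\<^sub>F m in sequentially. continuous_on {0..1} (\<lambda>t. \<Sum>k<m. c k * phi k t)"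
    by (intro always_eventually allI continuous_intros phi_continuous)
  show "uniform_limit {0..1} (\<lambda>m t. \<Sum>k<m. c k * phi k t) (series c) sequentially"
  proof (rule uniform_limitI)
    fix d :: real assume "d > 0"
    with tail_LIMSEQ have "\<forall>\<^sub>F m in sequentially. (\<Sum>k. w (k + m) * \<bar>c (k + m)\<bar>) < d"
      by (rule order_tendstoD(2))
    then show "\<forall>\<^sub>F m in sequentially. \<forall>t\<in>{0..1}. dist (\<Sum>k<m. c k * phi k t) (series c t) < d"
    proof eventually_elim
      case (elim m)
      show ?case
        using le_less_trans[OF series_tail elim] by (auto simp: dist_real_def abs_minus_commute)
    qed
  qed
qed auto

text \<open>The partial sums converge uniformly, and the sup bound with \<open>s = 1\<close> carries
  the tail through the form.\<close>

lemma lagform_series: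
  assumes g: "continuous_on {0..1} g" and h: "0 \<le> h"
  shows "(\<lambda>k. c k * lagform h (phi k) g) sums lagform h (series c) g"
proof -
  have le: "norm ((\<Sum>k<m. c k * lagform h (phi k) g) - lagform h (series c) g)
      \<le> (\<Sum>k. w (k + m) * \<bar>c (k + m)\<bar>) * (1 + sqnorm g)" for m
  proof -
    define f where "f t = (\<Sum>k<m. c k * phi k t)" for t
    have f: "continuous_on {0..1} f" unfolding f_def by (intro continuous_intros phi_continuous)
    have eq: "(\<Sum>k<m. c k * lagform h (phi k) g) = lagform h f g"
      unfolding f_def by (rule lagform_sum_left[symmetric]) (use phi_continuous g h in auto)
    have "lagform h (\<lambda>t. series c t + (-1) * f t) g = lagform h (series c) g - lagform h f g"
      by (subst lagform_add_left)
         (use lagform_scale_left[of h "-1" f g] in \<open>auto intro!: continuous_intros series_continuous f g h\<close>)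
    moreover have "\<bar>lagform h (\<lambda>t. series c t + (-1) * f t) g\<bar> \<le> (\<Sum>k. w (k + m) * \<bar>c (k + m)\<bar>) * (1 + sqnorm g / 1)"
      by (rule lagform_le_sup)
         (use series_tail[of _ m] in \<open>auto intro!: continuous_intros series_continuous f g h phi_continuous simp: f_def\<close>)
    ultimately show ?thesis unfolding eq by simp
  qed
  have "(\<lambda>m. (\<Sum>k. w (k + m) * \<bar>c (k + m)\<bar>) * (1 + sqnorm g)) \<longlonglongrightarrow> 0 * (1 + sqnorm g)"
    by (intro tendsto_intros tail_LIMSEQ)
  then have "(\<lambda>m. (\<Sum>k<m. c k * lagform h (phi k) g) - lagform h (series c) g) \<longlonglongrightarrow> 0"
    using Lim_null_comparison[OF always_eventually[OF allI[OF le]], of "\<lambda>m. m" sequentially] by simp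
  then show ?thesis unfolding sums_def by (simp add: LIM_zero_iff)
qed

end

end

section \<open>Linearity of the fit and its residual on smooth functions\<close>

context spline_basis
begin

lemma coef_sum: "coef (\<lambda>j. \<Sum>i\<in>I. a i * u i j) l = (\<Sum>i\<in>I. a i * coef (u i) l)"
  by (simp add: coef_def dinner_sum_left dinner_scale_left)

lemma coef_add: "coef (\<lambda>j. u j + u' j) l = coef u l + coef u' l"
  by (simp add: coef_def dinner_add_left)

lemma coef_diff: "coef (\<lambda>j. u j - u' j) l = coef u l - coef u' l"
  by (simp add: coef_def dinner_diff_left)

lemma proj_add: "proj (\<lambda>j. u j + u' j) t = proj u t + proj u' t"
  by (simp add: proj_def coef_add distrib_right sum.distrib)

lemma proj_diff: "proj (\<lambda>j. u j - u' j) t = proj u t - proj u' t"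
  by (simp add: proj_def coef_diff left_diff_distrib sum_subtractf)

lemma proj_sum: "proj (\<lambda>j. \<Sum>i\<in>I. a i * u i j) t = (\<Sum>i\<in>I. a i * proj (u i) t)"
  unfolding proj_def coef_sum sum_distrib_right sum_distrib_left
  by (subst sum.swap) (simp add: mult.assoc)

lemma proj_sqnorm: "sqnorm (proj u) \<le> spline_const p * (\<Sum>l<K. (coef u l)\<^sup>2)"
  unfolding sqnorm_def by (rule proj_integral)

lemma const_nonneg: "spline_const p \<ge> 0"
  by (simp add: spline_const_def)

lemma proj_sqnorm_le: "sqnorm (proj u) \<le> spline_const p * dinner N u u"
  by (rule order.trans[OF proj_sqnorm mult_left_mono[OF coef_bessel const_nonneg]])

lemma dinner_self_le:
  assumes "\<And>j. j \<in> {1..N} \<Longrightarrow> (u j)\<^sup>2 \<le> c"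
  shows "dinner N u u \<le> c"
proof -
  have "(\<Sum>j=1..N. u j * u j) \<le> (\<Sum>j=1..N. c)"
    by (rule sum_mono) (use assms in \<open>auto simp: power2_eq_square\<close>)
  then show ?thesis using N0 by (simp add: dinner_def divide_simps mult.commute)
qed

text \<open>The fit reproduces the spline \<open>g\<close>, so that \<open>f\<close> and
  \<open>f - g\<close> have the same residual. The fit of \<open>f - g\<close> is controlled by its
  mean square on the design, and \<open>f - g\<close> itself by its supremum.\<close>

lemma residual_sqnorm:
  assumes f: "continuous_on {0..1} f" and g: "g \<in> spline_space p J"
    and le: "\<And>t. t \<in> {0..1} \<Longrightarrow> \<bar>f t - g t\<bar> \<le> c"
  shows "sqnorm (\<lambda>t. proj (grid N f) t - f t) \<le> 2 * (spline_const p + 1) * c\<^sup>2"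
proof -
  note gc = spline_continuous[OF g p]
  define u where "u t = f t - g t" for t
  have u: "continuous_on {0..1} u" unfolding u_def by (intro continuous_intros f gc)
  have gu: "grid N u = (\<lambda>j. grid N f j - grid N g j)" by (auto simp: grid_def u_def)
  have eq: "proj (grid N f) t - f t = proj (grid N u) t + (- u t)" if "t \<in> {0..1}" for t
    unfolding gu proj_diff proj_of_spline[OF g that] by (simp add: u_def)
  have "sqnorm (\<lambda>t. proj (grid N f) t - f t) = sqnorm (\<lambda>t. proj (grid N u) t + (- u t))"
    unfolding sqnorm_def by (rule integral_cong) (use eq in auto)
  also have "\<dots> \<le> 2 * sqnorm (proj (grid N u)) + 2 * sqnorm (\<lambda>t. - u t)"
    by (intro sqnorm_add_le proj_continuous continuous_intros u)
  also have "sqnorm (\<lambda>t. - u t) \<le> c\<^sup>2"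
    by (intro sqnorm_le continuous_intros u) (use le in \<open>simp add: u_def abs_minus_commute\<close>)
  also have "sqnorm (proj (grid N u)) \<le> spline_const p * c\<^sup>2"
  proof (rule order.trans[OF proj_sqnorm_le mult_left_mono[OF dinner_self_le const_nonneg]])
    fix j assume "j \<in> {1..N}"
    then have "real j / real N \<in> {0..1}" by auto
    from power_mono[OF le[OF this] abs_ge_zero, of 2] show "(grid N u j)\<^sup>2 \<le> c\<^sup>2"
      by (simp add: grid_def u_def)
  qed
  finally show ?thesis by (simp add: algebra_simps)
qed

end

text \<open>The sample at one outcome: \<open>x\<close> holds the scores, \<open>v\<close> the
  errors already multiplied by sigma, and \<open>rho\<close> is the approximation rate. Smoothness
  appears as \<open>phi_approx\<close>, in which \<open>w k\<close> is at the same time the size and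
  the approximation constant of an eigenfunction.\<close>

locale spline_sample = spline_basis p J N K e + weighted_series phi w
  for p J N K e phi w +
  fixes n :: nat and x v :: "nat \<Rightarrow> nat \<Rightarrow> real" and rho :: real
  assumes n: "n > 0" and rho: "0 < rho" "rho \<le> 1"
    and phi_approx: "\<And>k. \<exists>g\<in>spline_space p J. \<forall>t\<in>{0..1}. \<bar>phi k t - g t\<bar> \<le> rho * w k"
    and x_summable: "\<And>i. i \<in> {1..n} \<Longrightarrow> summable (\<lambda>k. w k * (x i k)\<^sup>2)"
begin

definition "Z i = series (x i)"
definition "noise_fit i = proj (v i)"
definition "bias i t = proj (grid N (Z i)) t - Z i t"
definition "xbar k = (1 / real n) * (\<Sum>i=1..n. x i k)"
definition "vbar j = (1 / real n) * (\<Sum>i=1..n. v i j)"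
text \<open>The errors averaged over the curves with the scores of component \<open>k\<close> as
  weights; its projection is what \<open>phi k\<close> is paired with in the product of curves and
  noise.\<close>

definition "vcross k j = (\<Sum>i=1..n. (x i k / real n) * v i j)"
definition "score_energy = (1 / real n) * (\<Sum>i=1..n. wnorm (x i))"
definition "noise_energy = (1 / real n) * (\<Sum>i=1..n. \<Sum>l<K. (coef (v i) l)\<^sup>2)"
definition "cross_energy = (\<Sum>k. w k * (\<Sum>l<K. (coef (vcross k) l)\<^sup>2))"
definition "mean_score_energy = wnorm xbar"
definition "mean_noise_energy = dinner N vbar vbar"
text \<open>The contributions are, in order, bias, squared noise, the product of curves and noise,
  and centring. The free parameter \<open>s\<close> balances the third one and is chosen once
  expectations are known.\<close>

definition "error_bound s = (12 * spline_const p + 13) * rho * (wtotal * score_energy + 1) + 2 * spline_const p * noise_energy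
    + (wtotal * s + spline_const p * cross_energy / s) + 2 * spline_const p * (wtotal * mean_score_energy + mean_noise_energy)"

lemma Z_continuous: "i \<in> {1..n} \<Longrightarrow> continuous_on {0..1} (Z i)"
  unfolding Z_def by (intro series_continuous x_summable)

lemma bias_continuous: "i \<in> {1..n} \<Longrightarrow> continuous_on {0..1} (bias i)"
  unfolding bias_def[abs_def] by (intro continuous_on_diff proj_continuous Z_continuous)

lemma noise_fit_continuous: "continuous_on {0..1} (noise_fit i)"
  unfolding noise_fit_def by (rule proj_continuous)

text \<open>The partial sums of the series carry the approximation; this avoids differentiating it term by term.\<close>

lemma Z_spline_approx:
  assumes i: "i \<in> {1..n}"
  shows "\<exists>g\<in>spline_space p J. \<forall>t\<in>{0..1}. \<bar>Z i t - g t\<bar> \<le> rho * ((\<Sum>k. w k * \<bar>x i k\<bar>) + 1)"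
proof -
  note sq = x_summable[OF i]
  obtain g where g: "\<And>k. g k \<in> spline_space p J"
    and le: "\<And>k t. t \<in> {0..1} \<Longrightarrow> \<bar>phi k t - g k t\<bar> \<le> rho * w k"
    using phi_approx by metis
  have "\<forall>\<^sub>F m in sequentially. (\<Sum>k. w (k + m) * \<bar>x i (k + m)\<bar>) < rho"
    by (rule order_tendstoD(2)[OF tail_LIMSEQ[OF sq] rho(1)])
  \<comment> \<open>The truncation point depends on the outcome, which does no harm since the final
    bound does not mention it. The tail below \<open>rho\<close> is the \<open>+ 1\<close> in that
    bound.\<close>
  then obtain m where m: "(\<Sum>k. w (k + m) * \<bar>x i (k + m)\<bar>) < rho"
    by (auto simp: eventually_sequentially)
  have "\<bar>Z i t - (\<Sum>k<m. x i k * g k t)\<bar> \<le> rho * ((\<Sum>k. w k * \<bar>x i k\<bar>) + 1)" if t: "t \<in> {0..1}" for t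
  proof -
    have "\<bar>(\<Sum>k<m. x i k * phi k t) - (\<Sum>k<m. x i k * g k t)\<bar> = \<bar>\<Sum>k<m. x i k * (phi k t - g k t)\<bar>"
      by (simp add: right_diff_distrib sum_subtractf)
    also have "\<dots> \<le> (\<Sum>k<m. \<bar>x i k\<bar> * (rho * w k))"
      by (rule order.trans[OF sum_abs]) (auto simp: abs_mult intro!: sum_mono mult_left_mono le t)
    also have "\<dots> = rho * (\<Sum>k<m. w k * \<bar>x i k\<bar>)" by (simp add: sum_distrib_left mult_ac)
    also have "\<dots> \<le> rho * (\<Sum>k. w k * \<bar>x i k\<bar>)"
      by (intro mult_left_mono sum_le_suminf weighted_abs_summable sq) (use rho w_nonneg in auto)
    finally show ?thesis using series_tail[OF sq t, of m] m by (simp add: Z_def algebra_simps)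
  qed
  moreover have "(\<lambda>t. \<Sum>k<m. x i k * g k t) \<in> spline_space p J"
    by (rule spline_space_sum) (use p g in auto)
  ultimately show ?thesis by (intro bexI[of _ "\<lambda>t. \<Sum>k<m. x i k * g k t"] ballI)
qed

lemma bias_sqnorm:
  assumes i: "i \<in> {1..n}"
  shows "sqnorm (bias i) \<le> 4 * (spline_const p + 1) * rho\<^sup>2 * (wtotal * wnorm (x i) + 1)"
proof -
  define s where "s = (\<Sum>k. w k * \<bar>x i k\<bar>)"
  obtain g where g: "g \<in> spline_space p J" "\<And>t. t \<in> {0..1} \<Longrightarrow> \<bar>Z i t - g t\<bar> \<le> rho * (s + 1)"
    using Z_spline_approx[OF i] unfolding s_def by blast
  have "sqnorm (bias i) \<le> 2 * (spline_const p + 1) * (rho * (s + 1))\<^sup>2"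
    unfolding bias_def[abs_def] by (rule residual_sqnorm[OF Z_continuous[OF i] g])
  also have "\<dots> = 2 * (spline_const p + 1) * rho\<^sup>2 * (s + 1)\<^sup>2" by (simp add: power_mult_distrib)
  also have "\<dots> \<le> 2 * (spline_const p + 1) * rho\<^sup>2 * (2 * (wtotal * wnorm (x i) + 1))"
  proof (rule mult_left_mono)
    have "(s + 1)\<^sup>2 \<le> 2 * s\<^sup>2 + 2" using zero_le_power2[of "s - 1"] by (simp add: power2_eq_square algebra_simps)
    also have "\<dots> \<le> 2 * (wtotal * wnorm (x i) + 1)"
      using weighted_abs_square_le[OF x_summable[OF i]] by (simp add: s_def)
    finally show "(s + 1)\<^sup>2 \<le> 2 * (wtotal * wnorm (x i) + 1)" .
  qed (use const_nonneg in auto)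
  finally show ?thesis by (simp add: algebra_simps)
qed

lemma Z_sqnorm:
  assumes i: "i \<in> {1..n}"
  shows "sqnorm (Z i) \<le> wtotal * wnorm (x i)"
proof -
  have "sqnorm (Z i) \<le> (\<Sum>k. w k * \<bar>x i k\<bar>)\<^sup>2"
    by (rule sqnorm_le[OF Z_continuous[OF i]]) (use series_le[OF x_summable[OF i]] in \<open>auto simp: Z_def\<close>)
  also have "\<dots> \<le> wtotal * wnorm (x i)" by (rule weighted_abs_square_le[OF x_summable[OF i]])
  finally show ?thesis .
qed

text \<open>The squared norm of the bias is of order \<open>rho^2\<close>, so its product with the
  curve is balanced with the parameter \<open>rho\<close> and is of order \<open>rho\<close>; in the
  square of the bias, \<open>rho^2\<close> is relaxed to \<open>rho\<close>. The constant is 8(c+1)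
  from the square and 1 + 4(c+1) from the product, with \<open>c = spline_const p\<close>.\<close>

lemma curve_term_bound:
  assumes i: "i \<in> {1..n}" and h: "0 \<le> h"
  shows "\<bar>lagform h (\<lambda>t. bias i t + noise_fit i t) (\<lambda>t. bias i t + noise_fit i t) / 2 + lagform h (Z i) (bias i)\<bar>
    \<le> (12 * spline_const p + 13) * rho * (wtotal * wnorm (x i) + 1) + 2 * spline_const p * (\<Sum>l<K. (coef (v i) l)\<^sup>2)"
proof -
  define c where "c = spline_const p"
  define S where "S = wtotal * wnorm (x i) + 1"
  have S: "S \<ge> 1" unfolding S_def using wtotal_nonneg wnorm_nonneg[OF x_summable[OF i]] by simp
  have c: "c \<ge> 0" unfolding c_def by (rule const_nonneg)
  note cont = Z_continuous[OF i] bias_continuous[OF i] noise_fit_continuous[of i]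
  have D: "continuous_on {0..1} (\<lambda>t. bias i t + noise_fit i t)" by (intro continuous_intros cont)
  have Rs: "sqnorm (bias i) \<le> 4 * (c + 1) * rho\<^sup>2 * S" unfolding c_def S_def by (rule bias_sqnorm[OF i])
  have r2: "rho\<^sup>2 \<le> rho" using rho by (simp add: power2_eq_square mult_left_le)
  have Rs': "sqnorm (bias i) \<le> 4 * (c + 1) * rho * S"
    by (rule order.trans[OF Rs]) (use c S r2 in \<open>intro mult_right_mono mult_left_mono, auto\<close>)
  have RsZ: "sqnorm (bias i) / rho \<le> 4 * (c + 1) * rho * S"
    using Rs rho by (simp add: pos_divide_le_eq power2_eq_square mult_ac)
  have Es: "sqnorm (noise_fit i) \<le> c * (\<Sum>l<K. (coef (v i) l)\<^sup>2)"
    unfolding noise_fit_def c_def by (rule proj_sqnorm)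
  have 1: "\<bar>lagform h (\<lambda>t. bias i t + noise_fit i t) (\<lambda>t. bias i t + noise_fit i t)\<bar> \<le> 2 * (2 * sqnorm (bias i) + 2 * sqnorm (noise_fit i))"
    using lagform_le_sqnorm[OF D D h, of 1] sqnorm_add_le[OF cont(2,3)] by simp
  have 2: "\<bar>lagform h (Z i) (bias i)\<bar> \<le> rho * sqnorm (Z i) + sqnorm (bias i) / rho"
    by (rule lagform_le_sqnorm[OF cont(1,2) h rho(1)])
  have 3: "rho * sqnorm (Z i) \<le> rho * S"
    using Z_sqnorm[OF i] rho by (intro mult_left_mono) (auto simp: S_def)
  have 4: "(12 * c + 13) * rho * S = 2 * (4 * (c + 1) * rho * S) + rho * S + 4 * (c + 1) * rho * S"
    by (simp add: algebra_simps)
  define e where "e = (\<Sum>l<K. (coef (v i) l)\<^sup>2)"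
  define a where "a = lagform h (\<lambda>t. bias i t + noise_fit i t) (\<lambda>t. bias i t + noise_fit i t)"
  define b where "b = lagform h (Z i) (bias i)"
  have "\<bar>a / 2 + b\<bar> \<le> \<bar>a\<bar> / 2 + \<bar>b\<bar>" by (simp add: abs_if)
  also have "\<dots> \<le> (2 * sqnorm (bias i) + 2 * sqnorm (noise_fit i)) + (rho * sqnorm (Z i) + sqnorm (bias i) / rho)"
  proof (rule add_mono)
    show "\<bar>a\<bar> / 2 \<le> 2 * sqnorm (bias i) + 2 * sqnorm (noise_fit i)" using 1 unfolding a_def[symmetric] by simp
  qed (use 2 in \<open>simp add: b_def\<close>)
  also have "\<dots> \<le> (2 * (4 * (c + 1) * rho * S) + 2 * (c * e)) + (rho * S + 4 * (c + 1) * rho * S)"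
    using Rs' RsZ Es 3 unfolding e_def by (intro add_mono mult_left_mono[of _ _ "2 :: real"]) auto
  also have "\<dots> = (12 * c + 13) * rho * S + 2 * c * e" unfolding 4 by simp
  finally show ?thesis unfolding a_def b_def c_def S_def e_def .
qed

lemma vcross_summable: "summable (\<lambda>k. w k * (\<Sum>l<K. (coef (vcross k) l)\<^sup>2))"
proof (rule summable_comparison_test'[where N = 0])
  define B where "B = (\<Sum>l<K. \<Sum>i=1..n. (coef (v i) l / real n)\<^sup>2)"
  show "summable (\<lambda>k. (\<Sum>i=1..n. w k * (x i k)\<^sup>2) * B)"
    by (intro summable_mult2 summable_sum x_summable)
  fix k
  have "(\<Sum>l<K. (coef (vcross k) l)\<^sup>2) \<le> (\<Sum>l<K. (\<Sum>i=1..n. (x i k)\<^sup>2) * (\<Sum>i=1..n. (coef (v i) l / real n)\<^sup>2))"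
  proof (rule sum_mono)
    fix l
    have "coef (vcross k) l = (\<Sum>i=1..n. x i k * (coef (v i) l / real n))"
    proof -
      have "vcross k = (\<lambda>j. \<Sum>i=1..n. (x i k / real n) * v i j)" by (rule ext) (simp add: vcross_def)
      then show ?thesis by (simp only: coef_sum) simp
    qed
    then show "(coef (vcross k) l)\<^sup>2 \<le> (\<Sum>i=1..n. (x i k)\<^sup>2) * (\<Sum>i=1..n. (coef (v i) l / real n)\<^sup>2)"
      using Cauchy_Schwarz_ineq_sum[of "\<lambda>i. x i k" "\<lambda>i. coef (v i) l / real n" "{1..n}"] by (simp only:)
  qed
  also have "\<dots> = (\<Sum>i=1..n. (x i k)\<^sup>2) * B" by (simp add: B_def sum_distrib_left)
  finally have "w k * (\<Sum>l<K. (coef (vcross k) l)\<^sup>2) \<le> w k * ((\<Sum>i=1..n. (x i k)\<^sup>2) * B)"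
    by (rule mult_left_mono) (rule w_nonneg)
  also have "\<dots> = (\<Sum>i=1..n. w k * (x i k)\<^sup>2) * B" by (simp add: sum_distrib_left)
  finally show "norm (w k * (\<Sum>l<K. (coef (vcross k) l)\<^sup>2)) \<le> (\<Sum>i=1..n. w k * (x i k)\<^sup>2) * B"
    by (simp add: w_nonneg sum_nonneg)
qed

text \<open>Expanding the curves in \<open>phi\<close> leaves the functions \<open>proj (vcross k)\<close>, which do not depend on the lag;
  this is why uniformity in the lag costs nothing.\<close>

lemma cross_term_bound:
  assumes h: "0 \<le> h" and s: "s > 0"
  shows "\<bar>(1 / real n) * (\<Sum>i=1..n. lagform h (Z i) (noise_fit i))\<bar> \<le> wtotal * s + spline_const p * cross_energy / s"
proof -
  have "(\<lambda>k. \<Sum>i=1..n. (1 / real n) * (x i k * lagform h (phi k) (noise_fit i))) sums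
        (\<Sum>i=1..n. (1 / real n) * lagform h (Z i) (noise_fit i))"
    unfolding Z_def by (intro sums_sum sums_mult lagform_series x_summable noise_fit_continuous h)
  moreover have "(\<Sum>i=1..n. (1 / real n) * (x i k * lagform h (phi k) (noise_fit i))) = lagform h (phi k) (proj (vcross k))" for k
  proof -
    have eq: "proj (vcross k) = (\<lambda>t. \<Sum>i=1..n. (x i k / real n) * noise_fit i t)"
    proof -
      have "vcross k = (\<lambda>j. \<Sum>i=1..n. (x i k / real n) * v i j)" by (rule ext) (simp add: vcross_def)
      then show ?thesis by (intro ext) (simp only: proj_sum noise_fit_def)
    qed
    have "lagform h (proj (vcross k)) (phi k) = (\<Sum>i=1..n. (x i k / real n) * lagform h (noise_fit i) (phi k))"
      unfolding eq by (rule lagform_sum_left) (use noise_fit_continuous phi_continuous h in auto)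
    also have "\<dots> = (\<Sum>i=1..n. (1 / real n) * (x i k * lagform h (phi k) (noise_fit i)))"
      by (rule sum.cong) (simp_all add: lagform_commute[of h "noise_fit _" "phi k"])
    finally show ?thesis by (subst lagform_commute) (rule sym)
  qed
  ultimately have sums: "(\<lambda>k. lagform h (phi k) (proj (vcross k))) sums
        ((1 / real n) * (\<Sum>i=1..n. lagform h (Z i) (noise_fit i)))"
    by (simp add: sum_distrib_left)
  \<comment> \<open>A summable majorant for the expansion: the two parts of the sup bound for
    \<open>phi k\<close>, whose totals over \<open>k\<close> are the two terms of the claim.\<close>
  define q where "q k = w k * s + spline_const p / s * (w k * (\<Sum>l<K. (coef (vcross k) l)\<^sup>2))" for k
  have q: "q sums (wtotal * s + spline_const p / s * cross_energy)"
    unfolding q_def wtotal_def cross_energy_def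
    by (intro sums_add sums_mult sums_mult2 summable_sums w_summable vcross_summable)
  have le: "norm (lagform h (phi k) (proj (vcross k))) \<le> q k" for k
  proof -
    have "\<bar>lagform h (phi k) (proj (vcross k))\<bar> \<le> w k * (s + sqnorm (proj (vcross k)) / s)"
      by (rule lagform_le_sup) (use phi_continuous proj_continuous h s phi_le in auto)
    also have "\<dots> \<le> w k * (s + (spline_const p * (\<Sum>l<K. (coef (vcross k) l)\<^sup>2)) / s)"
      by (intro mult_left_mono add_left_mono divide_right_mono proj_sqnorm w_nonneg) (use s in auto)
    also have "\<dots> = q k" by (simp add: q_def algebra_simps)
    finally show ?thesis by simp
  qed
  have "norm (\<Sum>k. lagform h (phi k) (proj (vcross k))) \<le> suminf q"
    by (rule norm_suminf_le[OF le sums_summable[OF q]])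
  then show ?thesis unfolding sums_unique[OF sums, symmetric] sums_unique[OF q, symmetric]
    by (simp only: real_norm_def times_divide_eq_left)
qed

lemma Zbar_series: "t \<in> {0..1} \<Longrightarrow> series xbar t = (1 / real n) * (\<Sum>i=1..n. Z i t)"
proof -
  assume t: "t \<in> {0..1}"
  have "(\<lambda>k. (1 / real n) * (\<Sum>i=1..n. x i k * phi k t)) sums ((1 / real n) * (\<Sum>i=1..n. Z i t))"
    unfolding Z_def series_def
    by (intro sums_mult sums_sum summable_sums series_summable x_summable t)
  then have "(\<lambda>k. xbar k * phi k t) sums ((1 / real n) * (\<Sum>i=1..n. Z i t))"
    by (simp add: xbar_def sum_distrib_right)
  then show ?thesis unfolding series_def by (rule sums_unique[symmetric])
qed

lemma xbar_summable: "summable (\<lambda>k. w k * (xbar k)\<^sup>2)"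
proof (rule summable_comparison_test'[where N = 0])
  show "summable (\<lambda>k. (1 / real n) * (\<Sum>i=1..n. w k * (x i k)\<^sup>2))"
    by (intro summable_mult summable_sum x_summable)
  fix k
  have "(\<Sum>i=1..n. 1 * x i k)\<^sup>2 \<le> (\<Sum>i=1..n. 1\<^sup>2) * (\<Sum>i=1..n. (x i k)\<^sup>2)"
    by (rule Cauchy_Schwarz_ineq_sum)
  then have "(xbar k)\<^sup>2 \<le> (1 / real n) * (\<Sum>i=1..n. (x i k)\<^sup>2)"
    using n by (simp add: xbar_def power_divide divide_simps power2_eq_square mult_ac)
  then have "w k * (xbar k)\<^sup>2 \<le> w k * ((1 / real n) * (\<Sum>i=1..n. (x i k)\<^sup>2))"
    by (rule mult_left_mono) (rule w_nonneg)
  then show "norm (w k * (xbar k)\<^sup>2) \<le> (1 / real n) * (\<Sum>i=1..n. w k * (x i k)\<^sup>2)"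
    by (simp add: w_nonneg sum_distrib_left mult_ac)
qed

text \<open>The mean of the fits is itself a fit, to the averaged curve plus the averaged errors, so
  the contraction property of the projection suffices and no bias has to be split off.\<close>

lemma mean_term_bound:
  "sqnorm (proj (\<lambda>j. grid N (series xbar) j + vbar j)) \<le> 2 * spline_const p * (wtotal * mean_score_energy + mean_noise_energy)"
proof -
  define u where "u j = grid N (series xbar) j + vbar j" for j
  have "dinner N u u \<le> 2 * dinner N (grid N (series xbar)) (grid N (series xbar)) + 2 * mean_noise_energy"
  proof -
    have "(\<Sum>j=1..N. u j * u j) \<le> (\<Sum>j=1..N. 2 * (grid N (series xbar) j * grid N (series xbar) j) + 2 * (vbar j * vbar j))"
    proof (rule sum_mono)
      fix j
      have "0 \<le> (grid N (series xbar) j - vbar j)\<^sup>2" by simp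
      then show "u j * u j \<le> 2 * (grid N (series xbar) j * grid N (series xbar) j) + 2 * (vbar j * vbar j)"
        unfolding u_def by (simp add: power2_eq_square algebra_simps)
    qed
    then show ?thesis using N0
      by (simp add: dinner_def mean_noise_energy_def sum.distrib sum_distrib_left[symmetric] divide_simps)
  qed
  also have "dinner N (grid N (series xbar)) (grid N (series xbar)) \<le> wtotal * mean_score_energy"
    unfolding mean_score_energy_def
  proof (rule dinner_self_le)
    fix j assume "j \<in> {1..N}"
    then show "(grid N (series xbar) j)\<^sup>2 \<le> wtotal * wnorm xbar"
      unfolding grid_def by (intro series_square_le xbar_summable) auto
  qed
  finally have "dinner N u u \<le> 2 * (wtotal * mean_score_energy + mean_noise_energy)" by simp
  from mult_left_mono[OF this const_nonneg] proj_sqnorm_le[of u] show ?thesis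
    unfolding u_def by (simp add: algebra_simps)
qed

lemma cov_est_diff_bound:
  assumes h: "0 \<le> h" "h < 1" and s: "s > 0"
  shows "\<bar>cov_est n (Zhat p J N n (\<lambda>i j. grid N m j + grid N (Z i) j + v i j)) h - cov_est n Z h\<bar> \<le> 1 / (1 - h) * error_bound s"
proof -
  define V where "V i t = Z i t + (bias i t + noise_fit i t)" for i t
  define B where "B t = (1 / real n) * (\<Sum>i=1..n. V i t)" for t
  define D where "D i t = bias i t + noise_fit i t" for i t
  note cont = Z_continuous bias_continuous noise_fit_continuous
  have Dc: "continuous_on {0..1} (D i)" if "i \<in> {1..n}" for i
    unfolding D_def by (intro continuous_intros cont that)
  have Vc: "continuous_on {0..1} (V i)" if "i \<in> {1..n}" for i
    unfolding V_def by (intro continuous_intros cont that)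
  have Bc: "continuous_on {0..1} B" unfolding B_def by (intro continuous_intros Vc)
  have V: "V i t = proj (\<lambda>j. grid N (Z i) j + v i j) t" for i t
    by (simp add: V_def bias_def noise_fit_def proj_add)
  have fitV: "fit (\<lambda>j. grid N m j + grid N (Z i) j + v i j) t = proj (grid N m) t + V i t" if "t \<in> {0..1}" for i t
    using that by (simp add: fit_eq_proj V proj_add add.assoc)
  have Zh: "Zhat p J N n (\<lambda>i j. grid N m j + grid N (Z i) j + v i j) i t = V i t - B t" if "t \<in> {0..1}" for i t
    unfolding Zhat_def B_def fitV[OF that] using n by (simp add: sum.distrib field_simps)
  have "cov_est n (Zhat p J N n (\<lambda>i j. grid N m j + grid N (Z i) j + v i j)) h = cov_est n (\<lambda>i t. V i t - B t) h"
    unfolding cov_est_def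
    by (intro arg_cong[of _ _ "\<lambda>z. 1 / (1 - h) * z"] integral_cong) (use h Zh in auto)
  also have "\<dots> = 1 / (1 - h) * ((1 / real n) * ((\<Sum>i=1..n. lagform h (V i) (V i)) - real n * lagform h B B) / 2)"
  proof -
    have "cov_est n (\<lambda>i t. V i t - B t) h
      = 1 / (1 - h) * ((1 / real n) * (\<Sum>i=1..n. lagform h (\<lambda>t. V i t - B t) (\<lambda>t. V i t - B t) / 2))"
      by (rule cov_est_lagform) (use Vc Bc h(1) in \<open>auto intro!: continuous_intros\<close>)
    also have "(\<Sum>i=1..n. lagform h (\<lambda>t. V i t - B t) (\<lambda>t. V i t - B t) / 2)
      = ((\<Sum>i=1..n. lagform h (V i) (V i)) - real n * lagform h B B) / 2"
      unfolding sum_divide_distrib[symmetric] B_def[abs_def]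
      by (subst lagform_centered[of n V h]) (use Vc h(1) n in auto)
    finally show ?thesis by simp
  qed
  finally have 1: "cov_est n (Zhat p J N n (\<lambda>i j. grid N m j + grid N (Z i) j + v i j)) h
    = 1 / (1 - h) * ((1 / real n) * ((\<Sum>i=1..n. lagform h (V i) (V i)) - real n * lagform h B B) / 2)" .
  have 2: "cov_est n Z h = 1 / (1 - h) * ((1 / real n) * (\<Sum>i=1..n. lagform h (Z i) (Z i)) / 2)"
    using cov_est_lagform[of n Z h] Z_continuous h(1) by (simp add: sum_divide_distrib[symmetric])
  \<comment> \<open>The product of a curve with its noise is kept apart from the other terms, since
    it becomes small enough only after averaging over \<open>i\<close>.\<close>
  have VV: "lagform h (V i) (V i) = lagform h (Z i) (Z i) + 2 * (lagform h (D i) (D i) / 2 + lagform h (Z i) (bias i)) + 2 * lagform h (Z i) (noise_fit i)"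
    if i: "i \<in> {1..n}" for i
  proof -
    have "lagform h (V i) (V i) = lagform h (Z i) (Z i) + lagform h (D i) (D i) + 2 * lagform h (Z i) (D i)"
      unfolding V_def D_def[symmetric] by (rule lagform_square_add[OF Z_continuous[OF i] Dc[OF i] h(1)])
    moreover have "lagform h (Z i) (D i) = lagform h (Z i) (bias i) + lagform h (Z i) (noise_fit i)"
      unfolding D_def lagform_commute[of h "Z i"]
      by (rule lagform_add_left[OF cont(2)[OF i] cont(3) cont(1)[OF i] h(1)])
    ultimately show ?thesis by simp
  qed
  define G where "G = (1 / real n) * (\<Sum>i=1..n. lagform h (D i) (D i) / 2 + lagform h (Z i) (bias i))"
  define X where "X = (1 / real n) * (\<Sum>i=1..n. lagform h (Z i) (noise_fit i))"
  have "(\<Sum>i=1..n. lagform h (V i) (V i)) = (\<Sum>i=1..n. lagform h (Z i) (Z i)) + 2 * (real n * G) + 2 * (real n * X)"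
    using n VV by (simp add: sum.distrib G_def X_def sum_distrib_left[symmetric] sum_divide_distrib[symmetric])
  then have inner: "(1 / real n) * ((\<Sum>i=1..n. lagform h (V i) (V i)) - real n * lagform h B B) / 2
      - (1 / real n) * (\<Sum>i=1..n. lagform h (Z i) (Z i)) / 2 = G + X - lagform h B B / 2"
    using n by (simp add: field_simps)
  have diff: "cov_est n (Zhat p J N n (\<lambda>i j. grid N m j + grid N (Z i) j + v i j)) h - cov_est n Z h
     = 1 / (1 - h) * (G + X - lagform h B B / 2)"
    unfolding 1 2 right_diff_distrib[symmetric] inner by (rule refl)
  have "\<bar>G\<bar> \<le> (12 * spline_const p + 13) * rho * (wtotal * score_energy + 1) + 2 * spline_const p * noise_energy"
  proof -
    have "\<bar>\<Sum>i=1..n. lagform h (D i) (D i) / 2 + lagform h (Z i) (bias i)\<bar>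
       \<le> (\<Sum>i=1..n. (12 * spline_const p + 13) * rho * (wtotal * wnorm (x i) + 1) + 2 * spline_const p * (\<Sum>l<K. (coef (v i) l)\<^sup>2))"
      by (rule order.trans[OF sum_abs sum_mono]) (use curve_term_bound[OF _ h(1)] in \<open>simp add: D_def[abs_def]\<close>)
    also have "\<dots> = (12 * spline_const p + 13) * rho * (wtotal * (\<Sum>i=1..n. wnorm (x i)) + real n) +
        2 * spline_const p * (\<Sum>i=1..n. \<Sum>l<K. (coef (v i) l)\<^sup>2)"
      by (simp add: sum.distrib sum_distrib_left[symmetric])
    finally have "(1 / real n) * \<bar>\<Sum>i=1..n. lagform h (D i) (D i) / 2 + lagform h (Z i) (bias i)\<bar> \<le> (1 / real n) * ((12 * spline_const p + 13) * rho * (wtotal * (\<Sum>i=1..n. wnorm (x i)) + real n) +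
        2 * spline_const p * (\<Sum>i=1..n. \<Sum>l<K. (coef (v i) l)\<^sup>2))" by (rule mult_left_mono) simp
    then show ?thesis using n by (simp add: G_def score_energy_def noise_energy_def abs_mult field_simps)
  qed
  moreover have "\<bar>X\<bar> \<le> wtotal * s + spline_const p * cross_energy / s"
    unfolding X_def by (rule cross_term_bound[OF h(1) s])
  moreover have "\<bar>lagform h B B / 2\<bar> \<le> 2 * spline_const p * (wtotal * mean_score_energy + mean_noise_energy)"
  proof -
    have "B t = proj (\<lambda>j. grid N (series xbar) j + vbar j) t" for t
    proof -
      have "B t = proj (\<lambda>j. \<Sum>i=1..n. (1 / real n) * (grid N (Z i) j + v i j)) t"
        unfolding proj_sum by (simp add: B_def V sum_distrib_left)
      also have "\<dots> = proj (\<lambda>j. grid N (series xbar) j + vbar j) t"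
      proof -
        \<comment> \<open>The averaged curves and their series are known to agree on the unit
          interval only, so equality is established for the coefficients, which see the data at the
          design points alone.\<close>
        have "coef (\<lambda>j. \<Sum>i=1..n. (1 / real n) * (grid N (Z i) j + v i j)) l = coef (\<lambda>j. grid N (series xbar) j + vbar j) l" for l
          unfolding coef_def dinner_def
          by (intro arg_cong2[of _ _ _ _ "(/)"] sum.cong refl arg_cong2[of _ _ _ _ "(*)"])
             (auto simp: grid_def Zbar_series vbar_def sum.distrib sum_distrib_left[symmetric] sum_divide_distrib[symmetric] add_divide_distrib)
        then show ?thesis by (simp add: proj_def)
      qed
      finally show ?thesis .
    qed
    then have "sqnorm B \<le> 2 * spline_const p * (wtotal * mean_score_energy + mean_noise_energy)" using mean_term_bound by (metis ext)
    moreover have "\<bar>lagform h B B\<bar> \<le> 2 * sqnorm B" using lagform_le_sqnorm[OF Bc Bc h(1), of 1] by simp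
    ultimately show ?thesis by simp
  qed
  ultimately have "\<bar>G + X - lagform h B B / 2\<bar> \<le> error_bound s" unfolding error_bound_def by linarith
  then have "1 / (1 - h) * \<bar>G + X - lagform h B B / 2\<bar> \<le> 1 / (1 - h) * error_bound s"
    using h by (intro mult_left_mono) auto
  then show ?thesis
    unfolding diff using h by (simp add: abs_mult)
qed

end

section \<open>Expected size of the estimation error\<close>

text \<open>Integrability is bundled in, because the integral of a function that is not integrable
  is 0 and would satisfy a bare inequality.\<close>

definition exp_le :: "'a measure \<Rightarrow> ('a \<Rightarrow> real) \<Rightarrow> real \<Rightarrow> bool" where
  "exp_le M f c \<longleftrightarrow> integrable M f \<and> integral\<^sup>L M f \<le> c"

lemma exp_le_add: "exp_le M f a \<Longrightarrow> exp_le M g b \<Longrightarrow> exp_le M (\<lambda>x. f x + g x) (a + b)"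
  by (auto simp: exp_le_def)

lemma exp_le_scale: "c \<ge> 0 \<Longrightarrow> exp_le M f a \<Longrightarrow> exp_le M (\<lambda>x. c * f x) (c * a)"
  by (auto simp: exp_le_def mult_left_mono)

lemma exp_le_mono: "exp_le M f a \<Longrightarrow> a \<le> b \<Longrightarrow> exp_le M f b"
  by (auto simp: exp_le_def)

lemma exp_le_sum: "(\<And>i. i \<in> I \<Longrightarrow> exp_le M (f i) (a i)) \<Longrightarrow> exp_le M (\<lambda>x. \<Sum>i\<in>I. f i x) (\<Sum>i\<in>I. a i)"
  by (auto simp: exp_le_def intro!: sum_mono)

lemma (in prob_space) exp_le_const: "exp_le M (\<lambda>x. c) c"
  by (simp add: exp_le_def prob_space)

text \<open>Monotone convergence. A finite expectation of the sum also makes the series converge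
  almost surely, which is the event on which the curves are well behaved.\<close>

lemma exp_le_suminf:
  assumes f: "\<And>k x. f k x \<ge> (0::real)" and le: "\<And>k. exp_le M (f k) (a k)" and a: "summable a"
  shows "exp_le M (\<lambda>x. \<Sum>k. f k x) (\<Sum>k. a k)" and "AE x in M. summable (\<lambda>k. f k x)"
proof -
  have int: "integrable M (f k)" and E: "integral\<^sup>L M (f k) \<le> a k" for k
    using le by (auto simp: exp_le_def)
  have E0: "integral\<^sup>L M (f k) \<ge> 0" for k using f by (simp add: integral_nonneg_AE)
  have sE: "summable (\<lambda>k. integral\<^sup>L M (f k))"
    by (rule summable_comparison_test'[where N = 0, OF a]) (use E E0 in auto)
  have "(\<integral>\<^sup>+x. (\<Sum>k. ennreal (f k x)) \<partial>M) = (\<Sum>k. \<integral>\<^sup>+x. ennreal (f k x) \<partial>M)"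
    using int by (intro nn_integral_suminf) auto
  also have "\<dots> = (\<Sum>k. ennreal (integral\<^sup>L M (f k)))"
    by (intro suminf_cong nn_integral_eq_integral int) (use f in auto)
  also have "\<dots> = ennreal (\<Sum>k. integral\<^sup>L M (f k))"
    by (rule suminf_ennreal_eq) (use E0 sE in auto)
  finally have "(\<integral>\<^sup>+x. (\<Sum>k. ennreal (f k x)) \<partial>M) \<noteq> \<infinity>" by simp
  then have "AE x in M. (\<Sum>k. ennreal (f k x)) \<noteq> \<infinity>"
    using int by (intro nn_integral_PInf_AE) auto
  then show AE: "AE x in M. summable (\<lambda>k. f k x)"
    by eventually_elim (use f in \<open>auto intro: summable_suminf_not_top\<close>)
  have AE': "AE x in M. summable (\<lambda>k. norm (f k x))" using AE f by simp
  have sE': "summable (\<lambda>k. \<integral>x. norm (f k x) \<partial>M)" using sE f by simp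
  have "integrable M (\<lambda>x. \<Sum>k. f k x)" by (rule integrable_suminf[OF int AE' sE'])
  moreover have "(\<integral>x. (\<Sum>k. f k x) \<partial>M) \<le> (\<Sum>k. a k)"
    unfolding integral_suminf[OF int AE' sE'] by (rule suminf_le[OF E sE a])
  ultimately show "exp_le M (\<lambda>x. \<Sum>k. f k x) (\<Sum>k. a k)" by (simp add: exp_le_def)
qed

text \<open>Pythagoras in the space of square-integrable variables. It is applied to the scores of
  one component, to the errors, and to the products of a score with an error.\<close>

lemma exp_le_orthonormal_square:
  fixes Y :: "'i \<Rightarrow> 'a \<Rightarrow> real"
  assumes I: "finite I"
    and Y: "\<And>a b. a \<in> I \<Longrightarrow> b \<in> I \<Longrightarrow> integrable M (\<lambda>x. Y a x * Y b x) \<and>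
        integral\<^sup>L M (\<lambda>x. Y a x * Y b x) = (if a = b then 1 else 0)"
  shows "exp_le M (\<lambda>x. (\<Sum>a\<in>I. c a * Y a x)\<^sup>2) (\<Sum>a\<in>I. (c a)\<^sup>2)"
proof -
  have eq: "(\<Sum>a\<in>I. c a * Y a x)\<^sup>2 = (\<Sum>a\<in>I. \<Sum>b\<in>I. c a * c b * (Y a x * Y b x))" for x
    unfolding power2_eq_square sum_product by (intro sum.cong refl) (simp add: mult_ac)
  have "(\<integral>x. (\<Sum>a\<in>I. \<Sum>b\<in>I. c a * c b * (Y a x * Y b x)) \<partial>M) = (\<Sum>a\<in>I. \<Sum>b\<in>I. c a * c b * (if a = b then 1 else 0))"
    using Y by (subst Bochner_Integration.integral_sum, simp, intro sum.cong refl,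
        subst Bochner_Integration.integral_sum) auto
  also have "\<dots> = (\<Sum>a\<in>I. (c a)\<^sup>2)"
    using I by (intro sum.cong refl) (simp add: if_distrib power2_eq_square cong: if_cong)
  finally show ?thesis unfolding exp_le_def eq using Y by auto
qed

text \<open>Independence is condensed into three orthonormality relations. In \<open>XX\<close> and
  \<open>XE\<close> the component \<open>k\<close> is fixed, since the components are treated one at
  a time and then summed with the weights \<open>w k\<close>.\<close>

locale random_sample = spline_basis p J N K e + weighted_series phi w + prob_space M
  for p J N K e phi w and M :: "'a measure" +
  fixes n :: nat and X Eps :: "nat \<Rightarrow> nat \<Rightarrow> 'a \<Rightarrow> real" and sig :: "real \<Rightarrow> real" and Ms rho :: real
  assumes n: "n > 0" and rho: "0 < rho" "rho \<le> 1"
    and phi_approx: "\<And>k. \<exists>g\<in>spline_space p J. \<forall>t\<in>{0..1}. \<bar>phi k t - g t\<bar> \<le> rho * w k"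
    and sig_le: "\<And>t. t \<in> {0..1} \<Longrightarrow> \<bar>sig t\<bar> \<le> Ms"
    and XX: "\<And>i i' k. i \<ge> 1 \<Longrightarrow> i' \<ge> 1 \<Longrightarrow> integrable M (\<lambda>\<omega>. X i k \<omega> * X i' k \<omega>) \<and>
        integral\<^sup>L M (\<lambda>\<omega>. X i k \<omega> * X i' k \<omega>) = (if i = i' then 1 else 0)"
    and EE: "\<And>i i' j j'. i \<ge> 1 \<Longrightarrow> i' \<ge> 1 \<Longrightarrow> j \<ge> 1 \<Longrightarrow> j' \<ge> 1 \<Longrightarrow> integrable M (\<lambda>\<omega>. Eps i j \<omega> * Eps i' j' \<omega>) \<and>
        integral\<^sup>L M (\<lambda>\<omega>. Eps i j \<omega> * Eps i' j' \<omega>) = (if (i, j) = (i', j') then 1 else 0)"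
    and XE: "\<And>i i' j j' k. i \<ge> 1 \<Longrightarrow> i' \<ge> 1 \<Longrightarrow> j \<ge> 1 \<Longrightarrow> j' \<ge> 1 \<Longrightarrow>
        integrable M (\<lambda>\<omega>. (X i k \<omega> * Eps i j \<omega>) * (X i' k \<omega> * Eps i' j' \<omega>)) \<and>
        integral\<^sup>L M (\<lambda>\<omega>. (X i k \<omega> * Eps i j \<omega>) * (X i' k \<omega> * Eps i' j' \<omega>)) = (if (i, j) = (i', j') then 1 else 0)"
begin

definition "noise \<omega> i j = grid N sig j * Eps i j \<omega>"
definition "scores \<omega> i k = X i k \<omega>"
definition "good \<omega> \<longleftrightarrow> (\<forall>i\<in>{1..n}. summable (\<lambda>k. w k * (scores \<omega> i k)\<^sup>2))"
definition "sample_score_energy \<omega> = (1 / real n) * (\<Sum>i=1..n. wnorm (scores \<omega> i))"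
definition "sample_noise_energy \<omega> = (1 / real n) * (\<Sum>i=1..n. \<Sum>l<K. (coef (noise \<omega> i) l)\<^sup>2)"
definition "sample_cross_energy \<omega> = (\<Sum>k. w k * (\<Sum>l<K. (coef (\<lambda>j. \<Sum>i=1..n. (scores \<omega> i k / real n) * noise \<omega> i j) l)\<^sup>2))"
definition "sample_mean_score_energy \<omega> = wnorm (\<lambda>k. (1 / real n) * (\<Sum>i=1..n. scores \<omega> i k))"
definition "sample_mean_noise_energy \<omega> = dinner N (\<lambda>j. (1 / real n) * (\<Sum>i=1..n. noise \<omega> i j)) (\<lambda>j. (1 / real n) * (\<Sum>i=1..n. noise \<omega> i j))"
text \<open>The bound of the deterministic locale written for every outcome, which makes it a random
  variable on the whole space; the locale itself can be instantiated only where \<open>good\<close>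
  holds.\<close>

definition "sample_bound s \<omega> = (12 * spline_const p + 13) * rho * (wtotal * sample_score_energy \<omega> + 1) + 2 * spline_const p * sample_noise_energy \<omega>
    + (wtotal * s + spline_const p / s * sample_cross_energy \<omega>) + 2 * spline_const p * (wtotal * sample_mean_score_energy \<omega> + sample_mean_noise_energy \<omega>)"
definition "mean_bound s = (12 * spline_const p + 13) * rho * (wtotal * wtotal + 1)
    + 2 * spline_const p * (Ms\<^sup>2 * real K / real N)
    + (wtotal * s + spline_const p / s * (wtotal * (Ms\<^sup>2 * real K / (real N * real n))))
    + 2 * spline_const p * (wtotal * (wtotal / real n) + Ms\<^sup>2 / real n)"

lemma exp_score_energy: "exp_le M sample_score_energy wtotal" and AE_good: "AE \<omega> in M. good \<omega>"
proof -
  have sq: "exp_le M (\<lambda>\<omega>. w k * (scores \<omega> i k)\<^sup>2) (w k)" if "i \<in> {1..n}" for i k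
    using exp_le_scale[of "w k" M "\<lambda>\<omega>. (scores \<omega> i k)\<^sup>2" 1] w_nonneg XX[of i i k] that
    by (auto simp: exp_le_def scores_def power2_eq_square)
  have 1: "exp_le M (\<lambda>\<omega>. wnorm (scores \<omega> i)) wtotal" if "i \<in> {1..n}" for i
    unfolding wnorm_def wtotal_def
    by (rule exp_le_suminf(1)) (use sq that w_summable w_nonneg in auto)
  have "exp_le M sample_score_energy ((1 / real n) * (\<Sum>i=1..n. wtotal))"
    unfolding sample_score_energy_def[abs_def] by (intro exp_le_scale exp_le_sum 1) auto
  then show "exp_le M sample_score_energy wtotal" using n by simp
  have "AE \<omega> in M. summable (\<lambda>k. w k * (scores \<omega> i k)\<^sup>2)" if "i \<in> {1..n}" for i
    by (rule exp_le_suminf(2)) (use sq that w_summable w_nonneg in auto)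
  then show "AE \<omega> in M. good \<omega>" unfolding good_def by (intro AE_ball_countable') auto
qed

lemma sig_square: "j \<in> {1..N} \<Longrightarrow> (grid N sig j)\<^sup>2 \<le> Ms\<^sup>2"
  using power_mono[OF sig_le[of "real j / real N"] abs_ge_zero, of 2] by (simp add: grid_def)

text \<open>Each \<open>E l\<close> has empirical squared norm 1, so the squared weights with which
  the errors enter all \<open>K\<close> coefficients add up to at most \<open>Ms^2 * K / N\<close>.
  The factor \<open>c\<close> is 1 for a single curve and \<open>1 / n\<close> for an
  average.\<close>

lemma coef_weights:
  "(\<Sum>l<K. \<Sum>j=1..N. (c * (grid N sig j * grid N (e l) j / real N))\<^sup>2) \<le> c\<^sup>2 * (Ms\<^sup>2 * real K / real N)"
proof -
  have "(\<Sum>l<K. \<Sum>j=1..N. (c * (grid N sig j * grid N (e l) j / real N))\<^sup>2)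
      = c\<^sup>2 / (real N)\<^sup>2 * (\<Sum>l<K. \<Sum>j=1..N. (grid N sig j)\<^sup>2 * (grid N (e l) j)\<^sup>2)"
    by (simp add: sum_distrib_left power_mult_distrib power_divide)
  also have "\<dots> \<le> c\<^sup>2 / (real N)\<^sup>2 * (\<Sum>l<K. \<Sum>j=1..N. Ms\<^sup>2 * (grid N (e l) j)\<^sup>2)"
    by (intro mult_left_mono sum_mono mult_right_mono sig_square) auto
  also have "\<dots> = c\<^sup>2 / (real N)\<^sup>2 * (Ms\<^sup>2 * (real N * real K))"
    unfolding coef_square_sum[symmetric] by (simp add: sum_distrib_left)
  also have "\<dots> = c\<^sup>2 * (Ms\<^sup>2 * real K / real N)" using N0 by (simp add: power2_eq_square)
  finally show ?thesis .
qed

lemma exp_noise_energy: "exp_le M sample_noise_energy (Ms\<^sup>2 * real K / real N)"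
proof -
  have 1: "exp_le M (\<lambda>\<omega>. \<Sum>l<K. (coef (noise \<omega> i) l)\<^sup>2) (Ms\<^sup>2 * real K / real N)" if i: "i \<in> {1..n}" for i
  proof -
    have eq: "coef (noise \<omega> i) l = (\<Sum>j=1..N. (1 * (grid N sig j * grid N (e l) j / real N)) * Eps i j \<omega>)" for \<omega> l
      unfolding coef_def dinner_def noise_def sum_divide_distrib by (intro sum.cong refl) simp
    have "exp_le M (\<lambda>\<omega>. \<Sum>l<K. (coef (noise \<omega> i) l)\<^sup>2) (\<Sum>l<K. \<Sum>j=1..N. (1 * (grid N sig j * grid N (e l) j / real N))\<^sup>2)"
      unfolding eq by (intro exp_le_sum exp_le_orthonormal_square) (use EE[of i i] i in auto)
    from exp_le_mono[OF this coef_weights] show ?thesis by simp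
  qed
  have "exp_le M sample_noise_energy ((1 / real n) * (\<Sum>i=1..n. Ms\<^sup>2 * real K / real N))"
    unfolding sample_noise_energy_def[abs_def] by (intro exp_le_scale exp_le_sum 1) auto
  then show ?thesis using n by simp
qed

lemma exp_cross_energy: "exp_le M sample_cross_energy (wtotal * (Ms\<^sup>2 * real K / (real N * real n)))"
proof -
  define B where "B = Ms\<^sup>2 * real K / (real N * real n)"
  have 1: "exp_le M (\<lambda>\<omega>. \<Sum>l<K. (coef (\<lambda>j. \<Sum>i=1..n. (scores \<omega> i k / real n) * noise \<omega> i j) l)\<^sup>2) B" for k
  proof -
    \<comment> \<open>The weights do not depend on the curve: their squares contain 1/n^2 and occur
      \<open>n\<close> times, which leaves the gain of 1/n over the noise of a single curve.\<close>
    define a where "a l j = 1 / real n * (grid N sig j * grid N (e l) j / real N)" for l j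
    have eq: "coef (\<lambda>j. \<Sum>i=1..n. (scores \<omega> i k / real n) * noise \<omega> i j) l
        = (\<Sum>(i,j)\<in>{1..n}\<times>{1..N}. a l j * (X i k \<omega> * Eps i j \<omega>))" for \<omega> l
    proof -
      have "coef (\<lambda>j. \<Sum>i=1..n. (scores \<omega> i k / real n) * noise \<omega> i j) l = (\<Sum>i=1..n. (scores \<omega> i k / real n) * coef (noise \<omega> i) l)"
        by (rule coef_sum)
      also have "\<dots> = (\<Sum>i=1..n. \<Sum>j=1..N. a l j * (X i k \<omega> * Eps i j \<omega>))"
        unfolding coef_def dinner_def noise_def sum_divide_distrib sum_distrib_left a_def scores_def
        by (intro sum.cong refl) simp
      finally show ?thesis by (simp add: sum.cartesian_product)
    qed
    have "exp_le M (\<lambda>\<omega>. \<Sum>l<K. (\<Sum>(i,j)\<in>{1..n}\<times>{1..N}. a l j * (X i k \<omega> * Eps i j \<omega>))\<^sup>2)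
       (\<Sum>l<K. \<Sum>(i,j)\<in>{1..n}\<times>{1..N}. (a l j)\<^sup>2)"
    proof (rule exp_le_sum)
      fix l
      show "exp_le M (\<lambda>\<omega>. (\<Sum>(i,j)\<in>{1..n}\<times>{1..N}. a l j * (X i k \<omega> * Eps i j \<omega>))\<^sup>2) (\<Sum>(i,j)\<in>{1..n}\<times>{1..N}. (a l j)\<^sup>2)"
        using exp_le_orthonormal_square[of "{1..n}\<times>{1..N}" M "\<lambda>(i,j) \<omega>. X i k \<omega> * Eps i j \<omega>" "\<lambda>(i,j). a l j"] XE
        by (auto simp: case_prod_unfold)
    qed
    moreover have "(\<Sum>l<K. \<Sum>(i,j)\<in>{1..n}\<times>{1..N}. (a l j)\<^sup>2) \<le> B"
    proof -
      have "(\<Sum>l<K. \<Sum>(i,j)\<in>{1..n}\<times>{1..N}. (a l j)\<^sup>2) = real n * (\<Sum>l<K. \<Sum>j=1..N. (a l j)\<^sup>2)"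
        unfolding sum.cartesian_product[symmetric] by (simp add: sum_distrib_left)
      also have "\<dots> \<le> real n * ((1 / real n)\<^sup>2 * (Ms\<^sup>2 * real K / real N))"
        unfolding a_def by (intro mult_left_mono coef_weights) auto
      also have "\<dots> = B" using n by (simp add: B_def power2_eq_square field_simps)
      finally show ?thesis .
    qed
    ultimately show ?thesis unfolding eq by (rule exp_le_mono)
  qed
  have "exp_le M sample_cross_energy (\<Sum>k. w k * B)"
    unfolding sample_cross_energy_def[abs_def]
    by (rule exp_le_suminf(1)) (use 1 w_nonneg w_summable in \<open>auto intro!: exp_le_scale sum_nonneg summable_mult2 mult_nonneg_nonneg\<close>)
  then show ?thesis using suminf_mult2[OF w_summable, of B] by (simp add: wtotal_def B_def)
qed

lemma exp_mean_score_energy: "exp_le M sample_mean_score_energy (wtotal / real n)"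
proof -
  have 1: "exp_le M (\<lambda>\<omega>. ((1 / real n) * (\<Sum>i=1..n. scores \<omega> i k))\<^sup>2) (1 / real n)" for k
  proof -
    have "exp_le M (\<lambda>\<omega>. (\<Sum>i\<in>{1..n}. (1 / real n) * X i k \<omega>)\<^sup>2) (\<Sum>i\<in>{1..n}. (1 / real n)\<^sup>2)"
      by (rule exp_le_orthonormal_square) (use XX in auto)
    moreover have "(\<Sum>i\<in>{1..n}. (1 / real n)\<^sup>2) = 1 / real n" using n by (simp add: power2_eq_square)
    ultimately show ?thesis by (simp add: scores_def sum_distrib_left)
  qed
  have "exp_le M sample_mean_score_energy (\<Sum>k. w k * (1 / real n))"
    unfolding sample_mean_score_energy_def[abs_def] wnorm_def
    by (rule exp_le_suminf(1)[OF _ exp_le_scale[OF w_nonneg 1] summable_mult2[OF w_summable]]) (simp add: w_nonneg)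
  then show ?thesis using suminf_mult2[OF w_summable, of "1 / real n"] by (simp add: wtotal_def)
qed

lemma exp_mean_noise_energy: "exp_le M sample_mean_noise_energy (Ms\<^sup>2 / real n)"
proof -
  have 1: "exp_le M (\<lambda>\<omega>. ((1 / real n) * (\<Sum>i=1..n. noise \<omega> i j))\<^sup>2) (Ms\<^sup>2 / real n)" if j: "j \<in> {1..N}" for j
  proof -
    have "exp_le M (\<lambda>\<omega>. (\<Sum>i\<in>{1..n}. (grid N sig j / real n) * Eps i j \<omega>)\<^sup>2) (\<Sum>i\<in>{1..n}. (grid N sig j / real n)\<^sup>2)"
      by (rule exp_le_orthonormal_square) (use EE[of _ _ j j] j in auto)
    moreover have "(\<Sum>i\<in>{1..n}. (grid N sig j / real n)\<^sup>2) \<le> Ms\<^sup>2 / real n"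
      using n sig_square[OF j] by (simp add: power2_eq_square divide_simps)
    ultimately show ?thesis by (auto simp: noise_def sum_distrib_left intro: exp_le_mono)
  qed
  have "exp_le M (\<lambda>\<omega>. (1 / real N) * (\<Sum>j=1..N. ((1 / real n) * (\<Sum>i=1..n. noise \<omega> i j))\<^sup>2)) ((1 / real N) * (\<Sum>j=1..N. Ms\<^sup>2 / real n))"
    by (intro exp_le_scale exp_le_sum 1) auto
  moreover have "(1 / real N) * (\<Sum>j=1..N. Ms\<^sup>2 / real n) = Ms\<^sup>2 / real n" using N0 by simp
  moreover have "sample_mean_noise_energy = (\<lambda>\<omega>. (1 / real N) * (\<Sum>j=1..N. ((1 / real n) * (\<Sum>i=1..n. noise \<omega> i j))\<^sup>2))"
    by (rule ext) (simp add: sample_mean_noise_energy_def dinner_def power2_eq_square)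
  ultimately show ?thesis by (simp only:)
qed

lemma exp_sample_bound:
  assumes s: "s > 0"
  shows "exp_le M (sample_bound s) (mean_bound s)"
proof -
  have "exp_le M (\<lambda>\<omega>. wtotal * sample_score_energy \<omega> + 1) (wtotal * wtotal + 1)"
    by (rule exp_le_add[OF exp_le_scale[OF wtotal_nonneg exp_score_energy] exp_le_const])
  then have 1: "exp_le M (\<lambda>\<omega>. (12 * spline_const p + 13) * rho * (wtotal * sample_score_energy \<omega> + 1))
      ((12 * spline_const p + 13) * rho * (wtotal * wtotal + 1))"
    by (rule exp_le_scale[rotated]) (use rho const_nonneg in simp)
  have 2: "exp_le M (\<lambda>\<omega>. 2 * spline_const p * sample_noise_energy \<omega>) (2 * spline_const p * (Ms\<^sup>2 * real K / real N))"
    by (rule exp_le_scale[OF _ exp_noise_energy]) (use const_nonneg in simp)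
  have 3: "exp_le M (\<lambda>\<omega>. wtotal * s + spline_const p / s * sample_cross_energy \<omega>)
      (wtotal * s + spline_const p / s * (wtotal * (Ms\<^sup>2 * real K / (real N * real n))))"
    by (rule exp_le_add[OF exp_le_const exp_le_scale[OF _ exp_cross_energy]]) (use const_nonneg s in simp)
  have 4: "exp_le M (\<lambda>\<omega>. 2 * spline_const p * (wtotal * sample_mean_score_energy \<omega> + sample_mean_noise_energy \<omega>))
      (2 * spline_const p * (wtotal * (wtotal / real n) + Ms\<^sup>2 / real n))"
    by (rule exp_le_scale[OF _ exp_le_add[OF exp_le_scale[OF wtotal_nonneg exp_mean_score_energy] exp_mean_noise_energy]]) (use const_nonneg in simp)
  show ?thesis
    unfolding sample_bound_def[abs_def] mean_bound_def by (rule exp_le_add[OF exp_le_add[OF exp_le_add[OF 1 2] 3] 4])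
qed

lemma good_bound:
  assumes "good \<omega>" and h: "0 \<le> h" "h < 1" and s: "s > 0"
  shows "\<bar>cov_est n (Zhat p J N n (\<lambda>i j. grid N m j + grid N (series (scores \<omega> i)) j + noise \<omega> i j)) h
    - cov_est n (\<lambda>i. series (scores \<omega> i)) h\<bar> \<le> 1 / (1 - h) * sample_bound s \<omega>"
proof -
  have sq: "summable (\<lambda>k. w k * (scores \<omega> i k)\<^sup>2)" if "i \<in> {1..n}" for i
    using assms(1) that unfolding good_def by blast
  interpret S: spline_sample p J N K e phi w n "scores \<omega>" "noise \<omega>" rho
    by (rule spline_sample.intro[OF spline_basis_axioms weighted_series_axioms
          spline_sample_axioms.intro[OF n rho phi_approx sq]])
  have "S.error_bound s = sample_bound s \<omega>"
    unfolding S.error_bound_def sample_bound_def S.score_energy_def S.noise_energy_def S.cross_energy_def S.mean_score_energy_def S.mean_noise_energy_def sample_score_energy_def sample_noise_energy_def sample_cross_energy_def sample_mean_score_energy_def sample_mean_noise_energy_def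
      S.xbar_def[abs_def] S.vbar_def[abs_def] S.vcross_def[abs_def] by simp
  then show ?thesis using S.cov_est_diff_bound[OF h s, of m] by (simp add: S.Z_def[abs_def])
qed

text \<open>Markov's inequality for the lag-free bound; the exceptional set is its superlevel set
  together with a null set outside \<open>good\<close>. The factor \<open>1 - h0\<close> is the
  worst normalisation over the lags.\<close>

lemma covariance_error_tail:
  assumes h0: "0 < h0" "h0 < 1" and s: "s > 0" and c: "c > 0"
  shows "\<exists>A\<in>sets M. {\<omega>\<in>space M. \<bar>SUP h\<in>{0..h0}.
      \<bar>cov_est n (Zhat p J N n (\<lambda>i j. grid N m j + grid N (series (scores \<omega> i)) j + noise \<omega> i j)) h - C h
        - (cov_est n (\<lambda>i. series (scores \<omega> i)) h - C h)\<bar>\<bar> > c} \<subseteq> A \<and>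
    measure M A \<le> mean_bound s / ((1 - h0) * c)"
proof -
  obtain B where B: "{\<omega>\<in>space M. \<not> good \<omega>} \<subseteq> B" "emeasure M B = 0" "B \<in> sets M"
    by (rule AE_E[OF AE_good])
  have int: "integrable M (sample_bound s)" and Eb: "integral\<^sup>L M (sample_bound s) \<le> mean_bound s"
    using exp_sample_bound[OF s] by (auto simp: exp_le_def)
  define L where "L = {\<omega>\<in>space M. sample_bound s \<omega> \<ge> (1 - h0) * c}"
  have L: "L \<in> sets M" unfolding L_def using int by measurable
  \<comment> \<open>The bound dominates an absolute value at lag 0, so its sign needs no inspection
    of the individual terms.\<close>
  have pos: "sample_bound s \<omega> \<ge> 0" if "good \<omega>" for \<omega>
    using order.trans[OF abs_ge_zero good_bound[OF that _ _ s, of 0 "\<lambda>_. 0"]] by simp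
  have "measure M L \<le> integral\<^sup>L M (sample_bound s) / ((1 - h0) * c)"
    unfolding L_def
    by (rule integral_Markov_inequality_measure[OF int sets.top])
       (use AE_good pos h0 c in \<open>auto elim: eventually_mono\<close>)
  also have "\<dots> \<le> mean_bound s / ((1 - h0) * c)"
    using Eb h0 c by (intro divide_right_mono) auto
  finally have mL: "measure M L \<le> mean_bound s / ((1 - h0) * c)" .
  have "measure M (B \<union> L) \<le> measure M B + measure M L" using B L by (intro measure_Un_le) auto
  also have "measure M B = 0" using B(2) by (simp add: measure_def)
  finally have "measure M (B \<union> L) \<le> mean_bound s / ((1 - h0) * c)" using mL by simp
  moreover have "{\<omega>\<in>space M. \<bar>SUP h\<in>{0..h0}.
      \<bar>cov_est n (Zhat p J N n (\<lambda>i j. grid N m j + grid N (series (scores \<omega> i)) j + noise \<omega> i j)) h - C h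
        - (cov_est n (\<lambda>i. series (scores \<omega> i)) h - C h)\<bar>\<bar> > c} \<subseteq> B \<union> L"
  proof (rule ccontr)
    define f where "f \<omega> h = \<bar>cov_est n (Zhat p J N n (\<lambda>i j. grid N m j + grid N (series (scores \<omega> i)) j + noise \<omega> i j)) h - C h
        - (cov_est n (\<lambda>i. series (scores \<omega> i)) h - C h)\<bar>" for \<omega> h
    assume "\<not> ?thesis"
    then obtain \<omega> where \<omega>: "\<omega> \<in> space M" "\<bar>SUP h\<in>{0..h0}. f \<omega> h\<bar> > c" "\<omega> \<notin> B" "\<omega> \<notin> L"
      unfolding f_def by auto
    then have good: "good \<omega>" and small: "sample_bound s \<omega> < (1 - h0) * c" using B(1) by (auto simp: L_def)
    have le: "f \<omega> h \<le> c" if h: "h \<in> {0..h0}" for h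
    proof -
      have "f \<omega> h \<le> 1 / (1 - h) * sample_bound s \<omega>"
        using good_bound[OF good _ _ s, of h m] h h0 by (simp add: f_def)
      also have "\<dots> \<le> 1 / (1 - h0) * ((1 - h0) * c)"
        using small pos[OF good] h h0 by (intro mult_mono frac_le) auto
      also have "\<dots> = c" using h0 by simp
      finally show ?thesis .
    qed
    have "(SUP h\<in>{0..h0}. f \<omega> h) \<le> c" using h0 le by (intro cSUP_least) auto
    \<comment> \<open>The event concerns the absolute value of the supremum; the lag 0 shows that
      the supremum is not negative.\<close>
    moreover have "0 \<le> f \<omega> 0" by (simp add: f_def)
    then have "0 \<le> (SUP h\<in>{0..h0}. f \<omega> h)"
      using h0 le by (intro cSUP_upper2[of _ _ 0]) (auto intro!: bdd_aboveI2[of _ _ c])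
    ultimately show False using \<omega>(2) by simp
  qed
  ultimately show ?thesis using B L by (intro bexI[of _ "B \<union> L"]) auto
qed

end

section \<open>Moments and rates\<close>

context prob_space
begin

lemma indep_vars_centered_product:
  fixes Y :: "'i \<Rightarrow> 'a \<Rightarrow> real"
  assumes Y: "indep_vars (\<lambda>_. borel) Y I" and ab: "a \<in> I" "b \<in> I" "a \<noteq> b"
    and mean: "\<And>c. c \<in> I \<Longrightarrow> integrable M (Y c) \<and> integral\<^sup>L M (Y c) = 0"
  shows "integrable M (\<lambda>x. Y a x * Y b x) \<and> integral\<^sup>L M (\<lambda>x. Y a x * Y b x) = 0"
proof -
  have ind: "indep_vars (\<lambda>_. borel) Y {a, b}" by (rule indep_vars_subset[OF Y]) (use ab in auto)
  have int: "\<And>c. c \<in> {a, b} \<Longrightarrow> integrable M (Y c)" using mean ab by auto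
  from indep_vars_integrable[OF _ ind int] indep_vars_lebesgue_integral[OF _ ind int]
  show ?thesis using ab mean by simp
qed

lemma score_moments:
  assumes indep: "indep_vars (\<lambda>_. Pi\<^sub>M {1..} (\<lambda>_. borel)) (\<lambda>i \<omega>. restrict (\<lambda>k. X i k \<omega>) {1..}) {1..}"
    and mean: "\<And>i k. i \<ge> 1 \<Longrightarrow> k \<ge> 1 \<Longrightarrow> integrable M (X i k) \<and> integral\<^sup>L M (X i k) = 0"
    and var: "\<And>i k l. i \<ge> 1 \<Longrightarrow> k \<ge> 1 \<Longrightarrow> l \<ge> 1 \<Longrightarrow> integrable M (\<lambda>\<omega>. X i k \<omega> * X i l \<omega>) \<and>
        integral\<^sup>L M (\<lambda>\<omega>. X i k \<omega> * X i l \<omega>) = (if k = l then 1 else 0 :: real)"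
    and i: "i \<ge> 1" "i' \<ge> 1" and k: "k \<ge> (1::nat)"
  shows "integrable M (\<lambda>\<omega>. X i k \<omega> * X i' k \<omega>) \<and>
    integral\<^sup>L M (\<lambda>\<omega>. X i k \<omega> * X i' k \<omega>) = (if i = (i'::nat) then 1 else 0)"
proof (cases "i = i'")
  case True
  then show ?thesis using var[OF i(1) k k] by simp
next
  case False
  have "indep_vars (\<lambda>_. borel) (\<lambda>i \<omega>. restrict (\<lambda>k. X i k \<omega>) {1..} k) {1..}"
    using indep_vars_compose2[OF indep, of "\<lambda>i f. f k" "\<lambda>_. borel"] k by auto
  then have "indep_vars (\<lambda>_. borel) (\<lambda>i. X i k) {1..}" using k by simp
  from indep_vars_centered_product[OF this, of i i'] mean i k False show ?thesis by auto
qed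

lemma error_moments:
  assumes indep: "indep_vars (\<lambda>_. borel) (\<lambda>(i, j). Y i j) ({1..} \<times> {1..})"
    and mom: "\<And>i j. i \<ge> 1 \<Longrightarrow> j \<ge> 1 \<Longrightarrow> integrable M (Y i j) \<and> integral\<^sup>L M (Y i j) = 0
        \<and> integrable M (\<lambda>\<omega>. (Y i j \<omega>)\<^sup>2) \<and> integral\<^sup>L M (\<lambda>\<omega>. (Y i j \<omega>)\<^sup>2) = (1::real)"
    and i: "i \<ge> 1" "i' \<ge> (1::nat)" "j \<ge> 1" "j' \<ge> (1::nat)"
  shows "integrable M (\<lambda>\<omega>. Y i j \<omega> * Y i' j' \<omega>) \<and>
    integral\<^sup>L M (\<lambda>\<omega>. Y i j \<omega> * Y i' j' \<omega>) = (if (i, j) = (i', j') then 1 else 0)"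
proof (cases "(i, j) = (i', j')")
  case True
  then show ?thesis using mom[OF i(1,3)] by (simp add: power2_eq_square)
next
  case False
  from indep_vars_centered_product[OF indep, of "(i, j)" "(i', j')"] mom i False show ?thesis by auto
qed

text \<open>The product of four variables regroups into a product of scores and a product of errors.
  These are functions of independent families, so the expectation factorises into two known second
  moments.\<close>

lemma score_error_moments:
  fixes X Y :: "nat \<Rightarrow> nat \<Rightarrow> 'a \<Rightarrow> real"
  assumes indep: "indep_var
        (Pi\<^sub>M ({1..} \<times> {1..}) (\<lambda>_. borel)) (\<lambda>\<omega>. restrict (\<lambda>(i, k). X i k \<omega>) ({1..} \<times> {1..}))
        (Pi\<^sub>M ({1..} \<times> {1..}) (\<lambda>_. borel)) (\<lambda>\<omega>. restrict (\<lambda>(i, j). Y i j \<omega>) ({1..} \<times> {1..}))"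
    and X: "integrable M (\<lambda>\<omega>. X i k \<omega> * X i' k \<omega>) \<and> integral\<^sup>L M (\<lambda>\<omega>. X i k \<omega> * X i' k \<omega>) = (if i = i' then 1 else 0)"
    and Y: "integrable M (\<lambda>\<omega>. Y i j \<omega> * Y i' j' \<omega>) \<and>
        integral\<^sup>L M (\<lambda>\<omega>. Y i j \<omega> * Y i' j' \<omega>) = (if (i, j) = (i', j') then 1 else 0)"
    and i: "i \<ge> 1" "i' \<ge> 1" "j \<ge> 1" "j' \<ge> 1" "k \<ge> 1"
  shows "integrable M (\<lambda>\<omega>. (X i k \<omega> * Y i j \<omega>) * (X i' k \<omega> * Y i' j' \<omega>)) \<and>
    integral\<^sup>L M (\<lambda>\<omega>. (X i k \<omega> * Y i j \<omega>) * (X i' k \<omega> * Y i' j' \<omega>)) = (if (i, j) = (i', j') then 1 else 0)"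
proof -
  have m: "(\<lambda>f. f a * f b) \<in> measurable (Pi\<^sub>M ({1..} \<times> {1..}) (\<lambda>_. borel)) (borel :: real measure)"
    if "a \<in> {1..} \<times> {1..}" "b \<in> {1..} \<times> {1..}" for a b :: "nat \<times> nat"
    using that by (intro borel_measurable_times measurable_component_singleton) auto
  have "indep_var borel ((\<lambda>f. f (i, k) * f (i', k)) \<circ> (\<lambda>\<omega>. restrict (\<lambda>(i, k). X i k \<omega>) ({1..} \<times> {1..})))
      borel ((\<lambda>f. f (i, j) * f (i', j')) \<circ> (\<lambda>\<omega>. restrict (\<lambda>(i, j). Y i j \<omega>) ({1..} \<times> {1..})))"
    by (rule indep_var_compose[OF indep m m]) (use i in auto)
  then have ind: "indep_var borel (\<lambda>\<omega>. X i k \<omega> * X i' k \<omega>) borel (\<lambda>\<omega>. Y i j \<omega> * Y i' j' \<omega>)"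
    using i by (simp add: comp_def)
  have eq: "(X i k \<omega> * Y i j \<omega>) * (X i' k \<omega> * Y i' j' \<omega>) = (X i k \<omega> * X i' k \<omega>) * (Y i j \<omega> * Y i' j' \<omega>)" for \<omega>
    by (simp add: mult_ac)
  show ?thesis unfolding eq
    using indep_var_integrable[OF ind] indep_var_lebesgue_integral[OF ind] X Y by auto
qed

end

text \<open>The choice \<open>s = sqrt (r / n)\<close> balances the two parts of the product of
  curves and noise: after scaling by \<open>sqrt n\<close>, both are multiples of
  \<open>sqrt r\<close>. \<open>K_le\<close> replaces \<open>K / N\<close> by a multiple of
  \<open>r\<close>.\<close>

lemma (in random_sample) mean_bound_scaled:
  defines "r \<equiv> real (J + 1) / real N"
  shows "sqrt (real n) * mean_bound (sqrt (r / real n)) \<le>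
    (12 * spline_const p + 13) * (wtotal * wtotal + 1) * (sqrt (real n) * rho)
    + 2 * (spline_const p)\<^sup>2 * Ms\<^sup>2 * (sqrt (real n) * r)
    + (wtotal + (spline_const p)\<^sup>2 * wtotal * Ms\<^sup>2) * sqrt r
    + 2 * spline_const p * (wtotal * wtotal + Ms\<^sup>2) * (1 / sqrt (real n))"
proof -
  define c where "c = spline_const p"
  have c: "c \<ge> 0" unfolding c_def by (rule const_nonneg)
  define t where "t = sqrt (real n)"
  have t: "t > 0" "real n = t * t" using n by (auto simp: t_def)
  have r: "r > 0" using N0 by (simp add: r_def)
  define u where "u = sqrt r"
  have u: "u > 0" "r = u * u" using r by (auto simp: u_def)
  have su: "sqrt (r / real n) = u / t" by (simp add: u_def t_def real_sqrt_divide)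
  have K: "real K / real N \<le> c * r"
    using divide_right_mono[OF K_le, of "real N"] by (simp add: c_def r_def)
  have K1: "Ms\<^sup>2 * real K / real N \<le> Ms\<^sup>2 * (c * r)"
    using mult_left_mono[OF K, of "Ms\<^sup>2"] by simp
  have 1: "t * (2 * c * (Ms\<^sup>2 * real K / real N)) \<le> 2 * c\<^sup>2 * Ms\<^sup>2 * (t * r)"
    using mult_left_mono[OF K1, of "t * (2 * c)"] c t by (simp add: power2_eq_square mult_ac)
  have "t * (c / (u / t) * (wtotal * (Ms\<^sup>2 * real K / (real N * real n))))
      = (c * wtotal / u) * (Ms\<^sup>2 * real K / real N)"
    unfolding t(2) using t(1) u(1) by (simp add: field_simps)
  also have "\<dots> \<le> (c * wtotal / u) * (Ms\<^sup>2 * (c * r))"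
    by (rule mult_left_mono[OF K1]) (use c u wtotal_nonneg in auto)
  also have "\<dots> = c\<^sup>2 * wtotal * Ms\<^sup>2 * u"
    using u by (simp add: power2_eq_square field_simps)
  finally have 2: "t * (c / (u / t) * (wtotal * (Ms\<^sup>2 * real K / (real N * real n)))) \<le> c\<^sup>2 * wtotal * Ms\<^sup>2 * u" .
  have 3: "t * (wtotal * (u / t)) = wtotal * u" using t by simp
  have 4: "t * (2 * c * (wtotal * (wtotal / real n) + Ms\<^sup>2 / real n)) = 2 * c * (wtotal * wtotal + Ms\<^sup>2) * (1 / t)"
    unfolding t(2) using t(1) by (simp add: field_simps)
  have "t * mean_bound (u / t) = (12 * c + 13) * (wtotal * wtotal + 1) * (t * rho)
      + t * (2 * c * (Ms\<^sup>2 * real K / real N))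
      + (t * (wtotal * (u / t)) + t * (c / (u / t) * (wtotal * (Ms\<^sup>2 * real K / (real N * real n)))))
      + t * (2 * c * (wtotal * (wtotal / real n) + Ms\<^sup>2 / real n))"
    unfolding mean_bound_def c_def[symmetric] by (simp add: algebra_simps)
  also have "\<dots> \<le> (12 * c + 13) * (wtotal * wtotal + 1) * (t * rho) + 2 * c\<^sup>2 * Ms\<^sup>2 * (t * r)
      + (wtotal * u + c\<^sup>2 * wtotal * Ms\<^sup>2 * u) + 2 * c * (wtotal * wtotal + Ms\<^sup>2) * (1 / t)"
    using 1 2 3 4 by (intro add_mono) auto
  finally show ?thesis
    unfolding su c_def[symmetric] t_def[symmetric] u_def[symmetric] by (simp add: algebra_simps)
qed

section \<open>Growth rates of the sample size and the number of knots\<close>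

lemma powr_ln_tendsto_0:
  assumes "a > 0" "b > 0"
  shows "(\<lambda>N. real N powr (- a) * ln (real N) powr b) \<longlonglongrightarrow> 0"
proof -
  have "(\<lambda>N. ln (real N) / real N powr (a / b)) \<longlonglongrightarrow> 0"
    using lim_ln_over_power[of "a / b"] assms by simp
  then have "(\<lambda>N. (ln (real N) / real N powr (a / b)) powr b) \<longlonglongrightarrow> 0 powr b"
  proof (rule tendsto_powr'[OF _ tendsto_const], intro disjI2 conjI)
    show "\<forall>\<^sub>F N in sequentially. 0 \<le> ln (real N) / real N powr (a / b)"
      using eventually_ge_at_top[of 1] by eventually_elim auto
  qed (use assms in auto)
  moreover have "\<forall>\<^sub>F N in sequentially. (ln (real N) / real N powr (a / b)) powr b = real N powr (- a) * ln (real N) powr b"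
    using eventually_ge_at_top[of 1]
  proof eventually_elim
    case (elim N)
    then show ?case using assms by (simp add: powr_divide powr_powr powr_minus field_simps)
  qed
  ultimately show ?thesis by (simp add: tendsto_cong)
qed

context
  fixes nn Js :: "nat \<Rightarrow> nat" and d :: "nat \<Rightarrow> real" and theta gam tau :: real
  assumes nn: "(\<lambda>N. real (nn N)) \<in> O(\<lambda>N. real N powr theta)"
    and Js: "(\<lambda>N. real (Js N)) \<in> \<Theta>(\<lambda>N. real N powr gam * d N)"
    and d_pos: "\<And>N. d N > 0" and tau: "tau > 0"
    and d: "(\<lambda>N. d N + 1 / d N) \<in> O(\<lambda>N. ln (real N) powr tau)"
begin

text \<open>Rests on the lower bound for the number of knots, in which the logarithms come from
  \<open>1 / d N\<close>. They are absorbed by the strict inequality between the exponents.\<close>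

lemma knots_lower_rate:
  assumes a: "a > 0" and rate: "theta / 2 < gam * a"
  shows "(\<lambda>N. sqrt (real (nn N)) * (1 / real (Js N + 1)) powr a) \<longlonglongrightarrow> 0"
proof -
  obtain c where c: "c > 0" and nc: "\<forall>\<^sub>F N in sequentially. real (nn N) \<le> c * real N powr theta"
    using landau_o.bigE[OF nn] by auto
  from Js have "(\<lambda>N. real N powr gam * d N) \<in> O(\<lambda>N. real (Js N))" by (simp add: bigtheta_def bigomega_iff_bigo)
  then obtain c' where c': "c' > 0" and Jc: "\<forall>\<^sub>F N in sequentially. norm (real N powr gam * d N) \<le> c' * norm (real (Js N))"
    by (rule landau_o.bigE)
  obtain c'' where c'': "c'' > 0" and dc: "\<forall>\<^sub>F N in sequentially. norm (d N + 1 / d N) \<le> c'' * norm (ln (real N) powr tau)"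
    using landau_o.bigE[OF d] by auto
  define B where "B = sqrt c * (c' * c'') powr a"
  have le: "\<forall>\<^sub>F N in sequentially. norm (sqrt (real (nn N)) * (1 / real (Js N + 1)) powr a)
     \<le> B * (real N powr (- (gam * a - theta / 2)) * ln (real N) powr (tau * a))"
    using nc Jc dc eventually_gt_at_top[of 1]
  proof eventually_elim
    case (elim N)
    have N: "real N > 0" using elim by simp
    have dN: "1 / d N \<le> c'' * ln (real N) powr tau" using elim(3) d_pos[of N] by simp
    have "real N powr gam * d N \<le> c' * real (Js N + 1)"
      using elim(2) d_pos[of N] c' by (simp add: abs_mult algebra_simps)
    then have "1 / real (Js N + 1) \<le> c' * (1 / d N) * real N powr (- gam)"
      using N d_pos[of N] c' by (simp add: powr_minus field_simps)
    also have "\<dots> \<le> c' * (c'' * ln (real N) powr tau) * real N powr (- gam)"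
      using dN c' by (intro mult_right_mono mult_left_mono) auto
    finally have "(1 / real (Js N + 1)) powr a \<le> (c' * (c'' * ln (real N) powr tau) * real N powr (- gam)) powr a"
      using a by (intro powr_mono2) auto
    also have "\<dots> = (c' * c'') powr a * (ln (real N) powr (tau * a) * real N powr (- (gam * a)))"
      using c' c'' elim(4) by (simp add: powr_mult powr_powr mult.assoc)
    finally have 1: "(1 / real (Js N + 1)) powr a \<le> (c' * c'') powr a * (ln (real N) powr (tau * a) * real N powr (- (gam * a)))" .
    have "sqrt (real (nn N)) \<le> sqrt (c * real N powr theta)" using elim(1) by simp
    also have "\<dots> = sqrt c * real N powr (theta / 2)"
      by (simp add: real_sqrt_mult powr_half_sqrt[symmetric] powr_powr)
    finally have "sqrt (real (nn N)) * (1 / real (Js N + 1)) powr a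
        \<le> (sqrt c * real N powr (theta / 2)) * ((c' * c'') powr a * (ln (real N) powr (tau * a) * real N powr (- (gam * a))))"
      using 1 c by (intro mult_mono) auto
    also have "\<dots> = B * ((real N powr (theta / 2) * real N powr (- (gam * a))) * ln (real N) powr (tau * a))"
      by (simp add: B_def mult_ac)
    also have "real N powr (theta / 2) * real N powr (- (gam * a)) = real N powr (- (gam * a - theta / 2))"
      by (simp add: powr_add[symmetric])
    finally show ?case by simp
  qed
  have "(\<lambda>N. B * (real N powr (- (gam * a - theta / 2)) * ln (real N) powr (tau * a))) \<longlonglongrightarrow> B * 0"
    using rate tau a by (intro tendsto_mult tendsto_const powr_ln_tendsto_0) auto
  from Lim_null_comparison[OF le this[unfolded mult_zero_right add_0_left]] show ?thesis .
qed

text \<open>The counterpart with the upper bound for the number of knots and the bound on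
  \<open>d N\<close>. The extra 1 in \<open>Js N + 1\<close> contributes a term of order N^(theta/2
  - 1), hence the condition \<open>theta < 2\<close>.\<close>

lemma knots_upper_rate:
  assumes theta: "theta > 0" "theta < 2" and rate: "gam + theta / 2 < 1"
  shows "(\<lambda>N. sqrt (real (nn N)) * (real (Js N + 1) / real N)) \<longlonglongrightarrow> 0"
proof -
  obtain c where c: "c > 0" and nc: "\<forall>\<^sub>F N in sequentially. real (nn N) \<le> c * real N powr theta"
    using landau_o.bigE[OF nn] by auto
  from Js have "(\<lambda>N. real (Js N)) \<in> O(\<lambda>N. real N powr gam * d N)" by (rule bigthetaD1)
  then obtain c' where c': "c' > 0" and Jc: "\<forall>\<^sub>F N in sequentially. norm (real (Js N)) \<le> c' * norm (real N powr gam * d N)"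
    by (rule landau_o.bigE)
  obtain c'' where c'': "c'' > 0" and dc: "\<forall>\<^sub>F N in sequentially. norm (d N + 1 / d N) \<le> c'' * norm (ln (real N) powr tau)"
    using landau_o.bigE[OF d] by auto
  have le: "\<forall>\<^sub>F N in sequentially. norm (sqrt (real (nn N)) * (real (Js N + 1) / real N))
     \<le> sqrt c * (c' * c'' * (real N powr (- (1 - gam - theta / 2)) * ln (real N) powr tau) + real N powr (- (1 - theta / 2)))"
    using nc Jc dc eventually_gt_at_top[of 1]
  proof eventually_elim
    case (elim N)
    have N: "real N > 0" using elim by simp
    have dN: "d N \<le> c'' * ln (real N) powr tau" using elim(3) d_pos[of N] by (smt (verit) divide_pos_pos real_norm_def powr_ge_zero)
    have "real (Js N) \<le> c' * (real N powr gam * d N)" using elim(2) d_pos[of N] by (simp add: abs_mult)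
    also have "\<dots> \<le> c' * (real N powr gam * (c'' * ln (real N) powr tau))"
      using dN c' by (intro mult_left_mono) auto
    finally have J: "real (Js N + 1) \<le> c' * (real N powr gam * (c'' * ln (real N) powr tau)) + 1" by simp
    have "sqrt (real (nn N)) \<le> sqrt (c * real N powr theta)" using elim(1) by simp
    also have "\<dots> = sqrt c * real N powr (theta / 2)"
      by (simp add: real_sqrt_mult powr_half_sqrt[symmetric] powr_powr)
    finally have "sqrt (real (nn N)) * (real (Js N + 1) / real N)
       \<le> (sqrt c * real N powr (theta / 2)) * ((c' * (real N powr gam * (c'' * ln (real N) powr tau)) + 1) / real N)"
      using J c by (intro mult_mono divide_right_mono) auto
    also have "\<dots> = (sqrt c * real N powr (theta / 2)) * ((c' * (real N powr gam * (c'' * ln (real N) powr tau)) + 1) * real N powr (-1))"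
      using N by (simp add: powr_minus_divide)
    also have "\<dots> = sqrt c * (c' * c'' * ((real N powr (theta / 2) * real N powr gam * real N powr (-1)) * ln (real N) powr tau)
        + real N powr (theta / 2) * real N powr (-1))"
      by (simp add: algebra_simps)
    also have "real N powr (theta / 2) * real N powr gam * real N powr (-1) = real N powr (- (1 - gam - theta / 2))"
      by (simp only: powr_add[symmetric]) (rule arg_cong[of _ _ "(powr) (real N)"], simp)
    also have "real N powr (theta / 2) * real N powr (-1) = real N powr (- (1 - theta / 2))"
      by (simp only: powr_add[symmetric]) (rule arg_cong[of _ _ "(powr) (real N)"], simp)
    finally show ?case by simp
  qed
  have "(\<lambda>N. real N powr (- (1 - theta / 2))) \<longlonglongrightarrow> 0"
    by (rule tendsto_neg_powr[OF _ filterlim_real_sequentially]) (use theta in simp)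
  then have "(\<lambda>N. sqrt c * (c' * c'' * (real N powr (- (1 - gam - theta / 2)) * ln (real N) powr tau) + real N powr (- (1 - theta / 2))))
     \<longlonglongrightarrow> sqrt c * (c' * c'' * 0 + 0)"
    using rate tau by (intro tendsto_mult tendsto_add tendsto_const powr_ln_tendsto_0) auto
  from Lim_null_comparison[OF le this[unfolded mult_zero_right add_0_left]] show ?thesis .
qed

end

theorem theorem2:
  fixes M :: "'a measure"
    and xi eps Uxi Ueps :: "nat \<Rightarrow> nat \<Rightarrow> 'a \<Rightarrow> real"
    and m sig C :: "real \<Rightarrow> real"
    and phi psi :: "nat \<Rightarrow> real \<Rightarrow> real" and lam :: "nat \<Rightarrow> real"
    and nn Js kn :: "nat \<Rightarrow> nat" and d :: "nat \<Rightarrow> real"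
    and p q :: nat
    and h0 mu nu M_sigma M0 theta omg c1 c2 gamma1 gamma2 beta1 beta2 gam tau :: real
  assumes M: "prob_space M"
    \<comment> \<open>scores: measurable, mean 0, uncorrelated, variance 1, i.i.d. across i\<close>
    and xi_rv: "\<And>i k. xi i k \<in> borel_measurable M"
    and xi_mean: "\<And>i k. i \<ge> 1 \<Longrightarrow> k \<ge> 1 \<Longrightarrow> integrable M (xi i k) \<and> integral\<^sup>L M (xi i k) = 0"
    and xi_cov: "\<And>i k l. i \<ge> 1 \<Longrightarrow> k \<ge> 1 \<Longrightarrow> l \<ge> 1 \<Longrightarrow>
        integrable M (\<lambda>\<omega>. xi i k \<omega> * xi i l \<omega>) \<and>
        integral\<^sup>L M (\<lambda>\<omega>. xi i k \<omega> * xi i l \<omega>) = (if k = l then 1 else 0)"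
    and xi_indep: "prob_space.indep_vars M (\<lambda>_. Pi\<^sub>M {1..} (\<lambda>_. borel))
        (\<lambda>i \<omega>. restrict (\<lambda>k. xi i k \<omega>) {1..}) {1..}"
    and xi_ident: "\<And>i. i \<ge> 1 \<Longrightarrow>
        distr M (Pi\<^sub>M {1..} (\<lambda>_. borel)) (\<lambda>\<omega>. restrict (\<lambda>k. xi i k \<omega>) {1..})
      = distr M (Pi\<^sub>M {1..} (\<lambda>_. borel)) (\<lambda>\<omega>. restrict (\<lambda>k. xi 1 k \<omega>) {1..})"
    \<comment> \<open>errors: i.i.d., mean 0, variance 1, independent of the Z_i\<close>
    and eps_rv: "\<And>i j. eps i j \<in> borel_measurable M"
    and eps_mom: "\<And>i j. i \<ge> 1 \<Longrightarrow> j \<ge> 1 \<Longrightarrow> integrable M (eps i j) \<and> integral\<^sup>L M (eps i j) = 0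
        \<and> integrable M (\<lambda>\<omega>. (eps i j \<omega>)\<^sup>2) \<and> integral\<^sup>L M (\<lambda>\<omega>. (eps i j \<omega>)\<^sup>2) = 1"
    and eps_indep: "prob_space.indep_vars M (\<lambda>_. borel) (\<lambda>(i, j). eps i j) ({1..} \<times> {1..})"
    and eps_ident: "\<And>i j. i \<ge> 1 \<Longrightarrow> j \<ge> 1 \<Longrightarrow> distr M borel (eps i j) = distr M borel (eps 1 1)"
    and xi_eps_indep: "prob_space.indep_var M
        (Pi\<^sub>M ({1..} \<times> {1..}) (\<lambda>_. borel)) (\<lambda>\<omega>. restrict (\<lambda>(i, k). xi i k \<omega>) ({1..} \<times> {1..}))
        (Pi\<^sub>M ({1..} \<times> {1..}) (\<lambda>_. borel)) (\<lambda>\<omega>. restrict (\<lambda>(i, j). eps i j \<omega>) ({1..} \<times> {1..}))"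
    \<comment> \<open>phi_k = sqrt(lambda_k) psi_k, psi_k orthonormal eigenfunctions of G, G stationary\<close>
    and phi_eig: "\<And>k x. k \<ge> 1 \<Longrightarrow> x \<in> {0..1} \<Longrightarrow> phi k x = sqrt (lam k) * psi k x"
    and psi_on: "\<And>k l. k \<ge> 1 \<Longrightarrow> l \<ge> 1 \<Longrightarrow>
        integral {0..1} (\<lambda>x. psi k x * psi l x) = (if k = l then 1 else 0)"
    and psi_eigen: "\<And>k x. k \<ge> 1 \<Longrightarrow> x \<in> {0..1} \<Longrightarrow>
        integral {0..1} (\<lambda>x'. Gcov M xi phi x x' * psi k x') = lam k * psi k x"
    and stationary: "\<And>x x'. x \<in> {0..1} \<Longrightarrow> x' \<in> {0..1} \<Longrightarrow> Gcov M xi phi x x' = C \<bar>x - x'\<bar>"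
    and h0: "0 < h0" "h0 < 1"
    \<comment> \<open>(A1)\<close>
    and A1: "in_holder q mu m" "q > 0" "0 < mu" "mu \<le> 1"
    \<comment> \<open>(A2)\<close>
    and A2: "in_holder 0 nu sig" "0 < nu" "nu \<le> 1"
        "\<And>x. x \<in> {0..1} \<Longrightarrow> sig x \<le> M_sigma"
        "\<And>h. h \<in> {0..h0} \<Longrightarrow> \<bar>C h\<bar> \<le> M0"
    \<comment> \<open>(A3)\<close>
    and A3: "filterlim nn at_top sequentially" "theta > 0"
        "(\<lambda>N. real (nn N)) \<in> O(\<lambda>N. real N powr theta)"
    \<comment> \<open>(A4)\<close>
    and A4: "\<And>k. k \<ge> 1 \<Longrightarrow> in_holder q mu (phi k)"
        "summable (\<lambda>k. holder_norm q mu (phi (Suc k)))"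
        "summable (\<lambda>k. sup_norm01 (phi (Suc k)))"
        "strict_mono kn"
        "(\<lambda>n. \<Sum>k. sup_norm01 (phi (k + kn n + 1))) \<in> o(\<lambda>n. real n powr (-1/2))"
        "omg > 0" "(\<lambda>n. real (kn n)) \<in> O(\<lambda>n. real n powr omg)"
    \<comment> \<open>(A5)\<close>
    and A5: "c1 > 0" "c2 > 0" "gamma1 > 1" "gamma2 > 1"
        "0 < beta1" "beta1 < 1/2" "0 < beta2" "beta2 < 1/2"
        "min (2 * (1 - beta2) * (real q + mu) / (3 + (1 + beta1) * (real q + mu)))
             (2 * (nu - beta2) / (1 + beta1)) > theta"
        "prob_space.indep_vars M (\<lambda>_. borel) (\<lambda>(i, j). Ueps i j) ({1..} \<times> {1..})"
        "\<And>i j. i \<ge> 1 \<Longrightarrow> j \<ge> 1 \<Longrightarrow> distributed M lborel (Ueps i j) (\<lambda>x. ennreal (std_normal_density x))"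
        "prob_space.indep_vars M (\<lambda>_. borel) (\<lambda>(i, k). Uxi i k) ({1..} \<times> {1..})"
        "\<And>i k. i \<ge> 1 \<Longrightarrow> k \<ge> 1 \<Longrightarrow> distributed M lborel (Uxi i k) (\<lambda>x. ennreal (std_normal_density x))"
        "\<And>n. n \<ge> 1 \<Longrightarrow> measure M {\<omega>\<in>space M. \<exists>k\<in>{1..kn n}. \<exists>t\<in>{1..n}.
             \<bar>\<Sum>i=1..t. xi i k \<omega> - Uxi i k \<omega>\<bar> > real n powr beta1} < c1 * real n powr (- gamma1)"
        "\<And>N. N \<ge> 1 \<Longrightarrow> measure M {\<omega>\<in>space M. \<exists>i\<in>{1..nn N}. \<exists>t\<in>{1..N}.
             \<bar>\<Sum>j=1..t. eps i j \<omega> - Ueps i j \<omega>\<bar> > real N powr beta2} < c2 * real N powr (- gamma2)"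
    \<comment> \<open>(A6)\<close>
    and A6: "real p \<ge> real q + mu"
        "(\<lambda>N. real (Js N)) \<in> \<Theta>(\<lambda>N. real N powr gam * d N)"
        "\<And>N. d N > 0" "tau > 0"
        "(\<lambda>N. d N + 1 / d N) \<in> O(\<lambda>N. ln (real N) powr tau)"
        "Max {5 * theta / (4 * (real q + mu)),
              (theta + 8 * theta * beta1 / (gamma1 + 1 + omg)) / (2 * (real q + mu)),
              1 - nu} < gam"
        "gam < 1 - theta / 2 - beta2 - theta / 2 * beta1"
  shows "o_prob M
     (\<lambda>N \<omega>. SUP h\<in>{0..h0}.
        \<bar>cov_est (nn N) (Zhat p (Js N) N (nn N) (\<lambda>i j. Yobs m sig xi phi eps N i j \<omega>)) h - C h
          - (cov_est (nn N) (\<lambda>i x. Zproc xi phi i x \<omega>) h - C h)\<bar>)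
     (\<lambda>N. real (nn N) powr (-1/2))"
proof -
  interpret prob_space M by (rule M)
  define a where "a = real q + mu"
  have a: "a > 1" using A1(2,3) unfolding a_def by linarith
  have pq: "p > q" "p \<ge> 2" using A6(1) A1(2,3) by linarith+
  define phi' where "phi' k = phi (Suc k)" for k
  \<comment> \<open>The sup norm bounds the eigenfunction and the Hoelder norm its spline
    approximation error; both are summable by assumption (A4).\<close>
  define w where "w k = sup_norm01 (phi' k) + holder_norm q mu (phi' k)" for k
  have hol: "in_holder q mu (phi' k)" for k unfolding phi'_def by (rule A4(1)) simp
  have cont: "continuous_on {0..1} (phi' k)" for k by (rule in_holder_continuous[OF hol A1(2)])
  have sup0: "0 \<le> sup_norm01 (phi' k)" for k
    using order.trans[OF abs_ge_zero sup_norm01_bound[OF cont, of 0]] by simp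
  have hol0: "0 \<le> holder_norm q mu (phi' k)" for k using holder_norm_bound[OF hol] by blast
  have ws: "summable w" unfolding w_def phi'_def by (intro summable_add A4(2,3))
  interpret W: weighted_series phi' w
  proof
    show "\<bar>phi' k t\<bar> \<le> w k" if "t \<in> {0..1}" for k t
      using sup_norm01_bound[OF cont that, of k] hol0[of k] by (simp add: w_def)
  qed (use sup0 hol0 ws cont in \<open>auto simp: w_def\<close>)
  obtain D where D: "holder_derivs 0 sig D"
      "\<forall>x\<in>{0..1}. \<forall>y\<in>{0..1}. \<bar>D 0 x - D 0 y\<bar> \<le> holder_norm 0 nu sig * \<bar>x - y\<bar> powr nu"
    and h0s: "holder_norm 0 nu sig \<ge> 0"
    using holder_norm_bound[OF A2(1)] by blast
  \<comment> \<open>A two-sided bound for \<open>sig\<close> is required; Hoelder continuity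
    supplies it from the value at 0.\<close>
  define Ms where "Ms = \<bar>sig 0\<bar> + holder_norm 0 nu sig"
  have Ms: "\<bar>sig t\<bar> \<le> Ms" if t: "t \<in> {0..1}" for t
  proof -
    have "\<bar>sig t - sig 0\<bar> \<le> holder_norm 0 nu sig * \<bar>t - 0\<bar> powr nu"
      using D(2)[rule_format, of t 0] D(1) t by (simp add: holder_derivs_def)
    also have "\<dots> \<le> holder_norm 0 nu sig * 1"
      by (intro mult_left_mono powr_le1) (use t A2(2) h0s in auto)
    finally show ?thesis unfolding Ms_def by linarith
  qed
  define c where "c = spline_const p"
  define r where "r N = real (Js N + 1) / real N" for N
  \<comment> \<open>The constant of spline approximation is absorbed here, so that the approximation
    error of each eigenfunction is at most \<open>rho N * w k\<close>.\<close>
  define rho where "rho N = real p ^ Suc q * (1 / real (Js N + 1)) powr a" for N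
  define F where "F N = (12 * c + 13) * (W.wtotal * W.wtotal + 1) * (sqrt (real (nn N)) * rho N)
    + 2 * c\<^sup>2 * Ms\<^sup>2 * (sqrt (real (nn N)) * r N)
    + (W.wtotal + c\<^sup>2 * W.wtotal * Ms\<^sup>2) * sqrt (r N)
    + 2 * c * (W.wtotal * W.wtotal + Ms\<^sup>2) * (1 / sqrt (real (nn N)))" for N
  \<comment> \<open>The first condition makes the bias negligible: 5/4 already exceeds the required
    1/2 as the factor of theta. The second does the same for the squared noise, since
    \<open>beta1\<close> and \<open>beta2\<close> are positive.\<close>
  have gam: "theta / 2 < gam * a" "gam + theta / 2 < 1" "theta < 2"
  proof -
    have 1: "5 * theta / (4 * a) < gam" using A6(6) by (simp add: a_def)
    have "theta / 2 < 5 * theta / 4" using A3(2) by simp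
    also have "\<dots> < gam * a" using 1 a by (simp add: field_simps)
    finally show "theta / 2 < gam * a" .
    have "0 \<le> theta / 2 * beta1" using A3(2) A5(5) by simp
    then show "gam + theta / 2 < 1" using A6(7) A5(7) by linarith
    moreover have "gam > 0" using 1 a A3(2) by (smt (verit) divide_pos_pos)
    ultimately show "theta < 2" by linarith
  qed
  have nn_pos: "\<forall>\<^sub>F N in sequentially. nn N \<ge> 1"
    using A3(1) by (auto simp: filterlim_at_top)
  have sqrt_nn: "filterlim (\<lambda>N. sqrt (real (nn N))) at_top sequentially"
    by (intro filterlim_compose[OF sqrt_at_top] filterlim_compose[OF filterlim_real_sequentially] A3(1))
  have lim1: "(\<lambda>N. sqrt (real (nn N)) * (1 / real (Js N + 1)) powr a) \<longlonglongrightarrow> 0"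
    using knots_lower_rate[OF A3(3) A6(2,3,4,5) _ gam(1)] a by simp
  have lim2: "(\<lambda>N. sqrt (real (nn N)) * r N) \<longlonglongrightarrow> 0"
    unfolding r_def by (rule knots_upper_rate[OF A3(3) A6(2,3,4,5) A3(2) gam(3,2)])
  have lim_rho: "(\<lambda>N. sqrt (real (nn N)) * rho N) \<longlonglongrightarrow> 0"
    using tendsto_mult_left[OF lim1, of "real p ^ Suc q"] by (simp add: rho_def mult_ac)
  \<comment> \<open>Eventually \<open>sqrt n\<close> is at least 1, so the scaled limits also yield
    the limits of \<open>rho\<close> and \<open>r\<close> themselves.\<close>
  have le_scaled: "\<forall>\<^sub>F N in sequentially. norm (f N) \<le> sqrt (real (nn N)) * f N" if "\<And>N. f N \<ge> 0" for f :: "nat \<Rightarrow> real"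
    using nn_pos
  proof eventually_elim
    case (elim N)
    then have "1 \<le> sqrt (real (nn N))" by simp
    from mult_right_mono[OF this that[of N]] show ?case using that[of N] by simp
  qed
  have rho0: "rho N \<ge> 0" and r0: "r N \<ge> 0" for N by (simp_all add: rho_def r_def)
  have rho_lim: "rho \<longlonglongrightarrow> 0" by (rule Lim_null_comparison[OF le_scaled[OF rho0] lim_rho])
  have r_lim: "r \<longlonglongrightarrow> 0" by (rule Lim_null_comparison[OF le_scaled[OF r0] lim2])
  have "(\<lambda>N. 1 / sqrt (real (nn N))) \<longlonglongrightarrow> 0"
    by (rule tendsto_divide_0[OF tendsto_const filterlim_at_top_imp_at_infinity[OF sqrt_nn]])
  then have "F \<longlonglongrightarrow> (12 * c + 13) * (W.wtotal * W.wtotal + 1) * 0 + 2 * c\<^sup>2 * Ms\<^sup>2 * 0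
      + (W.wtotal + c\<^sup>2 * W.wtotal * Ms\<^sup>2) * sqrt 0 + 2 * c * (W.wtotal * W.wtotal + Ms\<^sup>2) * 0"
    unfolding F_def by (intro tendsto_add tendsto_mult tendsto_const tendsto_real_sqrt lim_rho lim2 r_lim)
  then have F: "F \<longlonglongrightarrow> 0" by simp
  \<comment> \<open>The bound at one sample size that is large enough. The condition
    \<open>real p * r N \<le> 1\<close> says that \<open>N\<close> is at least
    \<open>p * (Js N + 1)\<close>, as the norm equivalence requires.\<close>
  have tail: "\<exists>A\<in>sets M. {\<omega>\<in>space M. \<bar>SUP h\<in>{0..h0}.
        \<bar>cov_est (nn N) (Zhat p (Js N) N (nn N) (\<lambda>i j. Yobs m sig xi phi eps N i j \<omega>)) h - C h
          - (cov_est (nn N) (\<lambda>i x. Zproc xi phi i x \<omega>) h - C h)\<bar>\<bar> > e * real (nn N) powr (-1/2)} \<subseteq> A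
        \<and> measure M A \<le> F N / ((1 - h0) * e)"
    if N: "real p * r N \<le> 1" "N \<ge> 1" "nn N \<ge> 1" "rho N \<le> 1" and e: "e > 0" for N e
  proof -
    have "real p * real (Js N + 1) \<le> real N" using N(1,2) by (simp add: r_def pos_divide_le_eq)
    then have NJ: "N \<ge> p * (Js N + 1)" by (metis of_nat_le_iff of_nat_mult)
    obtain K B where basis: "spline_basis p (Js N) N K B"
      using spline_basis_exists[OF pq(2) NJ] by blast
    define X where "X i k = xi i (Suc k)" for i k
    have XX: "integrable M (\<lambda>\<omega>. X i k \<omega> * X i' k \<omega>) \<and> integral\<^sup>L M (\<lambda>\<omega>. X i k \<omega> * X i' k \<omega>) = (if i = i' then 1 else 0)"
      if "i \<ge> 1" "i' \<ge> 1" for i i' k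
      unfolding X_def by (rule score_moments[OF xi_indep xi_mean xi_cov that]) simp_all
    have EE: "integrable M (\<lambda>\<omega>. eps i j \<omega> * eps i' j' \<omega>) \<and>
        integral\<^sup>L M (\<lambda>\<omega>. eps i j \<omega> * eps i' j' \<omega>) = (if (i, j) = (i', j') then 1 else 0)"
      if "i \<ge> 1" "i' \<ge> 1" "j \<ge> 1" "j' \<ge> 1" for i i' j j'
      by (rule error_moments[OF eps_indep eps_mom that])
    have XE: "integrable M (\<lambda>\<omega>. (X i k \<omega> * eps i j \<omega>) * (X i' k \<omega> * eps i' j' \<omega>)) \<and>
        integral\<^sup>L M (\<lambda>\<omega>. (X i k \<omega> * eps i j \<omega>) * (X i' k \<omega> * eps i' j' \<omega>)) = (if (i, j) = (i', j') then 1 else 0)"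
      if "i \<ge> 1" "i' \<ge> 1" "j \<ge> 1" "j' \<ge> 1" for i i' j j' k
      using score_error_moments[OF xi_eps_indep XX[OF that(1,2), unfolded X_def] EE[OF that] that, of k]
      by (simp add: X_def)
    have approx: "\<exists>g\<in>spline_space p (Js N). \<forall>t\<in>{0..1}. \<bar>phi' k t - g t\<bar> \<le> rho N * w k" for k
    proof -
      obtain g where g: "g \<in> spline_space p (Js N)" and le: "\<forall>x\<in>{0..1}.
          \<bar>phi' k x - g x\<bar> \<le> real p ^ Suc q * holder_norm q mu (phi' k) * (1 / real (Js N + 1)) powr (real q + mu)"
        using in_holder_spline_approx[OF hol A1(3,2) pq(1)] by blast
      have "real p ^ Suc q * holder_norm q mu (phi' k) * (1 / real (Js N + 1)) powr (real q + mu) = rho N * holder_norm q mu (phi' k)"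
        by (simp add: rho_def a_def mult_ac)
      also have "\<dots> \<le> rho N * w k" using sup0[of k] rho0[of N] by (intro mult_left_mono) (auto simp: w_def)
      finally show ?thesis using g le by (meson order_trans)
    qed
    have rho_pos: "0 < rho N" using pq by (simp add: rho_def)
    have n0: "nn N > 0" using N by simp
    interpret S: random_sample p "Js N" N K B phi' w M "nn N" X eps sig Ms "rho N"
      by (rule random_sample.intro[OF basis W.weighted_series_axioms M
          random_sample_axioms.intro[OF n0 rho_pos N(4) approx Ms XX EE XE]])
    have Z: "W.series (S.scores \<omega> i) = (\<lambda>x. Zproc xi phi i x \<omega>)" for \<omega> i
      by (simp add: W.series_def[abs_def] S.scores_def[abs_def] Zproc_def X_def phi'_def)
    have Y: "(\<lambda>i j. grid N m j + grid N (\<lambda>x. Zproc xi phi i x \<omega>) j + S.noise \<omega> i j) = (\<lambda>i j. Yobs m sig xi phi eps N i j \<omega>)" for \<omega>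
      by (simp add: Yobs_def grid_def S.noise_def fun_eq_iff)
    define s where "s = sqrt (r N / real (nn N))"
    define u where "u = sqrt (real (nn N))"
    have u: "u > 0" using n0 by (simp add: u_def)
    have s: "s > 0" using N n0 by (simp add: s_def r_def)
    have half: "real (nn N) powr (-1/2) = 1 / u"
      using n0 by (simp add: u_def powr_half_sqrt[symmetric] powr_minus_divide)
    have ce: "e * real (nn N) powr (-1/2) > 0" using e n0 by simp
    obtain A where A: "A \<in> sets M" "{\<omega>\<in>space M. \<bar>SUP h\<in>{0..h0}.
        \<bar>cov_est (nn N) (Zhat p (Js N) N (nn N) (\<lambda>i j. Yobs m sig xi phi eps N i j \<omega>)) h - C h
          - (cov_est (nn N) (\<lambda>i x. Zproc xi phi i x \<omega>) h - C h)\<bar>\<bar> > e * real (nn N) powr (-1/2)} \<subseteq> A"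
      "measure M A \<le> S.mean_bound s / ((1 - h0) * (e * real (nn N) powr (-1/2)))"
      using S.covariance_error_tail[OF h0 s ce, of m C, unfolded Z Y] by (elim bexE conjE) (rule that)
    have "S.mean_bound s / ((1 - h0) * (e * real (nn N) powr (-1/2))) = (u * S.mean_bound s) / ((1 - h0) * e)"
      unfolding half using u by (simp add: field_simps)
    also have "\<dots> \<le> F N / ((1 - h0) * e)"
      using S.mean_bound_scaled h0 e unfolding F_def s_def r_def c_def u_def
      by (intro divide_right_mono) auto
    finally show ?thesis using A by (intro bexI[of _ A]) auto
  qed
  show ?thesis
    unfolding o_prob_def
  proof (intro allI impI)
    fix e \<delta> :: real assume e: "e > 0" and \<delta>: "\<delta> > 0"
    have "\<forall>\<^sub>F N in sequentially. F N < \<delta> * ((1 - h0) * e)"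
      by (rule order_tendstoD(2)[OF F]) (use e \<delta> h0 in simp)
    moreover have "(\<lambda>N. real p * r N) \<longlonglongrightarrow> real p * 0" by (intro tendsto_mult tendsto_const r_lim)
    then have "\<forall>\<^sub>F N in sequentially. real p * r N < 1" by (rule order_tendstoD(2)) simp
    moreover have "\<forall>\<^sub>F N in sequentially. rho N < 1" by (rule order_tendstoD(2)[OF rho_lim]) simp
    ultimately show "\<forall>\<^sub>F N in sequentially. \<exists>A\<in>sets M. {\<omega>\<in>space M. \<bar>SUP h\<in>{0..h0}.
        \<bar>cov_est (nn N) (Zhat p (Js N) N (nn N) (\<lambda>i j. Yobs m sig xi phi eps N i j \<omega>)) h - C h
          - (cov_est (nn N) (\<lambda>i x. Zproc xi phi i x \<omega>) h - C h)\<bar>\<bar> > e * real (nn N) powr (-1/2)} \<subseteq> A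
        \<and> measure M A < \<delta>"
      using nn_pos eventually_ge_at_top[of 1]
    proof eventually_elim
      case (elim N)
      have "F N / ((1 - h0) * e) < \<delta>" using elim(1) e h0 by (simp add: pos_divide_less_eq)
      then show ?case using tail[of N e] elim e by (meson le_less_trans less_imp_le)
    qed
  qed
qed

end
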